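(* Let $(G,g)$ be a $3$-dimensional connected Riemannian Lie group with Lie algebra $\mathfrak{g}$ and induced inner product $\langle\cdot,\cdot\rangle$ on $\mathfrak{g}$. Then $\mathfrak{g}$ admits a $Z$-decomposition if and only if there exist an $\langle\cdot,\cdot\rangle$-orthonormal basis $(e_1,e_2,e_3)$ of $\mathfrak{g}$ and a real number $a>0$ such that the only non-zero structure constant is $C_{12}^{2}=a$. Moreover, in this case the metric $g$ is locally symmetric.
   Context: A Riemannian Lie group $(G,g)$ is a real Lie group $G$ with a left invariant Riemannian metric $g$, inducing the inner product $\langle\cdot,\cdot\rangle$ on the Lie algebra $\mathfrak{g}$. Let $\nabla$ be the Levi-Civita connection and $R(x,y)=\nabla_{[x,y]}-\nabla_x\nabla_y+\nabla_y\nabla_x$; for $x,y\in\mathfrak{g}$ (left invariant vector fields) $\nabla_x y\in\mathfrak{g}$. The metric is locally symmetric if $\nabla R=0$. Structure constants: $[e_i,e_j]=\sum_k C_{ij}^{k}e_k$; "the only non-zero structure constant" is up to the antisymmetry $C_{ji}^k=-C_{ij}^k$. Primitive holonomy: let $\mathfrak{h}$ be the Lie subalgebra of $\mathfrak{so}(\mathfrak{g},\langle\cdot,\cdot\rangle)$ generated by the endomorphisms $R(u,v)$, $u,v\in\mathfrak{g}$, and let $\mathcal{H}$ be the connected Lie subgroup of $SO(\mathfrak{g})$ with Lie algebra $\mathfrak{h}$ (the primitive holonomy group at the identity). $V$-decomposition: the orthogonal decomposition $\mathfrak{g}=V_0\oplus V_1\oplus\cdots\oplus V_k$ into $\mathcal{H}$-invariant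 subspaces, where $\mathcal{H}$ acts trivially on $V_0$ and acts irreducibly and non-trivially on each $V_i$, $i>0$ (so $\dim V_i\ge 2$ for $i>0$). $Z$-decomposition: for $i>0$ let $Z_i\subseteq\mathfrak{g}$ be the linear span of all vectors $u_1$, $\nabla_{u_1}u_2$, $\nabla_{u_1}\nabla_{u_2}u_3,\dots,\nabla_{u_1}\nabla_{u_2}\cdots\nabla_{u_l}u_{l+1}$ with $l\geq 1$ and all $u_j\in V_i$, and let $Z_0$ be the orthogonal complement of $Z_1+\cdots+Z_k$ in $\mathfrak{g}$. One then has the orthogonal splitting $\mathfrak{g}=Z_0\oplus Z_1\oplus\cdots\oplus Z_k$. One says that $\mathfrak{g}$ admits a $Z$-decomposition if this splitting is non-trivial, that is, $R\neq 0$ (so $k\ge 1$) and at least two of the summands $Z_0,Z_1,\dots,Z_k$ are non-zero; in particular $\mathfrak{g}$ does not admit a $Z$-decomposition if $R=0$ or if $Z_1=\mathfrak{g}$. *)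

theory Defs
  imports "HOL-Analysis.Analysis" "HOL-Library.Function_Algebras"
begin

text \<open>Pointwise scalar multiplication, complementing the pointwise operations of
  \<open>Function_Algebras\<close>. Vector fields, tangent vectors and endomorphisms below are functions, so
  \<open>subspace\<close>, \<open>span\<close> and \<open>\<Sum>\<close> apply to them directly.\<close>

instantiation "fun" :: (type, real_vector) real_vector
begin

definition scaleR_fun :: "real \<Rightarrow> ('a \<Rightarrow> 'b) \<Rightarrow> 'a \<Rightarrow> 'b"
  where "scaleR_fun c f = (\<lambda>x. c *\<^sub>R f x)"

instance
  by standard (auto simp: scaleR_fun_def plus_fun_def scaleR_add_right scaleR_add_left)

end


section \<open>Smooth manifolds and Lie groups\<close>

text \<open>Both notions are meant for open \<open>S\<close>.\<close>

primrec Ck_on :: "nat \<Rightarrow> 'a::real_normed_vector set \<Rightarrow> ('a \<Rightarrow> 'b::real_normed_vector) \<Rightarrow> bool" where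
  "Ck_on 0 S f \<longleftrightarrow> continuous_on S f"
| "Ck_on (Suc k) S f \<longleftrightarrow>
     f differentiable_on S \<and> (\<forall>v. Ck_on k S (\<lambda>x. frechet_derivative f (at x) v))"

definition smooth_on :: "'a::real_normed_vector set \<Rightarrow> ('a \<Rightarrow> 'b::real_normed_vector) \<Rightarrow> bool"
  where "smooth_on S f \<longleftrightarrow> (\<forall>k. Ck_on k S f)"

type_synonym ('m, 'e) atlas = "('m set \<times> ('m \<Rightarrow> 'e)) set"

definition smooth_atlas :: "('m::topological_space, 'e::euclidean_space) atlas \<Rightarrow> bool" where
  "smooth_atlas A \<longleftrightarrow>
     (\<forall>(U, \<phi>)\<in>A. open U \<and> open (\<phi> ` U) \<and> homeomorphism U (\<phi> ` U) \<phi> (inv_into U \<phi>)) \<and>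
     (\<Union>(U, \<phi>)\<in>A. U) = UNIV \<and>
     (\<forall>(U, \<phi>)\<in>A. \<forall>(V, \<psi>)\<in>A. smooth_on (\<phi> ` (U \<inter> V)) (\<psi> \<circ> inv_into U \<phi>))"

text \<open>The (in general non-commutative) group law is written additively, as in the library class
  \<open>topological_group_add\<close>: \<open>a + b\<close> is the product, \<open>- a\<close> the inverse, \<open>0\<close> the identity.
  The dimension of the group is \<open>DIM('e)\<close>.\<close>

definition lie_group ::
  "('g::{topological_group_add, t2_space, second_countable_topology}, 'e::euclidean_space) atlas \<Rightarrow> bool"
where
  "lie_group A \<longleftrightarrow> smooth_atlas A \<and>
     (\<forall>(U, \<phi>)\<in>A. \<forall>(V, \<psi>)\<in>A. \<forall>(W, \<theta>)\<in>A.
        smooth_on {(x, y). x \<in> \<phi> ` U \<and> y \<in> \<psi> ` V \<and> inv_into U \<phi> x + inv_into V \<psi> y \<in> W}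
          (\<lambda>(x, y). \<theta> (inv_into U \<phi> x + inv_into V \<psi> y))) \<and>
     (\<forall>(U, \<phi>)\<in>A. \<forall>(V, \<psi>)\<in>A.
        smooth_on {x. x \<in> \<phi> ` U \<and> - inv_into U \<phi> x \<in> V} (\<lambda>x. \<psi> (- inv_into U \<phi> x)))"

definition smooth_funs :: "('m::topological_space, 'e::euclidean_space) atlas \<Rightarrow> ('m \<Rightarrow> real) set"
  where "smooth_funs A = {f. \<forall>(U, \<phi>)\<in>A. smooth_on (\<phi> ` U) (f \<circ> inv_into U \<phi>)}"


section \<open>Tangent vectors and vector fields as derivations\<close>

text \<open>Tangent vectors and vector fields are derivations of the algebra of smooth functions,
  extended by \<open>0\<close> to all functions so that each one is represented by a unique function.\<close>

type_synonym 'm tangent = "('m \<Rightarrow> real) \<Rightarrow> real"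
type_synonym 'm vfield = "('m \<Rightarrow> real) \<Rightarrow> 'm \<Rightarrow> real"

definition tangent_space ::
  "('m::topological_space, 'e::euclidean_space) atlas \<Rightarrow> 'm \<Rightarrow> 'm tangent set" where
  "tangent_space A p = {v.
     (\<forall>f\<in>smooth_funs A. \<forall>h\<in>smooth_funs A. v (f + h) = v f + v h) \<and>
     (\<forall>c. \<forall>f\<in>smooth_funs A. v (c *\<^sub>R f) = c * v f) \<and>
     (\<forall>f\<in>smooth_funs A. \<forall>h\<in>smooth_funs A. v (f * h) = f p * v h + v f * h p) \<and>
     (\<forall>f. f \<notin> smooth_funs A \<longrightarrow> v f = 0)}"

definition vector_fields ::
  "('m::topological_space, 'e::euclidean_space) atlas \<Rightarrow> 'm vfield set" where
  "vector_fields A = {X.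
     (\<forall>f\<in>smooth_funs A. X f \<in> smooth_funs A) \<and>
     (\<forall>f\<in>smooth_funs A. \<forall>h\<in>smooth_funs A. X (f + h) = X f + X h) \<and>
     (\<forall>c. \<forall>f\<in>smooth_funs A. X (c *\<^sub>R f) = c *\<^sub>R X f) \<and>
     (\<forall>f\<in>smooth_funs A. \<forall>h\<in>smooth_funs A. X (f * h) = f * X h + X f * h) \<and>
     (\<forall>f. f \<notin> smooth_funs A \<longrightarrow> X f = 0)}"

definition value_at :: "'m vfield \<Rightarrow> 'm \<Rightarrow> 'm tangent"
  where "value_at X p = (\<lambda>f. X f p)"

definition fmult :: "('m \<Rightarrow> real) \<Rightarrow> 'm vfield \<Rightarrow> 'm vfield"
  where "fmult f X = (\<lambda>h. f * X h)"

definition bracket :: "'m vfield \<Rightarrow> 'm vfield \<Rightarrow> 'm vfield"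
  where "bracket X Y = (\<lambda>f. X (Y f) - Y (X f))"


section \<open>Left invariant fields and metrics\<close>

definition push_left :: "'g::plus \<Rightarrow> 'g tangent \<Rightarrow> 'g tangent"
  where "push_left a v = (\<lambda>f. v (\<lambda>q. f (a + q)))"

definition lie_algebra ::
  "('g::topological_group_add, 'e::euclidean_space) atlas \<Rightarrow> 'g vfield set" where
  "lie_algebra A = {X \<in> vector_fields A.
     \<forall>a p. value_at X (a + p) = push_left a (value_at X p)}"

type_synonym 'm metric = "'m \<Rightarrow> 'm tangent \<Rightarrow> 'm tangent \<Rightarrow> real"

definition metric_on :: "'m metric \<Rightarrow> 'm vfield \<Rightarrow> 'm vfield \<Rightarrow> 'm \<Rightarrow> real"
  where "metric_on g X Y = (\<lambda>p. g p (value_at X p) (value_at Y p))"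

definition riemannian_metric ::
  "('m::topological_space, 'e::euclidean_space) atlas \<Rightarrow> 'm metric \<Rightarrow> bool" where
  "riemannian_metric A g \<longleftrightarrow>
     (\<forall>p. \<forall>u\<in>tangent_space A p. \<forall>v\<in>tangent_space A p. \<forall>w\<in>tangent_space A p.
        g p (u + v) w = g p u w + g p v w) \<and>
     (\<forall>p c. \<forall>u\<in>tangent_space A p. \<forall>v\<in>tangent_space A p. g p (c *\<^sub>R u) v = c * g p u v) \<and>
     (\<forall>p. \<forall>u\<in>tangent_space A p. \<forall>v\<in>tangent_space A p. g p u v = g p v u) \<and>
     (\<forall>p. \<forall>v\<in>tangent_space A p. v \<noteq> 0 \<longrightarrow> g p v v > 0) \<and>
     (\<forall>X\<in>vector_fields A. \<forall>Y\<in>vector_fields A. metric_on g X Y \<in> smooth_funs A)"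

definition left_invariant_metric ::
  "('g::topological_group_add, 'e::euclidean_space) atlas \<Rightarrow> 'g metric \<Rightarrow> bool" where
  "left_invariant_metric A g \<longleftrightarrow> riemannian_metric A g \<and>
     (\<forall>a p. \<forall>v\<in>tangent_space A p. \<forall>w\<in>tangent_space A p.
        g (a + p) (push_left a v) (push_left a w) = g p v w)"

text \<open>The inner product on the Lie algebra, by evaluation at the identity.\<close>

definition inner_prod :: "'g::zero metric \<Rightarrow> 'g vfield \<Rightarrow> 'g vfield \<Rightarrow> real"
  where "inner_prod g X Y = g 0 (value_at X 0) (value_at Y 0)"


section \<open>Levi-Civita connection and curvature\<close>

type_synonym 'm connection = "'m vfield \<Rightarrow> 'm vfield \<Rightarrow> 'm vfield"

definition levi_civita ::
  "('m::topological_space, 'e::euclidean_space) atlas \<Rightarrow> 'm metric \<Rightarrow> 'm connection \<Rightarrow> bool" where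
  "levi_civita A g D \<longleftrightarrow>
     (\<forall>X\<in>vector_fields A. \<forall>Y\<in>vector_fields A. D X Y \<in> vector_fields A) \<and>
     (\<forall>X\<in>vector_fields A. \<forall>Y\<in>vector_fields A. \<forall>Z\<in>vector_fields A.
        D (X + Y) Z = D X Z + D Y Z \<and> D X (Y + Z) = D X Y + D X Z) \<and>
     (\<forall>f\<in>smooth_funs A. \<forall>X\<in>vector_fields A. \<forall>Y\<in>vector_fields A.
        D (fmult f X) Y = fmult f (D X Y) \<and>
        D X (fmult f Y) = fmult (X f) Y + fmult f (D X Y)) \<and>
     (\<forall>X\<in>vector_fields A. \<forall>Y\<in>vector_fields A. D X Y - D Y X = bracket X Y) \<and>
     (\<forall>X\<in>vector_fields A. \<forall>Y\<in>vector_fields A. \<forall>Z\<in>vector_fields A.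
        X (metric_on g Y Z) = metric_on g (D X Y) Z + metric_on g Y (D X Z))"

text \<open>Note the sign convention.\<close>

definition curv :: "'m connection \<Rightarrow> 'm vfield \<Rightarrow> 'm vfield \<Rightarrow> 'm vfield \<Rightarrow> 'm vfield" where
  "curv D X Y Z = D (bracket X Y) Z - D X (D Y Z) + D Y (D X Z)"

text \<open>\<open>\<nabla>R = 0\<close>, where \<open>(\<nabla>\<^sub>WR)(X,Y)Z\<close> is given by the Leibniz rule.\<close>

definition locally_symmetric ::
  "('m::topological_space, 'e::euclidean_space) atlas \<Rightarrow> 'm connection \<Rightarrow> bool" where
  "locally_symmetric A D \<longleftrightarrow>
     (\<forall>W\<in>vector_fields A. \<forall>X\<in>vector_fields A. \<forall>Y\<in>vector_fields A. \<forall>Z\<in>vector_fields A.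
        D W (curv D X Y Z) - curv D (D W X) Y Z - curv D X (D W Y) Z - curv D X Y (D W Z) = 0)"


section \<open>Primitive holonomy\<close>

text \<open>In this section \<open>L\<close> is a finite-dimensional subspace with inner product \<open>ip\<close>. Endomorphisms
  of \<open>L\<close> are functions on the ambient space that vanish outside \<open>L\<close>.\<close>

definition so_algebra ::
  "'v::real_vector set \<Rightarrow> ('v \<Rightarrow> 'v \<Rightarrow> real) \<Rightarrow> ('v \<Rightarrow> 'v) set" where
  "so_algebra L ip = {T.
     (\<forall>x\<in>L. T x \<in> L) \<and> (\<forall>x. x \<notin> L \<longrightarrow> T x = 0) \<and>
     (\<forall>x\<in>L. \<forall>y\<in>L. T (x + y) = T x + T y) \<and> (\<forall>c. \<forall>x\<in>L. T (c *\<^sub>R x) = c *\<^sub>R T x) \<and>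
     (\<forall>x\<in>L. \<forall>y\<in>L. ip (T x) y = - ip x (T y))}"

definition so_subalgebra ::
  "'v::real_vector set \<Rightarrow> ('v \<Rightarrow> 'v \<Rightarrow> real) \<Rightarrow> ('v \<Rightarrow> 'v) set \<Rightarrow> bool" where
  "so_subalgebra L ip S \<longleftrightarrow> S \<subseteq> so_algebra L ip \<and> subspace S \<and>
     (\<forall>P\<in>S. \<forall>Q\<in>S. P \<circ> Q - Q \<circ> P \<in> S)"

text \<open>The sum of \<open>\<Sum>n. T\<^sup>n z / n!\<close>, the limit being taken in the norm of \<open>L\<close>.\<close>

definition exp_endo ::
  "'v::real_vector set \<Rightarrow> ('v \<Rightarrow> 'v \<Rightarrow> real) \<Rightarrow> ('v \<Rightarrow> 'v) \<Rightarrow> 'v \<Rightarrow> 'v" where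
  "exp_endo L ip T z = (if z \<in> L then
     (THE w. w \<in> L \<and>
        (\<lambda>N. let d = w - (\<Sum>n<N. (1 / fact n) *\<^sub>R (T ^^ n) z) in ip d d) \<longlonglongrightarrow> 0)
     else 0)"

text \<open>The connected Lie subgroup of \<open>SO(L)\<close> with Lie algebra \<open>H\<close> is the subgroup generated by the
  exponentials of the elements of \<open>H\<close>; closure under inverses holds because \<open>H = -H\<close>.\<close>

inductive_set connected_subgroup ::
  "'v::real_vector set \<Rightarrow> ('v \<Rightarrow> 'v \<Rightarrow> real) \<Rightarrow> ('v \<Rightarrow> 'v) set \<Rightarrow> ('v \<Rightarrow> 'v) set"
  for L ip H where
  one: "(\<lambda>x. if x \<in> L then x else 0) \<in> connected_subgroup L ip H"
| mult: "T \<in> H \<Longrightarrow> B \<in> connected_subgroup L ip H \<Longrightarrow>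
    exp_endo L ip T \<circ> B \<in> connected_subgroup L ip H"

definition curv_endos ::
  "('g::topological_group_add, 'e::euclidean_space) atlas \<Rightarrow> 'g connection \<Rightarrow>
   ('g vfield \<Rightarrow> 'g vfield) set" where
  "curv_endos A D =
     {(\<lambda>z. if z \<in> lie_algebra A then curv D u v z else 0) | u v.
        u \<in> lie_algebra A \<and> v \<in> lie_algebra A}"

definition holonomy_algebra ::
  "('g::topological_group_add, 'e::euclidean_space) atlas \<Rightarrow> 'g metric \<Rightarrow> 'g connection \<Rightarrow>
   ('g vfield \<Rightarrow> 'g vfield) set" where
  "holonomy_algebra A g D =
     so_subalgebra (lie_algebra A) (inner_prod g) hull curv_endos A D"

definition holonomy_group ::
  "('g::topological_group_add, 'e::euclidean_space) atlas \<Rightarrow> 'g metric \<Rightarrow> 'g connection \<Rightarrow>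
   ('g vfield \<Rightarrow> 'g vfield) set" where
  "holonomy_group A g D =
     connected_subgroup (lie_algebra A) (inner_prod g) (holonomy_algebra A g D)"


section \<open>The V- and Z-decompositions\<close>

definition invariant_under :: "('v \<Rightarrow> 'v) set \<Rightarrow> 'v set \<Rightarrow> bool"
  where "invariant_under H W \<longleftrightarrow> (\<forall>h\<in>H. \<forall>w\<in>W. h w \<in> W)"

definition irreducible_under :: "('v::real_vector \<Rightarrow> 'v) set \<Rightarrow> 'v set \<Rightarrow> bool" where
  "irreducible_under H V \<longleftrightarrow> V \<noteq> {0} \<and>
     (\<forall>W. subspace W \<and> W \<subseteq> V \<and> invariant_under H W \<longrightarrow> W = {0} \<or> W = V)"

definition V_decomposition ::
  "('g::topological_group_add, 'e::euclidean_space) atlas \<Rightarrow> 'g metric \<Rightarrow> 'g connection \<Rightarrow>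
   nat \<Rightarrow> (nat \<Rightarrow> 'g vfield set) \<Rightarrow> bool" where
  "V_decomposition A g D k V \<longleftrightarrow>
     (\<forall>i\<le>k. subspace (V i) \<and> invariant_under (holonomy_group A g D) (V i)) \<and>
     (\<forall>i\<le>k. \<forall>j\<le>k. i \<noteq> j \<longrightarrow> (\<forall>x\<in>V i. \<forall>y\<in>V j. inner_prod g x y = 0)) \<and>
     span (\<Union>i\<le>k. V i) = lie_algebra A \<and>
     (\<forall>h\<in>holonomy_group A g D. \<forall>x\<in>V 0. h x = x) \<and>
     (\<forall>i\<in>{1..k}. irreducible_under (holonomy_group A g D) (V i) \<and>
        (\<exists>h\<in>holonomy_group A g D. \<exists>x\<in>V i. h x \<noteq> x))"

text \<open>The vectors \<open>\<nabla>\<^bsub>u1\<^esub> \<dots> \<nabla>\<^bsub>ul\<^esub> u\<close> with at least zero derivatives and all entries in \<open>V\<close>.\<close>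

inductive_set iterated_derivs :: "'m connection \<Rightarrow> 'm vfield set \<Rightarrow> 'm vfield set"
  for D V where
  base: "u \<in> V \<Longrightarrow> u \<in> iterated_derivs D V"
| step: "u \<in> V \<Longrightarrow> w \<in> iterated_derivs D V \<Longrightarrow> D u w \<in> iterated_derivs D V"

definition Z_part ::
  "('g::topological_group_add, 'e::euclidean_space) atlas \<Rightarrow> 'g metric \<Rightarrow> 'g connection \<Rightarrow>
   nat \<Rightarrow> (nat \<Rightarrow> 'g vfield set) \<Rightarrow> nat \<Rightarrow> 'g vfield set" where
  "Z_part A g D k V i =
     (if i = 0
      then {x \<in> lie_algebra A. \<forall>y\<in>span (\<Union>j\<in>{1..k}. span (iterated_derivs D (V j))).
              inner_prod g x y = 0}
      else span (iterated_derivs D (V i)))"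

definition admits_Z_decomposition ::
  "('g::topological_group_add, 'e::euclidean_space) atlas \<Rightarrow> 'g metric \<Rightarrow> 'g connection \<Rightarrow> bool" where
  "admits_Z_decomposition A g D \<longleftrightarrow>
     (\<exists>u\<in>lie_algebra A. \<exists>v\<in>lie_algebra A. \<exists>w\<in>lie_algebra A. curv D u v w \<noteq> 0) \<and>
     (\<exists>k V. V_decomposition A g D k V \<and>
        (\<exists>i\<le>k. \<exists>j\<le>k. i \<noteq> j \<and> Z_part A g D k V i \<noteq> {0} \<and> Z_part A g D k V j \<noteq> {0}))"


section \<open>Orthonormal bases and structure constants\<close>

text \<open>Bases are indexed by \<open>1, \<dots>, n\<close>.\<close>

definition orthonormal_basis ::
  "'v::real_vector set \<Rightarrow> ('v \<Rightarrow> 'v \<Rightarrow> real) \<Rightarrow> nat \<Rightarrow> (nat \<Rightarrow> 'v) \<Rightarrow> bool" where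
  "orthonormal_basis L ip n e \<longleftrightarrow>
     span (e ` {1..n}) = L \<and>
     (\<forall>i\<in>{1..n}. \<forall>j\<in>{1..n}. ip (e i) (e j) = (if i = j then 1 else 0))"

definition structure_constants ::
  "nat \<Rightarrow> (nat \<Rightarrow> 'm vfield) \<Rightarrow> (nat \<Rightarrow> nat \<Rightarrow> nat \<Rightarrow> real) \<Rightarrow> bool" where
  "structure_constants n e C \<longleftrightarrow>
     (\<forall>i\<in>{1..n}. \<forall>j\<in>{1..n}. bracket (e i) (e j) = (\<Sum>k=1..n. C i j k *\<^sub>R e k))"

end

theory Submission
  imports Defs
begin

text \<open>Derivations at a point are determined by three numbers (Hadamard's lemma), so the Lie algebra
  has dimension at most three and its skew endomorphisms exponentiate by Rodrigues' formula; hence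
  invariance under the holonomy group and under its Lie algebra agree. If there is a Z-decomposition,
  the holonomy moves exactly one plane \<open>V_1\<close>, and \<open>V_1\<close> is closed under \<open>\<nabla>\<close>. Its unit normal
  \<open>n\<close> satisfies \<open>R(x, y) n = 0\<close>, which makes \<open>n\<close> parallel; so \<open>\<nabla>\<^sub>x = \<mu>(x) J\<close> with \<open>J\<close> the rotation of
  \<open>V_1\<close>, the Jacobi identity gives \<open>\<mu>(n) = 0\<close>, and \<open>e2\<close> is the direction of \<open>[u, v]\<close> for a basis
  \<open>u, v\<close> of \<open>V_1\<close>. Conversely the structure constants give \<open>\<nabla>\<^sub>x = - a \<langle>x, e2\<rangle> J\<close>: the metric is
  locally the product of a line and a hyperbolic plane, where everything is explicit.\<close>

section \<open>Smooth maps between open subsets of normed spaces\<close>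

text \<open>Vector fields are derivations of the algebra of global smooth functions, so neither
  coordinates nor a basis come with the definitions. What is extracted from dimension three is an
  upper bound: four pairwise orthogonal nonzero vectors cannot exist. It turns every orthonormal
  triple into a frame, makes each skew T satisfy T^3 = - \<theta>^2 T, and leaves room for only one
  plane moved by the holonomy. The normal n is parallel because of a single curvature component:
  with w = \<nabla>_n n, the vector R(w, n) n has inner product |w|^4 with w. The Jacobi identity
  alone yields only \<mu>(n) J [u, v] = 0; here R \<noteq> 0 enters a second time, since [u, v] = 0
  would make \<mu> vanish on all brackets and hence R vanish. Local symmetry is a statement about
  all vector fields, not only the left invariant ones. The frame must therefore be shown to generate
  all fields over the smooth functions, and the curvature is computed with variable
  coefficients.\<close>

lemma Ck_on_cong:
  assumes "open S" "\<And>x. x \<in> S \<Longrightarrow> f x = g x" "Ck_on k S f"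
  shows "Ck_on k S g"
  using assms(2,3)
proof (induction k arbitrary: f g)
  case 0
  then show ?case using continuous_on_cong by fastforce
next
  case (Suc k)
  have d: "f differentiable at x" if "x \<in> S" for x
    using Suc.prems(2) that assms(1) by (simp add: differentiable_on_eq_differentiable_at)
  have "g differentiable at x" if "x \<in> S" for x
    using d[OF that] Suc.prems(1) assms(1) that
    by (meson differentiable_def has_derivative_transform_within_open)
  moreover have "frechet_derivative f (at x) = frechet_derivative g (at x)" if "x \<in> S" for x
    using frechet_derivative_transform_within_open[OF d[OF that] assms(1) that] Suc.prems(1) by blast
  moreover have "Ck_on k S (\<lambda>x. frechet_derivative g (at x) v)" for v
    using Suc.prems(2) calculation(2)
    by (auto intro: Suc.IH[of "\<lambda>x. frechet_derivative f (at x) v" "\<lambda>x. frechet_derivative g (at x) v"])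
  ultimately show ?case
    using assms(1) by (simp add: differentiable_on_eq_differentiable_at)
qed

text \<open>Trades the chosen \<open>frechet_derivative\<close> for any explicit derivative. Many
  closure rules below are inductions on \<open>k\<close> that differentiate once by the classical
  formula and then apply this rule.\<close>

lemma Ck_on_SucI:
  assumes "open S" "\<And>x. x \<in> S \<Longrightarrow> (f has_derivative f' x) (at x)"
    and "\<And>v. Ck_on k S (\<lambda>x. f' x v)"
  shows "Ck_on (Suc k) S f"
proof -
  have "frechet_derivative f (at x) v = f' x v" if "x \<in> S" for x v
    using frechet_derivative_at[OF assms(2)[OF that]] by simp
  moreover have "f differentiable_on S"
    using assms(2) by (auto simp: differentiable_on_def differentiable_def intro: has_derivative_at_withinI)
  ultimately show ?thesis
    using assms(3) Ck_on_cong[OF assms(1), of "\<lambda>x. f' x v" "\<lambda>x. frechet_derivative f (at x) v" for v]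
    by auto
qed

lemma Ck_on_Suc_has_derivative:
  assumes "Ck_on (Suc k) S f" "open S" "x \<in> S"
  shows "(f has_derivative frechet_derivative f (at x)) (at x)"
  using assms by (simp add: differentiable_on_eq_differentiable_at frechet_derivative_works)

lemma Ck_on_Suc_deriv: "Ck_on (Suc k) S f \<Longrightarrow> Ck_on k S (\<lambda>x. frechet_derivative f (at x) v)"
  by simp

lemma Ck_on_SucD: "Ck_on (Suc k) S f \<Longrightarrow> Ck_on k S f"
proof (induction k arbitrary: f)
  case 0
  then show ?case by (simp add: differentiable_imp_continuous_on)
qed (simp del: fun_upd_apply)

lemma Ck_on_continuous_on: "Ck_on k S f \<Longrightarrow> continuous_on S f"
  by (cases k) (auto simp: differentiable_imp_continuous_on)

lemma Ck_on_subset: "Ck_on k S f \<Longrightarrow> T \<subseteq> S \<Longrightarrow> Ck_on k T f"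
  by (induction k arbitrary: f) (auto intro: continuous_on_subset differentiable_on_subset)

text \<open>Being \<open>Ck_on\<close> an open set is a local condition. This permits gluing:
  functions that are cut off or extended by zero are smooth on open sets which together cover the
  domain.\<close>

lemma Ck_on_local:
  assumes "open S" "\<And>x. x \<in> S \<Longrightarrow> \<exists>T. open T \<and> x \<in> T \<and> Ck_on k T f"
  shows "Ck_on k S f"
  using assms(2)
proof (induction k arbitrary: f)
  case 0
  then show ?case
    using assms(1) by (metis Ck_on.simps(1) continuous_on_eq_continuous_at)
next
  case (Suc k)
  have "f differentiable at x" if "x \<in> S" for x
    using Suc.prems[OF that] by (auto simp: differentiable_on_eq_differentiable_at)
  moreover have "Ck_on k S (\<lambda>x. frechet_derivative f (at x) v)" for v
    using Suc.prems by (intro Suc.IH) (metis Ck_on_Suc_deriv)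
  ultimately show ?case
    using assms(1) by (simp add: differentiable_on_eq_differentiable_at)
qed

lemma Ck_on_const: "open S \<Longrightarrow> Ck_on k S (\<lambda>x. c)"
proof (induction k arbitrary: c)
  case (Suc k)
  show ?case by (rule Ck_on_SucI[where f'="\<lambda>x v. 0"]) (auto intro: Suc)
qed auto

lemma Ck_on_bounded_linear: "open S \<Longrightarrow> bounded_linear f \<Longrightarrow> Ck_on k S f"
proof (cases k)
  case (Suc j)
  assume "open S" "bounded_linear f"
  then show ?thesis unfolding Suc
    by (intro Ck_on_SucI[where f'="\<lambda>x. f"])
      (auto intro: Ck_on_const bounded_linear_imp_has_derivative)
qed (auto intro: linear_continuous_on)

lemma Ck_on_add: "open S \<Longrightarrow> Ck_on k S f \<Longrightarrow> Ck_on k S g \<Longrightarrow> Ck_on k S (\<lambda>x. f x + g x)"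
proof (induction k arbitrary: f g)
  case (Suc k)
  show ?case
    by (rule Ck_on_SucI[OF Suc.prems(1)
          has_derivative_add[OF Ck_on_Suc_has_derivative Ck_on_Suc_has_derivative]])
      (use Suc in auto)
qed (auto intro: continuous_on_add)

lemma Ck_on_sum:
  "open S \<Longrightarrow> (\<And>i. i \<in> I \<Longrightarrow> Ck_on k S (f i)) \<Longrightarrow> Ck_on k S (\<lambda>x. \<Sum>i\<in>I. f i x)"
  by (induction I rule: infinite_finite_induct) (auto intro: Ck_on_const Ck_on_add)

lemma (in bounded_linear) Ck_on_comp: "open S \<Longrightarrow> Ck_on k S g \<Longrightarrow> Ck_on k S (\<lambda>x. f (g x))"
proof (induction k arbitrary: g)
  case (Suc k)
  show ?case
    by (rule Ck_on_SucI[OF Suc.prems(1)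
          has_derivative[OF Ck_on_Suc_has_derivative]])
      (use Suc in auto)
qed (auto intro: continuous_on)

lemma (in bounded_bilinear) Ck_on_prod:
  "open S \<Longrightarrow> Ck_on k S f \<Longrightarrow> Ck_on k S g \<Longrightarrow> Ck_on k S (\<lambda>x. prod (f x) (g x))"
proof (induction k arbitrary: f g)
  case (Suc k)
  \<comment> \<open>The product rule leaves \<open>f\<close> and \<open>g\<close> themselves next to
    the derivatives, so both are also needed at the lower order \<open>k\<close>.\<close>
  have "Ck_on k S f" "Ck_on k S g"
    using Ck_on_SucD[OF Suc.prems(2)] Ck_on_SucD[OF Suc.prems(3)] .
  then show ?case
    using Suc
    by (intro Ck_on_SucI[OF Suc.prems(1)
          FDERIV[OF Ck_on_Suc_has_derivative Ck_on_Suc_has_derivative]] Ck_on_add) auto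
qed (auto intro: continuous_on)

text \<open>In the chain rule the base point \<open>g x\<close> and the direction vary together.
  Expanding the direction in \<open>Basis\<close>, whence the Euclidean domain of \<open>f\<close>,
  separates them into scalar coefficients and compositions of partial derivatives of
  \<open>f\<close> with \<open>g\<close>, which the induction hypothesis covers.\<close>

lemma Ck_on_compose:
  fixes f :: "'b::euclidean_space \<Rightarrow> 'c::real_normed_vector"
  assumes "open S" "open T" "g ` S \<subseteq> T"
  shows "Ck_on k T f \<Longrightarrow> Ck_on k S g \<Longrightarrow> Ck_on k S (\<lambda>x. f (g x))"
  using assms(3)
proof (induction k arbitrary: f g)
  case 0
  then show ?case by (auto intro: continuous_on_compose2)
next
  case (Suc k)
  have g: "(g has_derivative frechet_derivative g (at x)) (at x)" if "x \<in> S" for x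
    using Ck_on_Suc_has_derivative[OF Suc.prems(2) assms(1) that] .
  have f: "(f has_derivative frechet_derivative f (at (g x))) (at (g x))" if "x \<in> S" for x
    using Ck_on_Suc_has_derivative[OF Suc.prems(1) assms(2)] that Suc.prems(3) by auto
  have eq: "frechet_derivative f (at (g x)) (frechet_derivative g (at x) v) =
      (\<Sum>b\<in>Basis. (frechet_derivative g (at x) v \<bullet> b) *\<^sub>R frechet_derivative f (at (g x)) b)"
    if "x \<in> S" for x v
  proof -
    interpret l: linear "frechet_derivative f (at (g x))"
      using f[OF that] has_derivative_linear by blast
    show ?thesis
      by (subst euclidean_representation[symmetric]) (simp add: l.sum l.scaleR)
  qed
  have "Ck_on k S (\<lambda>x. \<Sum>b\<in>Basis. (frechet_derivative g (at x) v \<bullet> b) *\<^sub>R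
      frechet_derivative f (at (g x)) b)" for v
    using Suc assms(1)
    by (intro Ck_on_sum bounded_bilinear.Ck_on_prod[OF bounded_bilinear_scaleR]
        bounded_linear.Ck_on_comp[OF bounded_linear_inner_left] Suc.IH Ck_on_Suc_deriv)
      (auto intro: Ck_on_SucD[OF Suc.prems(2)])
  then have "Ck_on k S (\<lambda>x. frechet_derivative f (at (g x)) (frechet_derivative g (at x) v))" for v
    by (rule Ck_on_cong[OF assms(1), rotated]) (simp add: eq)
  then show ?case
    by (intro Ck_on_SucI[OF assms(1) has_derivative_compose[OF g f]]) auto
qed

lemma smooth_on_cong: "open S \<Longrightarrow> smooth_on S f \<Longrightarrow> (\<And>x. x \<in> S \<Longrightarrow> f x = g x) \<Longrightarrow> smooth_on S g"
  unfolding smooth_on_def using Ck_on_cong by blast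

lemma smooth_on_subset: "smooth_on S f \<Longrightarrow> T \<subseteq> S \<Longrightarrow> smooth_on T f"
  unfolding smooth_on_def using Ck_on_subset by blast

lemma smooth_on_local:
  "open S \<Longrightarrow> (\<And>x. x \<in> S \<Longrightarrow> \<exists>T. open T \<and> x \<in> T \<and> smooth_on T f) \<Longrightarrow> smooth_on S f"
  unfolding smooth_on_def by (metis Ck_on_local)

lemma smooth_on_const: "open S \<Longrightarrow> smooth_on S (\<lambda>x. c)"
  by (simp add: smooth_on_def Ck_on_const)

lemma smooth_on_bounded_linear: "open S \<Longrightarrow> bounded_linear f \<Longrightarrow> smooth_on S f"
  by (simp add: smooth_on_def Ck_on_bounded_linear)

lemma smooth_on_add:
  "open S \<Longrightarrow> smooth_on S f \<Longrightarrow> smooth_on S g \<Longrightarrow> smooth_on S (\<lambda>x. f x + g x)"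
  by (simp add: smooth_on_def Ck_on_add)

lemma smooth_on_mult:
  fixes f g :: "_ \<Rightarrow> real"
  shows "open S \<Longrightarrow> smooth_on S f \<Longrightarrow> smooth_on S g \<Longrightarrow> smooth_on S (\<lambda>x. f x * g x)"
  by (simp add: smooth_on_def bounded_bilinear.Ck_on_prod[OF bounded_bilinear_mult])

lemma smooth_on_compose:
  fixes f :: "'b::euclidean_space \<Rightarrow> 'c::real_normed_vector"
  shows "open S \<Longrightarrow> open T \<Longrightarrow> g ` S \<subseteq> T \<Longrightarrow> smooth_on T f \<Longrightarrow> smooth_on S g \<Longrightarrow>
    smooth_on S (\<lambda>x. f (g x))"
  by (simp add: smooth_on_def Ck_on_compose)

lemma smooth_on_inner_self:
  fixes S :: "'a::real_inner set"
  assumes "open S" shows "smooth_on S (\<lambda>x. (x - c) \<bullet> (x - c))"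
proof -
  have "smooth_on S (\<lambda>x. x + (- c))"
    by (intro smooth_on_add smooth_on_const smooth_on_bounded_linear bounded_linear_ident assms)
  then show ?thesis
    using assms
    by (simp add: smooth_on_def bounded_bilinear.Ck_on_prod[OF bounded_bilinear_inner])
qed

lemma smooth_on_Pair:
  assumes "open S" shows "smooth_on S (\<lambda>x. (a, x))"
proof -
  have "smooth_on S (\<lambda>x. (a, 0) + (0, x))"
    by (intro smooth_on_add smooth_on_const smooth_on_bounded_linear assms
        bounded_linear_Pair bounded_linear_zero bounded_linear_ident)
  then show ?thesis by simp
qed

subsection \<open>A smooth bump function\<close>

text \<open>The polynomial parameter makes the family closed under differentiation: \<open>q\<close>
  is replaced by X^2 (q - q'), written \<open>[:0, 0, 1:] * (q - pderiv q)\<close>. One induction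
  then gives smoothness of all members.\<close>

definition exp_germ :: "real poly \<Rightarrow> real \<Rightarrow> real" where
  "exp_germ q t = (if t > 0 then poly q (1 / t) * exp (- (1 / t)) else 0)"

lemma poly_mult_exp_tendsto_0: "((\<lambda>x. poly q x * exp (- x)) \<longlongrightarrow> (0::real)) at_top"
proof -
  have "((\<lambda>x. \<Sum>i\<le>degree q. coeff q i * (x ^ i / exp x)) \<longlongrightarrow> (\<Sum>i\<le>degree q. coeff q i * 0)) at_top"
    by (intro tendsto_intros tendsto_power_div_exp_0)
  then show ?thesis
    by (simp add: poly_altdef sum_distrib_right sum_divide_distrib exp_minus field_simps)
qed

lemma exp_germ_tendsto_0: "(exp_germ q \<longlongrightarrow> 0) (at 0)"
proof -
  have "((\<lambda>t. poly q (1 / t) * exp (- (1 / t))) \<longlongrightarrow> 0) (at_right 0)"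
    using filterlim_compose[OF poly_mult_exp_tendsto_0 filterlim_inverse_at_top_right]
    by (simp add: inverse_eq_divide)
  then have "(exp_germ q \<longlongrightarrow> 0) (at_right 0)"
    by (rule Lim_transform_eventually)
      (auto simp: exp_germ_def eventually_at_right_field intro: exI[of _ 1])
  moreover have "(exp_germ q \<longlongrightarrow> 0) (at_left 0)"
    by (rule Lim_transform_eventually[OF tendsto_const])
      (auto simp: exp_germ_def eventually_at_left_field intro: exI[of _ "-1"])
  ultimately show ?thesis
    by (simp add: filterlim_split_at)
qed

lemma exp_germ_has_real_derivative:
  "(exp_germ q has_real_derivative exp_germ ([:0, 0, 1:] * (q - pderiv q)) t) (at t)"
proof -
  consider "t > 0" | "t < 0" | "t = 0" by linarith
  then show ?thesis
  proof cases
    case 1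
    have "((\<lambda>t. poly q (1 / t) * exp (- (1 / t))) has_real_derivative
        exp_germ ([:0, 0, 1:] * (q - pderiv q)) t) (at t)"
      using 1 unfolding exp_germ_def
      by (auto intro!: derivative_eq_intros simp: field_simps power2_eq_square)
    then show ?thesis
      by (rule has_field_derivative_transform_within_open[where S="{0<..}"])
        (use 1 in \<open>auto simp: exp_germ_def\<close>)
  next
    case 2
    have "((\<lambda>t. 0) has_real_derivative exp_germ ([:0, 0, 1:] * (q - pderiv q)) t) (at t)"
      using 2 by (simp add: exp_germ_def)
    then show ?thesis
      by (rule has_field_derivative_transform_within_open[where S="{..<0}"])
        (use 2 in \<open>auto simp: exp_germ_def\<close>)
  next
    case 3
    \<comment> \<open>The difference quotient at 0 is again a member of the family, with polynomial
      X q, so it tends to 0.\<close>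
    have "exp_germ q h / h = exp_germ ([:0, 1:] * q) h" for h
      by (simp add: exp_germ_def)
    then show ?thesis
      using exp_germ_tendsto_0[of "[:0, 1:] * q"] 3
      by (simp add: DERIV_def exp_germ_def[of _ 0])
  qed
qed

lemma Ck_on_exp_germ: "Ck_on k UNIV (exp_germ q)"
proof (induction k arbitrary: q)
  case 0
  then show ?case
    by (auto intro!: DERIV_continuous_on[OF has_field_derivative_at_within[OF exp_germ_has_real_derivative]])
next
  case (Suc k)
  show ?case
    by (rule Ck_on_SucI[OF _ exp_germ_has_real_derivative[unfolded has_field_derivative_def]])
      (auto intro!: bounded_bilinear.Ck_on_prod[OF bounded_bilinear_mult] Suc Ck_on_const)
qed

lemma smooth_bump:
  fixes c :: "'a::euclidean_space"
  assumes "r > 0"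
  obtains \<beta> :: "'a \<Rightarrow> real" where "smooth_on UNIV \<beta>" "\<beta> c = 1" "\<And>x. x \<notin> ball c r \<Longrightarrow> \<beta> x = 0"
proof
  \<comment> \<open>The argument r^2 - |x - c|^2 is positive exactly inside the ball; the factor
    \<open>exp (1 / r\<^sup>2)\<close> normalizes the value at the centre to 1.\<close>
  let ?b = "\<lambda>x. exp (1 / r\<^sup>2) * exp_germ 1 (r\<^sup>2 + (- 1) * ((x - c) \<bullet> (x - c)))"
  have "smooth_on UNIV (\<lambda>x. r\<^sup>2 + (- 1) * ((x - c) \<bullet> (x - c)))"
    by (intro smooth_on_mult smooth_on_const smooth_on_add smooth_on_inner_self open_UNIV)
  moreover have "smooth_on UNIV (exp_germ 1)"
    by (simp add: smooth_on_def Ck_on_exp_germ)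
  ultimately have "smooth_on UNIV (\<lambda>x. exp_germ 1 (r\<^sup>2 + (- 1) * ((x - c) \<bullet> (x - c))))"
    by (rule smooth_on_compose[OF open_UNIV open_UNIV subset_UNIV, rotated])
  then show "smooth_on UNIV ?b"
    by (intro smooth_on_mult smooth_on_const open_UNIV)
  show "?b c = 1"
    using assms by (simp add: exp_germ_def flip: exp_add)
  show "?b x = 0" if "x \<notin> ball c r" for x
  proof -
    have "r\<^sup>2 \<le> (norm (x - c))\<^sup>2"
      using that assms by (intro power_mono) (auto simp: dist_norm norm_minus_commute)
    then show ?thesis by (simp add: exp_germ_def power2_norm_eq_inner)
  qed
qed

subsection \<open>Hadamard's lemma\<close>

lemma ray_in_ball:
  fixes c :: "'a::real_normed_vector"
  assumes "y \<in> ball c r" "0 \<le> t" "t \<le> (1::real)"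
  shows "c + t *\<^sub>R (y - c) \<in> ball c r"
proof -
  have "t * norm (y - c) \<le> 1 * norm (y - c)"
    using assms by (intro mult_right_mono) auto
  then show ?thesis using assms by (simp add: dist_norm norm_minus_commute)
qed

lemma continuous_on_ray:
  fixes \<phi> :: "'a::euclidean_space \<Rightarrow> real"
  assumes "continuous_on (ball c r) \<phi>"
  shows "continuous_on (ball c r \<times> cbox 0 1) (\<lambda>(y, t). t ^ m * \<phi> (c + t *\<^sub>R (y - c)))"
  unfolding split_beta
  by (intro continuous_intros continuous_on_compose2[OF assms])
    (auto intro!: ray_in_ball simp del: mem_ball)

text \<open>The power \<open>t ^ m\<close> is there for the induction: differentiating in
  \<open>y\<close> under the integral brings out one more factor \<open>t\<close>, so a derivative
  has the same form with \<open>Suc m\<close>.\<close>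

lemma Ck_on_integral_ray:
  fixes \<phi> :: "'a::euclidean_space \<Rightarrow> real"
  assumes "Ck_on k (ball c r) \<phi>"
  shows "Ck_on k (ball c r) (\<lambda>y. integral {0..1} (\<lambda>t. t ^ m * \<phi> (c + t *\<^sub>R (y - c))))"
  using assms
proof (induction k arbitrary: m \<phi>)
  case 0
  then show ?case
    using integral_continuous_on_param[OF continuous_on_ray, of c r \<phi> m] by simp
next
  case (Suc k)
  let ?p = "\<lambda>y t. c + t *\<^sub>R (y - c)"
  let ?D = "\<lambda>x. frechet_derivative \<phi> (at x)"
  let ?L = "\<lambda>y t v. t ^ Suc m * ?D (?p y t) v"
  have d: "(\<phi> has_derivative ?D x) (at x)" if "x \<in> ball c r" for x
    using Ck_on_Suc_has_derivative[OF Suc.prems _ that] by simp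
  have cD: "continuous_on (ball c r) (\<lambda>x. ?D x v)" for v
    using Ck_on_continuous_on[OF Ck_on_Suc_deriv[OF Suc.prems]] .
  have p: "?p y t \<in> ball c r" if "y \<in> ball c r" "t \<in> cbox 0 1" for y t
    using ray_in_ball[OF that(1)] that(2) by auto
  \<comment> \<open>\<open>leibniz_rule\<close> takes the derivative as a bounded linear function.
    \<open>Blinfun\<close> is known to return the intended map only where that map is bounded
    linear, hence the restriction to the ball.\<close>
  have bl: "blinfun_apply (Blinfun (?L y t)) = ?L y t" if "y \<in> ball c r" "t \<in> cbox 0 1" for y t
    using has_derivative_bounded_linear[OF d[OF p[OF that]]]
    by (intro bounded_linear_Blinfun_apply bounded_linear_const_mult)
  have c1: "continuous_on (ball c r \<times> cbox 0 1) (\<lambda>(y, t). Blinfun (?L y t))"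
    unfolding split_beta
  proof (rule continuous_on_blinfun_componentwise)
    fix i :: 'a
    show "continuous_on (ball c r \<times> cbox 0 1) (\<lambda>x. blinfun_apply (Blinfun (?L (fst x) (snd x))) i)"
      using continuous_on_ray[OF cD[of i], of "Suc m"]
      by (rule continuous_on_eq) (auto simp: bl simp del: mem_ball power_Suc)
  qed
  have d1: "((\<lambda>y. integral (cbox 0 1) (\<lambda>t. t ^ m * \<phi> (?p y t))) has_derivative
      integral (cbox 0 1) (\<lambda>t. Blinfun (?L y t))) (at y within ball c r)" if y: "y \<in> ball c r" for y
  proof (rule leibniz_rule[OF _ _ c1 y])
    show "((\<lambda>y. t ^ m * \<phi> (?p y t)) has_derivative blinfun_apply (Blinfun (?L x t)))
        (at x within ball c r)" if "x \<in> ball c r" "t \<in> cbox 0 1" for x t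
    proof -
      have lin: "linear (?D (?p x t))"
        using d[OF p[OF that]] has_derivative_linear by blast
      have "((\<lambda>y. ?p y t) has_derivative (\<lambda>v. t *\<^sub>R v)) (at x)"
        by (auto intro!: derivative_eq_intros)
      from has_derivative_mult_right[OF has_derivative_compose[OF this d[OF p[OF that]]], of "t ^ m"]
      have "((\<lambda>y. t ^ m * \<phi> (?p y t)) has_derivative (\<lambda>v. t ^ m * ?D (?p x t) (t *\<^sub>R v)))
          (at x within ball c r)"
        by (rule has_derivative_at_withinI)
      moreover have "(\<lambda>v. t ^ m * ?D (?p x t) (t *\<^sub>R v)) = blinfun_apply (Blinfun (?L x t))"
        unfolding bl[OF that] linear_cmul[OF lin] by (simp add: fun_eq_iff)
      ultimately show ?thesis by simp
    qed
    show "(\<lambda>t. t ^ m * \<phi> (?p x t)) integrable_on cbox 0 1" if "x \<in> ball c r" for x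
      using that
      by (intro integrable_continuous
          continuous_on_compose2[OF continuous_on_ray[OF Ck_on_continuous_on[OF Suc.prems], of m, unfolded split_beta],
            of _ "\<lambda>t. (x, t)", simplified fst_conv snd_conv])
        (auto intro!: continuous_intros)
  qed auto
  have d2: "blinfun_apply (integral (cbox 0 1) (\<lambda>t. Blinfun (?L y t))) =
      (\<lambda>v. integral {0..1} (\<lambda>t. ?L y t v))" if "y \<in> ball c r" for y
  proof
    fix v
    have "(\<lambda>t. Blinfun (?L y t)) integrable_on cbox 0 1"
      using that by (intro integrable_continuous
          continuous_on_compose2[OF c1[unfolded split_beta],
            of _ "\<lambda>t. (y, t)", simplified fst_conv snd_conv])
        (auto intro!: continuous_intros)
    from blinfun_apply_integral[OF this]
    show "blinfun_apply (integral (cbox 0 1) (\<lambda>t. Blinfun (?L y t))) v =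
        integral {0..1} (\<lambda>t. ?L y t v)"
      using that by (auto simp: bl simp del: mem_ball power_Suc intro!: integral_cong)
  qed
  have "((\<lambda>y. integral {0..1} (\<lambda>t. t ^ m * \<phi> (?p y t))) has_derivative
      (\<lambda>v. integral {0..1} (\<lambda>t. ?L y t v))) (at y)" if "y \<in> ball c r" for y
    using d1[OF that] unfolding d2[OF that] at_within_open[OF that open_ball] by simp
  then show ?case
    by (rule Ck_on_SucI[OF open_ball _ Suc.IH[OF Ck_on_Suc_deriv[OF Suc.prems]]])
qed

text \<open>Integrate the derivative of F along the segment from \<open>c\<close> to
  \<open>y\<close> and expand the direction \<open>y - c\<close> in \<open>Basis\<close>; the
  coefficient functions are the ray integrals of the partial derivatives.\<close>

lemma Hadamard_lemma:
  fixes F :: "'a::euclidean_space \<Rightarrow> real"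
  assumes "smooth_on (ball c r) F"
  obtains h :: "'a \<Rightarrow> 'a \<Rightarrow> real" where "\<And>b. smooth_on (ball c r) (h b)"
    "\<And>y. y \<in> ball c r \<Longrightarrow> F y = F c + (\<Sum>b\<in>Basis. ((y - c) \<bullet> b) * h b y)"
proof
  let ?D = "\<lambda>x. frechet_derivative F (at x)"
  let ?p = "\<lambda>y t. c + t *\<^sub>R (y - c)"
  \<comment> \<open>The factor \<open>t ^ 0\<close> only gives the integrand the shape required by
    \<open>Ck_on_integral_ray\<close>.\<close>
  let ?h = "\<lambda>b y. integral {0..1} (\<lambda>t. t ^ 0 * ?D (?p y t) b)"
  have C1: "Ck_on (Suc k) (ball c r) F" for k
    using assms unfolding smooth_on_def by blast
  then show "smooth_on (ball c r) (?h b)" for b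
    unfolding smooth_on_def using Ck_on_integral_ray[OF Ck_on_Suc_deriv] by blast
  show "F y = F c + (\<Sum>b\<in>Basis. ((y - c) \<bullet> b) * ?h b y)" if y: "y \<in> ball c r" for y
  proof -
    have p: "?p y t \<in> ball c r" if "t \<in> {0..1}" for t
      using ray_in_ball[OF y] that by auto
    have "((\<lambda>t. F (?p y t)) has_vector_derivative ?D (?p y t) (y - c)) (at t within {0..1})"
      if t: "t \<in> {0..1}" for t
    proof -
      have d: "(F has_derivative ?D (?p y t)) (at (?p y t))"
        using Ck_on_Suc_has_derivative[OF C1 _ p[OF t]] by simp
      have "((\<lambda>t. ?p y t) has_derivative (\<lambda>v. v *\<^sub>R (y - c))) (at t)"
        by (auto intro!: derivative_eq_intros)
      from has_derivative_compose[OF this d] show ?thesis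
        unfolding has_vector_derivative_def linear_cmul[OF has_derivative_linear[OF d], symmetric]
        by (rule has_derivative_at_withinI)
    qed
    then have "((\<lambda>t. ?D (?p y t) (y - c)) has_integral F (?p y 1) - F (?p y 0)) {0..1}"
      by (intro fundamental_theorem_of_calculus) auto
    moreover have "((\<lambda>t. \<Sum>b\<in>Basis. ((y - c) \<bullet> b) * ?D (?p y t) b) has_integral
        (\<Sum>b\<in>Basis. ((y - c) \<bullet> b) * ?h b y)) {0..1}"
    proof (intro has_integral_sum has_integral_mult_right finite_Basis)
      fix b :: 'a
      have "continuous_on (ball c r) (\<lambda>x. ?D x b)"
        using Ck_on_continuous_on[OF Ck_on_Suc_deriv[OF C1]] by blast
      then have "continuous_on {0..1} (\<lambda>t. ?D (?p y t) b)"
        by (rule continuous_on_compose2) (auto intro!: continuous_intros p simp del: mem_ball)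
      then show "((\<lambda>t. ?D (?p y t) b) has_integral ?h b y) {0..1}"
        using integrable_integral[OF integrable_continuous_interval] by simp
    qed
    moreover have "?D (?p y t) (y - c) = (\<Sum>b\<in>Basis. ((y - c) \<bullet> b) * ?D (?p y t) b)"
      if "t \<in> {0..1}" for t
    proof -
      interpret l: linear "?D (?p y t)"
        using Ck_on_Suc_has_derivative[OF C1 _ p[OF that]] has_derivative_linear by auto
      show ?thesis
        by (subst (5) euclidean_representation[symmetric]) (simp add: l.sum l.scaleR)
    qed
    ultimately have "F (?p y 1) - F (?p y 0) = (\<Sum>b\<in>Basis. ((y - c) \<bullet> b) * ?h b y)"
      by (metis (no_types, lifting) has_integral_cong has_integral_unique)
    then show ?thesis by simp
  qed
qed

section \<open>Smooth functions and tangent vectors\<close>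

lemma sum_fun_apply: "(\<Sum>i\<in>I. f i) x = (\<Sum>i\<in>I. f i x)"
  by (induction I rule: infinite_finite_induct) auto

locale smooth_manifold =
  fixes A :: "('m::t2_space, 'e::euclidean_space) atlas"
  assumes atlas: "smooth_atlas A"
begin

lemma chart_open: "(U, \<phi>) \<in> A \<Longrightarrow> open U" "(U, \<phi>) \<in> A \<Longrightarrow> open (\<phi> ` U)"
  using atlas by (auto simp: smooth_atlas_def)

lemma chart_homeomorphism: "(U, \<phi>) \<in> A \<Longrightarrow> homeomorphism U (\<phi> ` U) \<phi> (inv_into U \<phi>)"
  using atlas by (auto simp: smooth_atlas_def)

lemma chart_inverse: "(U, \<phi>) \<in> A \<Longrightarrow> q \<in> U \<Longrightarrow> inv_into U \<phi> (\<phi> q) = q"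
  using chart_homeomorphism by (rule homeomorphism_apply1)

lemma chart_continuous_inverse: "(U, \<phi>) \<in> A \<Longrightarrow> continuous_on (\<phi> ` U) (inv_into U \<phi>)"
  using chart_homeomorphism homeomorphism_def by blast

lemma chart_at: obtains U \<phi> where "(U, \<phi>) \<in> A" "p \<in> U"
proof -
  have "p \<in> (\<Union>(U, \<phi>)\<in>A. U)"
    using atlas by (simp add: smooth_atlas_def)
  then show ?thesis using that by auto
qed

lemma chart_transition:
  assumes "(U, \<phi>) \<in> A" "(V, \<psi>) \<in> A"
  shows "smooth_on (\<phi> ` (U \<inter> V)) (\<lambda>y. \<psi> (inv_into U \<phi> y))"
proof -
  have "\<forall>(U, \<phi>)\<in>A. \<forall>(V, \<psi>)\<in>A. smooth_on (\<phi> ` (U \<inter> V)) (\<psi> \<circ> inv_into U \<phi>)"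
    using atlas unfolding smooth_atlas_def by (elim conjE)
  from bspec[OF bspec[OF this assms(1), simplified split] assms(2)] show ?thesis
    by (simp add: o_def)
qed

lemma chart_open_image:
  assumes "(U, \<phi>) \<in> A" "open W"
  shows "open (\<phi> ` (U \<inter> W))"
proof -
  have "openin (top_of_set (\<phi> ` U)) (\<phi> ` (U \<inter> W))"
    using homeomorphism_imp_open_map[OF chart_homeomorphism[OF assms(1)]] assms(2)
    by (simp add: openin_open_Int)
  then show ?thesis
    using chart_open(2)[OF assms(1)] openin_open_trans by blast
qed

lemma smooth_funsD:
  "f \<in> smooth_funs A \<Longrightarrow> (U, \<phi>) \<in> A \<Longrightarrow> smooth_on (\<phi> ` U) (\<lambda>y. f (inv_into U \<phi> y))"
  by (auto simp: smooth_funs_def o_def)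

lemma smooth_funsI:
  assumes "\<And>U \<phi>. (U, \<phi>) \<in> A \<Longrightarrow> smooth_on (\<phi> ` U) (\<lambda>y. f (inv_into U \<phi> y))"
  shows "f \<in> smooth_funs A"
  using assms by (auto simp: smooth_funs_def o_def)

lemma smooth_funs_const: "(\<lambda>q. c) \<in> smooth_funs A"
  by (rule smooth_funsI) (rule smooth_on_const[OF chart_open(2)])

lemma smooth_funs_0: "0 \<in> smooth_funs A"
  using smooth_funs_const[of 0] by (simp add: func_zero)

lemma smooth_funs_add: "f \<in> smooth_funs A \<Longrightarrow> h \<in> smooth_funs A \<Longrightarrow> f + h \<in> smooth_funs A"
  by (rule smooth_funsI) (simp add: smooth_on_add chart_open smooth_funsD)

lemma smooth_funs_mult: "f \<in> smooth_funs A \<Longrightarrow> h \<in> smooth_funs A \<Longrightarrow> f * h \<in> smooth_funs A"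
  by (rule smooth_funsI) (simp add: smooth_on_mult chart_open smooth_funsD)

lemma smooth_funs_scaleR: "f \<in> smooth_funs A \<Longrightarrow> c *\<^sub>R f \<in> smooth_funs A"
  using smooth_funs_mult[OF smooth_funs_const[of c]] by (simp add: func_times scaleR_fun_def)

lemma smooth_funs_diff:
  assumes "f \<in> smooth_funs A" "h \<in> smooth_funs A"
  shows "f - h \<in> smooth_funs A"
  using smooth_funs_add[OF assms(1) smooth_funs_scaleR[OF assms(2), of "-1"]]
  by simp

lemma smooth_funs_sum:
  "(\<And>i. i \<in> I \<Longrightarrow> f i \<in> smooth_funs A) \<Longrightarrow> (\<Sum>i\<in>I. f i) \<in> smooth_funs A"
  by (induction I rule: infinite_finite_induct) (auto intro: smooth_funs_0 smooth_funs_add)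

text \<open>Hausdorff separation enters here: the preimage of the compact set \<open>K\<close> in
  the manifold is closed, so its complement and \<open>U\<close> form an open cover. On
  \<open>U\<close> the function is \<open>F\<close> in coordinates, on the complement it is
  zero.\<close>

lemma smooth_funs_extend_by_zero:
  assumes U: "(U, \<phi>) \<in> A" and F: "smooth_on (\<phi> ` U) F"
    and K: "compact K" "K \<subseteq> \<phi> ` U" "\<And>y. y \<notin> K \<Longrightarrow> F y = 0"
  shows "(\<lambda>q. if q \<in> U then F (\<phi> q) else 0) \<in> smooth_funs A"
proof (rule smooth_funsI)
  fix V \<psi> assume V: "(V, \<psi>) \<in> A"
  let ?f = "\<lambda>q. if q \<in> U then F (\<phi> q) else 0"
  let ?C = "inv_into U \<phi> ` K"
  have "compact ?C"
    using K chart_continuous_inverse[OF U] by (metis compact_continuous_image continuous_on_subset)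
  then have C: "open (- ?C)"
    by (simp add: compact_imp_closed open_Compl)
  have out: "F (\<phi> q) = 0" if "q \<in> U" "q \<notin> ?C" for q
    using that K(3) chart_inverse[OF U] by (metis image_eqI)
  show "smooth_on (\<psi> ` V) (\<lambda>y. ?f (inv_into V \<psi> y))"
  proof (rule smooth_on_local[OF chart_open(2)[OF V]])
    fix y assume "y \<in> \<psi> ` V"
    then obtain q where q: "q \<in> V" "y = \<psi> q" by blast
    show "\<exists>T. open T \<and> y \<in> T \<and> smooth_on T (\<lambda>y. ?f (inv_into V \<psi> y))"
    proof (cases "q \<in> U")
      case True
      have o: "open (\<psi> ` (V \<inter> U))"
        using chart_open_image[OF V chart_open(1)[OF U]] .
      have "smooth_on (\<psi> ` (V \<inter> U)) (\<lambda>y. F (\<phi> (inv_into V \<psi> y)))"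
        by (rule smooth_on_compose[OF o chart_open(2)[OF U] _ F chart_transition[OF V U]])
          (auto simp: chart_inverse[OF V])
      then have "smooth_on (\<psi> ` (V \<inter> U)) (\<lambda>y. ?f (inv_into V \<psi> y))"
        by (rule smooth_on_cong[OF o]) (auto simp: chart_inverse[OF V])
      then show ?thesis using o q True by blast
    next
      case False
      have o: "open (\<psi> ` (V \<inter> - ?C))"
        using chart_open_image[OF V C] .
      have "smooth_on (\<psi> ` (V \<inter> - ?C)) (\<lambda>y. ?f (inv_into V \<psi> y))"
        by (rule smooth_on_cong[OF o smooth_on_const[OF o, of 0]])
          (use out in \<open>auto simp: chart_inverse[OF V]\<close>)
      moreover have "q \<notin> ?C"
        using False K(2) by (auto dest: inv_into_into[OF subsetD[OF K(2)]])
      ultimately show ?thesis using o q by blast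
    qed
  qed
qed

section \<open>Tangent vectors as derivations at a point\<close>

lemma tangent_spaceD:
  assumes "v \<in> tangent_space A p"
  shows "f \<in> smooth_funs A \<Longrightarrow> h \<in> smooth_funs A \<Longrightarrow> v (f + h) = v f + v h"
    "f \<in> smooth_funs A \<Longrightarrow> v (c *\<^sub>R f) = c * v f"
    "f \<in> smooth_funs A \<Longrightarrow> h \<in> smooth_funs A \<Longrightarrow> v (f * h) = f p * v h + v f * h p"
    "f \<notin> smooth_funs A \<Longrightarrow> v f = 0"
  using assms by (auto simp: tangent_space_def)

lemma tangent_space_sum:
  assumes "v \<in> tangent_space A p" "\<And>i. i \<in> I \<Longrightarrow> f i \<in> smooth_funs A"
  shows "v (\<Sum>i\<in>I. f i) = (\<Sum>i\<in>I. v (f i))"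
proof -
  have "v 0 = 0"
    using tangent_spaceD(2)[OF assms(1) smooth_funs_0, of 0] by simp
  with assms(2) show ?thesis
    by (induction I rule: infinite_finite_induct)
      (auto simp: tangent_spaceD(1)[OF assms(1)] smooth_funs_sum)
qed

lemma subspace_tangent_space: "subspace (tangent_space A p)"
  unfolding subspace_def
  by (auto simp: tangent_space_def scaleR_fun_def algebra_simps)

text \<open>With a bump function \<open>B\<close> at \<open>p\<close>, Hadamard's lemma gives
  \<open>B * (B * f) = f p *\<^sub>R (B * B) + \<Sum>b. x b * H b\<close> with \<open>x b\<close> vanishing at \<open>p\<close> and independent
  of \<open>f\<close>, so the Leibniz rule determines \<open>v f\<close> from the numbers \<open>v (x b)\<close>.\<close>

lemma tangent_vector_coordinates:
  obtains x :: "'e \<Rightarrow> 'm \<Rightarrow> real" where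
    "\<forall>v\<in>tangent_space A p. (\<forall>b\<in>Basis. v (x b) = 0) \<longrightarrow> v = 0"
proof -
  obtain U \<phi> where U: "(U, \<phi>) \<in> A" "p \<in> U" by (rule chart_at)
  let ?c = "\<phi> p"
  obtain R where R: "R > 0" "cball ?c R \<subseteq> \<phi> ` U"
    using chart_open(2)[OF U(1)] U(2) open_contains_cball by blast
  \<comment> \<open>The bump lives on half the radius, so its product with a function known only on
    \<open>ball ?c R\<close> extends smoothly by zero, with support in a compact part of the
    chart.\<close>
  let ?K = "cball ?c (R / 2)"
  have K: "?K \<subseteq> ball ?c R" "ball ?c R \<subseteq> \<phi> ` U"
    using R by auto
  obtain \<beta> :: "'e \<Rightarrow> real" where \<beta>: "smooth_on UNIV \<beta>" "\<beta> ?c = 1"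
      "\<And>y. y \<notin> ball ?c (R / 2) \<Longrightarrow> \<beta> y = 0"
    using smooth_bump[of "R / 2" ?c] R by auto
  have \<beta>0: "\<beta> y = 0" if "y \<notin> ?K" for y
    using \<beta>(3)[of y] that by auto
  have cut: "smooth_on UNIV (\<lambda>y. if y \<in> ball ?c R then \<beta> y * k y else 0)"
    if k: "smooth_on (ball ?c R) k" for k
  proof (rule smooth_on_local[OF open_UNIV])
    fix y
    show "\<exists>T. open T \<and> y \<in> T \<and> smooth_on T (\<lambda>y. if y \<in> ball ?c R then \<beta> y * k y else 0)"
    proof (cases "y \<in> ball ?c R")
      case True
      have "smooth_on (ball ?c R) (\<lambda>y. \<beta> y * k y)"
        by (intro smooth_on_mult open_ball k smooth_on_subset[OF \<beta>(1)] subset_UNIV)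
      then have "smooth_on (ball ?c R) (\<lambda>y. if y \<in> ball ?c R then \<beta> y * k y else 0)"
        by (rule smooth_on_cong[OF open_ball]) simp
      with True show ?thesis using open_ball by blast
    next
      case False
      have o: "open (- ?K)" by (simp add: open_Compl)
      have "smooth_on (- ?K) (\<lambda>y. if y \<in> ball ?c R then \<beta> y * k y else 0)"
        by (rule smooth_on_cong[OF o smooth_on_const[OF o, of 0]]) (simp add: \<beta>0)
      moreover have "y \<in> - ?K" using False K by blast
      ultimately show ?thesis using o by blast
    qed
  qed
  define ext where "ext G q = (if q \<in> U then G (\<phi> q) else 0)" for G :: "'e \<Rightarrow> real" and q
  have ext: "ext (\<lambda>y. if y \<in> ball ?c R then \<beta> y * k y else 0) \<in> smooth_funs A"
    if "smooth_on (ball ?c R) k" for k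
    unfolding ext_def
    by (rule smooth_funs_extend_by_zero[OF U(1) smooth_on_subset[OF cut[OF that] subset_UNIV], of ?K])
      (use K \<beta>0 in auto)
  define B where "B = ext (\<lambda>y. if y \<in> ball ?c R then \<beta> y * 1 else 0)"
  define x where "x b = ext (\<lambda>y. if y \<in> ball ?c R then \<beta> y * ((y - ?c) \<bullet> b) else 0)" for b
  have B: "B \<in> smooth_funs A"
    unfolding B_def by (intro ext smooth_on_const open_ball)
  have "smooth_on (ball ?c R) (\<lambda>y. (y - ?c) \<bullet> b)" for b
  proof -
    have "smooth_on (ball ?c R) (\<lambda>y. y \<bullet> b + (- (?c \<bullet> b)))"
      by (intro smooth_on_add smooth_on_const smooth_on_bounded_linear open_ball
          bounded_linear_inner_left)
    then show ?thesis by (simp add: inner_diff_left)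
  qed
  then have x: "x b \<in> smooth_funs A" for b
    unfolding x_def by (rule ext)
  have Bp: "B p = 1" and xp: "x b p = 0" for b
    using U(2) R(1) \<beta>(2) by (auto simp: B_def x_def ext_def)
  have zero: "v f = 0" if v: "v \<in> tangent_space A p" "\<And>b. b \<in> Basis \<Longrightarrow> v (x b) = 0"
    and f: "f \<in> smooth_funs A" for v f
  proof -
    let ?F = "\<lambda>y. f (inv_into U \<phi> y)"
    have "smooth_on (ball ?c R) ?F"
      using smooth_on_subset[OF smooth_funsD[OF f U(1)] K(2)] .
    then obtain h where h: "\<And>b. smooth_on (ball ?c R) (h b)"
      "\<And>y. y \<in> ball ?c R \<Longrightarrow> ?F y = ?F ?c + (\<Sum>b\<in>Basis. ((y - ?c) \<bullet> b) * h b y)"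
      by (rule Hadamard_lemma) blast
    define H where "H b = ext (\<lambda>y. if y \<in> ball ?c R then \<beta> y * h b y else 0)" for b
    have H: "H b \<in> smooth_funs A" for b
      unfolding H_def by (intro ext h)
    \<comment> \<open>Two factors \<open>B\<close> are needed because every summand has two factors,
      a coordinate and a Hadamard coefficient, and each must be cut off separately to become
      globally smooth.\<close>
    have "B * (B * f) = f p *\<^sub>R (B * B) + (\<Sum>b\<in>Basis. x b * H b)"
    proof
      fix q
      show "(B * (B * f)) q = (f p *\<^sub>R (B * B) + (\<Sum>b\<in>Basis. x b * H b)) q"
      proof (cases "q \<in> U \<and> \<phi> q \<in> ball ?c R")
        case True
        then have "f q = f p + (\<Sum>b\<in>Basis. ((\<phi> q - ?c) \<bullet> b) * h b (\<phi> q))"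
          using h(2)[of "\<phi> q"] by (simp add: chart_inverse[OF U(1)] U(2))
        then have "\<beta> (\<phi> q) * (\<beta> (\<phi> q) * f q) = f p * (\<beta> (\<phi> q) * \<beta> (\<phi> q)) +
            (\<Sum>b\<in>Basis. (\<beta> (\<phi> q) * ((\<phi> q - ?c) \<bullet> b)) * (\<beta> (\<phi> q) * h b (\<phi> q)))"
          by (simp add: sum_distrib_left algebra_simps)
        with True show ?thesis
          by (simp add: B_def x_def H_def ext_def scaleR_fun_def sum_fun_apply del: mem_ball)
      next
        case False
        then show ?thesis
          by (auto simp add: B_def x_def H_def ext_def scaleR_fun_def sum_fun_apply simp del: mem_ball)
      qed
    qed
    \<comment> \<open>With \<open>B p = 1\<close> the Leibniz rule gives v f + 2 (f p) (v B) on the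
      left. On the right the sum contributes nothing, because both \<open>x b p\<close> and
      \<open>v (x b)\<close> vanish, and 2 (f p) (v B) remains.\<close>
    then have "v (B * (B * f)) = v (f p *\<^sub>R (B * B) + (\<Sum>b\<in>Basis. x b * H b))" by simp
    moreover have "v (\<Sum>b\<in>Basis. x b * H b) = 0"
      using x H v by (simp add: tangent_space_sum[OF v(1)] smooth_funs_mult tangent_spaceD(3)[OF v(1)] xp)
    ultimately show ?thesis
      by (simp add: tangent_spaceD[OF v(1)] B f smooth_funs_mult smooth_funs_sum smooth_funs_scaleR
          x H Bp)
  qed
  show ?thesis
  proof (intro that ballI impI HOL.ext)
    fix v f assume v: "v \<in> tangent_space A p" "\<forall>b\<in>Basis. v (x b) = 0"
    show "v f = 0 f"
      using zero[OF v(1) bspec[OF v(2)]] tangent_spaceD(4)[OF v(1)] by (cases "f \<in> smooth_funs A") auto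
  qed
qed

section \<open>The metric at a point and the dimension bound\<close>

lemma metric_add:
  "riemannian_metric A g \<Longrightarrow> u \<in> tangent_space A p \<Longrightarrow> v \<in> tangent_space A p \<Longrightarrow>
    w \<in> tangent_space A p \<Longrightarrow> g p (u + v) w = g p u w + g p v w"
  unfolding riemannian_metric_def by blast

lemma metric_scaleR:
  "riemannian_metric A g \<Longrightarrow> u \<in> tangent_space A p \<Longrightarrow> v \<in> tangent_space A p \<Longrightarrow>
    g p (c *\<^sub>R u) v = c * g p u v"
  unfolding riemannian_metric_def by blast

lemma metric_commute:
  "riemannian_metric A g \<Longrightarrow> u \<in> tangent_space A p \<Longrightarrow> v \<in> tangent_space A p \<Longrightarrow>
    g p u v = g p v u"
  unfolding riemannian_metric_def by blast

lemma metric_pos: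
  "riemannian_metric A g \<Longrightarrow> v \<in> tangent_space A p \<Longrightarrow> v \<noteq> 0 \<Longrightarrow> g p v v > 0"
  unfolding riemannian_metric_def by blast

text \<open>The numbers \<open>v (x b)\<close> embed the tangent space linearly into Euclidean
  space, where too many vectors are dependent. Injectivity pulls the relation back, and pairing it
  with a member \<open>w\<close> whose coefficient is nonzero gives
  \<open>g p w w = 0\<close>.\<close>

lemma card_orthogonal_tangent_vectors:
  assumes "riemannian_metric A g" "finite W" "W \<subseteq> tangent_space A p" "0 \<notin> W"
    and "\<And>u v. u \<in> W \<Longrightarrow> v \<in> W \<Longrightarrow> u \<noteq> v \<Longrightarrow> g p u v = 0"
  shows "card W \<le> DIM('e)"
proof (rule ccontr)
  assume "\<not> card W \<le> DIM('e)"
  obtain x :: "'e \<Rightarrow> 'm \<Rightarrow> real" where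
    x: "\<forall>v\<in>tangent_space A p. (\<forall>b\<in>Basis. v (x b) = 0) \<longrightarrow> v = 0"
    by (rule tangent_vector_coordinates)
  define \<Phi> where "\<Phi> v = (\<Sum>b\<in>Basis. v (x b) *\<^sub>R b)" for v
  have \<Phi>: "v = 0" if "v \<in> tangent_space A p" "\<Phi> v = 0" for v
  proof -
    have "v (x b) = \<Phi> v \<bullet> b" if "b \<in> Basis" for b
      using that by (simp add: \<Phi>_def)
    then show ?thesis using that x by simp
  qed
  have "inj_on \<Phi> W"
  proof (rule inj_onI)
    fix u v assume uv: "u \<in> W" "v \<in> W" "\<Phi> u = \<Phi> v"
    have "\<Phi> (u - v) = 0"
      using uv(3) by (simp add: \<Phi>_def scaleR_diff_left sum_subtractf)
    then have "u - v = 0"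
      using \<Phi> subspace_diff[OF subspace_tangent_space] uv assms(3) by blast
    then show "u = v" by simp
  qed
  with \<open>\<not> card W \<le> DIM('e)\<close> have "dependent (\<Phi> ` W)"
    using dependent_biggerset[of "\<Phi> ` W"] by (simp add: card_image)
  then obtain c where c: "\<exists>y\<in>\<Phi> ` W. c y \<noteq> 0" "(\<Sum>y\<in>\<Phi> ` W. c y *\<^sub>R y) = 0"
    using assms(2) dependent_finite[of "\<Phi> ` W"] by auto
  define s where "s = (\<Sum>v\<in>W. c (\<Phi> v) *\<^sub>R v)"
  have mem: "c (\<Phi> v) *\<^sub>R v \<in> tangent_space A p" if "v \<in> W" for v
    using that assms(3) subspace_scale[OF subspace_tangent_space] by blast
  have "\<Phi> s = (\<Sum>v\<in>W. c (\<Phi> v) *\<^sub>R \<Phi> v)"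
    by (simp add: \<Phi>_def s_def sum_fun_apply scaleR_fun_def scaleR_sum_left scaleR_sum_right
        sum.swap[of _ Basis])
  also have "\<dots> = 0"
    using c(2) \<open>inj_on \<Phi> W\<close> by (simp add: sum.reindex)
  finally have "s = 0"
    by (rule \<Phi>[rotated]) (auto simp: s_def intro: subspace_sum[OF subspace_tangent_space] mem)
  have lin: "g p (\<Sum>v\<in>I. c (\<Phi> v) *\<^sub>R v) w = (\<Sum>v\<in>I. c (\<Phi> v) * g p v w)"
    if "I \<subseteq> W" "w \<in> W" for I w
  proof -
    have "finite I" using that assms(2) finite_subset by blast
    then show ?thesis using that(1)
    proof (induction I)
      case empty
      have "g p (0 *\<^sub>R w) w = 0 * g p w w"
        using assms(1,3) that(2) unfolding riemannian_metric_def by blast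
      then show ?case by (simp add: func_zero)
    next
      case (insert v I)
      have "(\<Sum>v\<in>I. c (\<Phi> v) *\<^sub>R v) \<in> tangent_space A p"
        using insert.prems mem by (intro subspace_sum[OF subspace_tangent_space]) auto
      moreover have "v \<in> tangent_space A p" "w \<in> tangent_space A p"
        using insert.prems assms(3) that(2) by auto
      ultimately have "g p (c (\<Phi> v) *\<^sub>R v + (\<Sum>v\<in>I. c (\<Phi> v) *\<^sub>R v)) w =
          c (\<Phi> v) * g p v w + g p (\<Sum>v\<in>I. c (\<Phi> v) *\<^sub>R v) w"
        using metric_add[OF assms(1)] metric_scaleR[OF assms(1)] mem insert.prems by simp
      then show ?case
        using insert.IH insert.prems by (simp only: sum.insert[OF insert.hyps] insert_subset)
    qed
  qed
  obtain w where w: "w \<in> W" "c (\<Phi> w) \<noteq> 0" using c(1) by blast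
  have "0 = (\<Sum>v\<in>W. c (\<Phi> v) * g p v w)"
    using lin[OF order_refl w(1)] lin[of "{}" w] w(1) \<open>s = 0\<close> by (simp add: s_def)
  also have "\<dots> = (\<Sum>v\<in>W. if v = w then c (\<Phi> w) * g p w w else 0)"
    using assms(5) w(1) by (intro sum.cong) auto
  also have "\<dots> = c (\<Phi> w) * g p w w"
    using assms(2) w(1) by simp
  finally have "g p w w = 0" using w(2) by simp
  moreover have "g p w w > 0"
    using metric_pos[OF assms(1), of w p] assms(3,4) w(1) by auto
  ultimately show False by simp
qed

end

section \<open>Vector fields\<close>

lemma scaleR_fun_apply: "(c *\<^sub>R f) x = c *\<^sub>R f x"
  by (simp add: scaleR_fun_def)

context smooth_manifold
begin

lemma vector_fieldD:
  assumes "X \<in> vector_fields A"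
  shows "f \<in> smooth_funs A \<Longrightarrow> X f \<in> smooth_funs A"
    "f \<in> smooth_funs A \<Longrightarrow> h \<in> smooth_funs A \<Longrightarrow> X (f + h) = X f + X h"
    "f \<in> smooth_funs A \<Longrightarrow> X (c *\<^sub>R f) = c *\<^sub>R X f"
    "f \<in> smooth_funs A \<Longrightarrow> h \<in> smooth_funs A \<Longrightarrow> X (f * h) = f * X h + X f * h"
    "f \<notin> smooth_funs A \<Longrightarrow> X f = 0"
  using assms by (auto simp: vector_fields_def)

lemma vector_field_diff:
  assumes "X \<in> vector_fields A" "f \<in> smooth_funs A" "h \<in> smooth_funs A"
  shows "X (f - h) = X f - X h"
  using vector_fieldD(2)[OF assms(1,2) smooth_funs_scaleR[OF assms(3), of "-1"]]
    vector_fieldD(3)[OF assms(1,3), of "-1"]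
  by simp

lemma vector_field_const:
  assumes "X \<in> vector_fields A"
  shows "X (\<lambda>p. c) = 0"
proof -
  have 1: "1 \<in> smooth_funs A"
    using smooth_funs_const[of 1] by (simp add: func_one)
  have "X (1 * 1) = 1 * X 1 + X 1 * 1"
    by (rule vector_fieldD(4)[OF assms 1 1])
  then have "X 1 = 0" by simp
  then have "X (c *\<^sub>R 1) = 0"
    using vector_fieldD(3)[OF assms 1, of c] by simp
  also have "c *\<^sub>R 1 = (\<lambda>p. c)"
    by (simp add: scaleR_fun_def func_one)
  finally show ?thesis .
qed

lemma value_at_tangent_space: "X \<in> vector_fields A \<Longrightarrow> value_at X p \<in> tangent_space A p"
  by (auto simp: tangent_space_def value_at_def vector_fieldD scaleR_fun_apply)

lemma subspace_vector_fields: "subspace (vector_fields A)"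
  unfolding subspace_def vector_fields_def
  by (auto simp: smooth_funs_0 smooth_funs_add smooth_funs_scaleR algebra_simps scaleR_fun_apply)

lemma fmult_vector_field:
  assumes "f \<in> smooth_funs A" "X \<in> vector_fields A"
  shows "fmult f X \<in> vector_fields A"
  using assms unfolding vector_fields_def fmult_def
  by (auto simp: smooth_funs_mult algebra_simps scaleR_fun_apply fun_eq_iff)

lemma bracket_vector_field:
  assumes "X \<in> vector_fields A" "Y \<in> vector_fields A"
  shows "bracket X Y \<in> vector_fields A"
proof -
  note s = smooth_funs_add smooth_funs_mult smooth_funs_scaleR smooth_funs_diff
  note X = vector_fieldD[OF assms(1)] and Y = vector_fieldD[OF assms(2)]
  have 0: "X 0 = 0" "Y 0 = 0"
    using vector_field_const[OF assms(1), of 0] vector_field_const[OF assms(2), of 0]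
    by (simp_all add: func_zero)
  show ?thesis
    unfolding vector_fields_def bracket_def
  proof (intro CollectI conjI ballI allI impI)
    fix f h assume f: "f \<in> smooth_funs A" and h: "h \<in> smooth_funs A"
    show "X (Y (f * h)) - Y (X (f * h)) = f * (X (Y h) - Y (X h)) + (X (Y f) - Y (X f)) * h"
      by (simp add: X Y s f h algebra_simps)
  qed (auto simp: X Y 0 s algebra_simps)
qed

lemma value_at_simps:
  "value_at (X + Y) p = value_at X p + value_at Y p"
  "value_at (c *\<^sub>R X) p = c *\<^sub>R value_at X p"
  "value_at (fmult f X) p = f p *\<^sub>R value_at X p"
  "value_at 0 p = 0"
  by (auto simp: value_at_def fmult_def scaleR_fun_apply)

lemma vector_field_eqI: "(\<And>p. value_at X p = value_at Y p) \<Longrightarrow> X = Y"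
  unfolding value_at_def fun_eq_iff by blast

end

locale riemannian_manifold = smooth_manifold +
  fixes g assumes riemannian: "riemannian_metric A g"
begin

lemma metric_on_smooth:
  "X \<in> vector_fields A \<Longrightarrow> Y \<in> vector_fields A \<Longrightarrow> metric_on g X Y \<in> smooth_funs A"
  using riemannian unfolding riemannian_metric_def by blast

lemma metric_on_commute:
  "X \<in> vector_fields A \<Longrightarrow> Y \<in> vector_fields A \<Longrightarrow> metric_on g X Y = metric_on g Y X"
  by (simp add: metric_on_def metric_commute[OF riemannian] value_at_tangent_space)

lemma metric_on_add_left:
  assumes "X \<in> vector_fields A" "Y \<in> vector_fields A" "Z \<in> vector_fields A"
  shows "metric_on g (X + Y) Z = metric_on g X Z + metric_on g Y Z"
  using assms
  by (simp add: metric_on_def metric_add[OF riemannian] value_at_tangent_space value_at_simps fun_eq_iff)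

lemma metric_on_scaleR_left:
  assumes "X \<in> vector_fields A" "Z \<in> vector_fields A"
  shows "metric_on g (c *\<^sub>R X) Z = c *\<^sub>R metric_on g X Z"
  using assms
  by (simp add: metric_on_def metric_scaleR[OF riemannian] value_at_tangent_space value_at_simps
      fun_eq_iff scaleR_fun_apply)

lemma metric_on_diff_left:
  assumes "X \<in> vector_fields A" "Y \<in> vector_fields A" "Z \<in> vector_fields A"
  shows "metric_on g (X - Y) Z = metric_on g X Z - metric_on g Y Z"
  using metric_on_add_left[OF assms(1) subspace_scale[OF subspace_vector_fields assms(2), of "-1"] assms(3)]
    metric_on_scaleR_left[OF assms(2,3), of "-1"]
  by simp

lemma metric_on_fmult_left:
  assumes "X \<in> vector_fields A" "Z \<in> vector_fields A"
  shows "metric_on g (fmult f X) Z = f * metric_on g X Z"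
  using assms
  by (simp add: metric_on_def metric_scaleR[OF riemannian] value_at_tangent_space value_at_simps
      fun_eq_iff)

lemma metric_on_fmult_right:
  assumes "X \<in> vector_fields A" "Z \<in> vector_fields A" "f \<in> smooth_funs A"
  shows "metric_on g Z (fmult f X) = f * metric_on g Z X"
  using metric_on_fmult_left[OF assms(1,2)] metric_on_commute[OF assms(2)] assms
    fmult_vector_field[OF assms(3,1)] by simp

lemma metric_on_scaleR_right:
  assumes "X \<in> vector_fields A" "Z \<in> vector_fields A"
  shows "metric_on g Z (c *\<^sub>R X) = c *\<^sub>R metric_on g Z X"
  using metric_on_scaleR_left[OF assms] metric_on_commute[OF assms(2)] assms
    subspace_scale[OF subspace_vector_fields assms(1)] by simp

lemma vector_field_eq_0I:
  assumes "X \<in> vector_fields A" "metric_on g X X = 0"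
  shows "X = 0"
proof (rule vector_field_eqI)
  fix p
  have "g p (value_at X p) (value_at X p) = 0"
    using assms(2) by (simp add: metric_on_def fun_eq_iff)
  then show "value_at X p = value_at 0 p"
    using metric_pos[OF riemannian value_at_tangent_space[OF assms(1)], of p]
    by (auto simp: value_at_simps)
qed

end

section \<open>The Levi-Civita connection and its curvature\<close>

locale levi_civita_manifold = riemannian_manifold +
  fixes D assumes levi_civita: "levi_civita A g D"
begin

lemma connection_vector_field:
  "X \<in> vector_fields A \<Longrightarrow> Y \<in> vector_fields A \<Longrightarrow> D X Y \<in> vector_fields A"
  using levi_civita unfolding levi_civita_def by blast

lemma connection_add:
  assumes "X \<in> vector_fields A" "Y \<in> vector_fields A" "Z \<in> vector_fields A"
  shows "D (X + Y) Z = D X Z + D Y Z" "D X (Y + Z) = D X Y + D X Z"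
  using levi_civita assms unfolding levi_civita_def by blast+

lemma connection_fmult:
  assumes "f \<in> smooth_funs A" "X \<in> vector_fields A" "Y \<in> vector_fields A"
  shows "D (fmult f X) Y = fmult f (D X Y)" "D X (fmult f Y) = fmult (X f) Y + fmult f (D X Y)"
  using levi_civita assms unfolding levi_civita_def by blast+

lemma torsion_free:
  assumes "X \<in> vector_fields A" "Y \<in> vector_fields A"
  shows "bracket X Y = D X Y - D Y X"
proof -
  have "D X Y - D Y X = bracket X Y"
    using levi_civita assms unfolding levi_civita_def by blast
  then show ?thesis by (rule sym)
qed

lemma metric_compatible:
  "X \<in> vector_fields A \<Longrightarrow> Y \<in> vector_fields A \<Longrightarrow> Z \<in> vector_fields A \<Longrightarrow>
    X (metric_on g Y Z) = metric_on g (D X Y) Z + metric_on g Y (D X Z)"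
  using levi_civita unfolding levi_civita_def by blast

lemma fmult_const: "fmult (\<lambda>p. c) X = c *\<^sub>R X"
  by (simp add: fmult_def fun_eq_iff scaleR_fun_apply)

lemma connection_scaleR:
  assumes "X \<in> vector_fields A" "Y \<in> vector_fields A"
  shows "D (c *\<^sub>R X) Y = c *\<^sub>R D X Y" "D X (c *\<^sub>R Y) = c *\<^sub>R D X Y"
proof -
  have "fmult (X (\<lambda>p. c)) Y = 0"
    unfolding vector_field_const[OF assms(1)] by (simp add: fmult_def fun_eq_iff)
  then show "D (c *\<^sub>R X) Y = c *\<^sub>R D X Y" "D X (c *\<^sub>R Y) = c *\<^sub>R D X Y"
    using connection_fmult[OF smooth_funs_const[of c] assms] by (simp_all add: fmult_const)
qed

text \<open>Compatibility and vanishing torsion expand the right-hand side into connection terms,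
  all of which cancel except two copies of the left one. The derivative terms are kept because
  invariance of the connection is later tested against arbitrary fields \<open>Z\<close>.\<close>

lemma Koszul:
  assumes X: "X \<in> vector_fields A" and Y: "Y \<in> vector_fields A" and Z: "Z \<in> vector_fields A"
  shows "2 *\<^sub>R metric_on g (D X Y) Z = X (metric_on g Y Z) + Y (metric_on g X Z) - Z (metric_on g X Y)
    + metric_on g (bracket X Y) Z - metric_on g (bracket X Z) Y - metric_on g (bracket Y Z) X"
proof -
  note D = connection_vector_field
  note c = metric_on_commute
  show ?thesis
    unfolding torsion_free[OF X Y] torsion_free[OF X Z] torsion_free[OF Y Z]
      metric_compatible[OF X Y Z] metric_compatible[OF Y X Z] metric_compatible[OF Z X Y]
      metric_on_diff_left[OF D[OF X Y] D[OF Y X] Z] metric_on_diff_left[OF D[OF X Z] D[OF Z X] Y]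
      metric_on_diff_left[OF D[OF Y Z] D[OF Z Y] X]
      c[OF Y D[OF X Z]] c[OF X D[OF Y Z]] c[OF X D[OF Z Y]]
    by (simp add: algebra_simps scaleR_2)
qed

lemma curv_add:
  assumes "X \<in> vector_fields A" "Y \<in> vector_fields A" "Z \<in> vector_fields A" "W \<in> vector_fields A"
  shows "curv D X Y (Z + W) = curv D X Y Z + curv D X Y W"
  using assms
  by (simp add: curv_def connection_add connection_vector_field bracket_vector_field)

text \<open>The second derivatives of \<open>f\<close> cancel against the derivative along the
  bracket, and the mixed first-order terms cancel by symmetry. This lets the curvature be computed
  on a frame.\<close>

lemma curv_fmult:
  assumes X: "X \<in> vector_fields A" and Y: "Y \<in> vector_fields A" and Z: "Z \<in> vector_fields A"
    and f: "f \<in> smooth_funs A"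
  shows "curv D X Y (fmult f Z) = fmult f (curv D X Y Z)"
proof -
  have 2: "D X (D Y (fmult f Z)) = fmult (X (Y f)) Z + fmult (Y f) (D X Z) + (fmult (X f) (D Y Z) + fmult f (D X (D Y Z)))"
    if "X \<in> vector_fields A" "Y \<in> vector_fields A" for X Y
    using that Z f
    by (simp add: connection_fmult connection_add fmult_vector_field connection_vector_field vector_fieldD(1))
  show ?thesis
    unfolding curv_def connection_fmult(2)[OF f bracket_vector_field[OF X Y] Z] 2[OF X Y] 2[OF Y X]
    by (simp add: fun_eq_iff fmult_def bracket_def algebra_simps)
qed

end

section \<open>Left invariance\<close>

definition shift :: "'g::plus \<Rightarrow> ('g \<Rightarrow> real) \<Rightarrow> 'g \<Rightarrow> real"
  where "shift a f = (\<lambda>q. f (a + q))"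

text \<open>The pull-back of \<open>X\<close> along the left translation by \<open>a\<close>. It
  acts on arbitrary fields, so that left invariance becomes a fixed-point condition respected by
  brackets and, up to \<open>shift\<close>, by the metric.\<close>

definition translate :: "'g::group_add \<Rightarrow> 'g vfield \<Rightarrow> 'g vfield"
  where "translate a X = (\<lambda>f. shift a (X (shift (- a) f)))"

lemma shift_simps:
  "shift a (f + h) = shift a f + shift a h" "shift a (f * h) = shift a f * shift a h"
  "shift a (f - h) = shift a f - shift a h"
  "shift a (c *\<^sub>R f) = c *\<^sub>R shift a f" "shift a 0 = 0"
  by (auto simp: shift_def scaleR_fun_apply)

lemma shift_shift:
  fixes a :: "'g::group_add"
  shows "shift a (shift (- a) f) = f" "shift (- a) (shift a f) = f"
  by (auto simp: shift_def add.assoc[symmetric])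

lemma bracket_translate: "bracket (translate a X) (translate a Y) = translate a (bracket X Y)"
  by (simp add: bracket_def translate_def shift_shift shift_simps)

lemma translate_simps:
  "translate a (X + Y) = translate a X + translate a Y"
  "translate a (c *\<^sub>R X) = c *\<^sub>R translate a X" "translate a 0 = 0"
  by (auto simp: translate_def shift_simps fun_eq_iff scaleR_fun_apply)

lemma value_at_translate: "value_at (translate a X) p = push_left (- a) (value_at X (a + p))"
  by (simp add: value_at_def translate_def shift_def push_left_def)

lemma translate_shift: "translate a X (shift a f) = shift a (X f)"
  by (simp add: translate_def shift_shift)

lemma translate_translate: "translate a (translate (- a) X) = X"
  using shift_shift[of "- a"] by (simp add: translate_def shift_shift)

lemma lie_algebra_iff_translate:
  "X \<in> lie_algebra A \<longleftrightarrow> X \<in> vector_fields A \<and> (\<forall>a. translate a X = X)"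
proof -
  have "(\<forall>a p. value_at X (a + p) = push_left a (value_at X p)) \<longleftrightarrow> (\<forall>a. translate a X = X)"
  proof
    assume "\<forall>a p. value_at X (a + p) = push_left a (value_at X p)"
    then show "\<forall>a. translate a X = X"
      by (simp add: fun_eq_iff translate_def shift_def value_at_def push_left_def add.assoc[symmetric])
  next
    assume "\<forall>a. translate a X = X"
    then have "X (shift a f) = shift a (X f)" for a f
      using translate_shift by metis
    then show "\<forall>a p. value_at X (a + p) = push_left a (value_at X p)"
      by (simp add: value_at_def push_left_def shift_def fun_eq_iff)
  qed
  then show ?thesis by (simp add: lie_algebra_def)
qed

locale riemannian_lie_group =
  fixes A :: "('g::{topological_group_add, t2_space, second_countable_topology}, 'e::euclidean_space) atlas"
    and g :: "'g metric" and D :: "'g connection"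
  assumes lie_group: "lie_group A"
    and left_invariant: "left_invariant_metric A g"
    and levi_civita: "levi_civita A g D"

sublocale riemannian_lie_group \<subseteq> levi_civita_manifold A g D
  using lie_group left_invariant levi_civita
  by unfold_locales (auto simp: lie_group_def left_invariant_metric_def)

context riemannian_lie_group
begin

lemma group_law_smooth:
  assumes "(U, \<phi>) \<in> A" "(V, \<psi>) \<in> A" "(W, \<theta>) \<in> A"
  shows "smooth_on {(x, y). x \<in> \<phi> ` U \<and> y \<in> \<psi> ` V \<and> inv_into U \<phi> x + inv_into V \<psi> y \<in> W}
    (\<lambda>(x, y). \<theta> (inv_into U \<phi> x + inv_into V \<psi> y))"
proof -
  have "\<forall>(U, \<phi>)\<in>A. \<forall>(V, \<psi>)\<in>A. \<forall>(W, \<theta>)\<in>A.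
        smooth_on {(x, y). x \<in> \<phi> ` U \<and> y \<in> \<psi> ` V \<and> inv_into U \<phi> x + inv_into V \<psi> y \<in> W}
          (\<lambda>(x, y). \<theta> (inv_into U \<phi> x + inv_into V \<psi> y))"
    using lie_group unfolding lie_group_def by (elim conjE)
  from bspec[OF bspec[OF bspec[OF this assms(1), simplified split] assms(2), simplified split] assms(3)]
  show ?thesis by (simp only: split)
qed

text \<open>In charts, left translation is the group law with its first argument frozen at
  \<open>\<phi> a\<close>, a slice of a smooth map. The set \<open>?S\<close> must be shown open
  since composition is available on open domains only.\<close>

lemma shift_smooth:
  assumes f: "f \<in> smooth_funs A"
  shows "shift a f \<in> smooth_funs A"
proof (rule smooth_funsI)
  fix V \<psi> assume V: "(V, \<psi>) \<in> A"
  obtain U \<phi> where U: "(U, \<phi>) \<in> A" "a \<in> U" by (rule chart_at)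
  show "smooth_on (\<psi> ` V) (\<lambda>y. shift a f (inv_into V \<psi> y))"
  proof (rule smooth_on_local[OF chart_open(2)[OF V]])
    fix y assume "y \<in> \<psi> ` V"
    then obtain q where q: "q \<in> V" "y = \<psi> q" by blast
    obtain W \<theta> where W: "(W, \<theta>) \<in> A" "a + q \<in> W" by (rule chart_at)
    let ?S = "{(x, y). x \<in> \<phi> ` U \<and> y \<in> \<psi> ` V \<and> inv_into U \<phi> x + inv_into V \<psi> y \<in> W}"
    let ?T = "\<psi> ` (V \<inter> {q. a + q \<in> W})"
    let ?m = "\<lambda>(x, y). \<theta> (inv_into U \<phi> x + inv_into V \<psi> y)"
    have S: "open ?S"
    proof -
      have "continuous_on (\<phi> ` U \<times> \<psi> ` V) (\<lambda>z. inv_into U \<phi> (fst z) + inv_into V \<psi> (snd z))"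
        by (intro continuous_on_add continuous_on_compose2[OF chart_continuous_inverse[OF U(1)]]
            continuous_on_compose2[OF chart_continuous_inverse[OF V]] continuous_on_fst
            continuous_on_snd continuous_on_id) auto
      then have "open ((\<phi> ` U \<times> \<psi> ` V) \<inter> (\<lambda>z. inv_into U \<phi> (fst z) + inv_into V \<psi> (snd z)) -` W)"
        by (intro continuous_open_preimage open_Times chart_open[OF U(1)] chart_open[OF V]
            chart_open[OF W(1)])
      also have "(\<phi> ` U \<times> \<psi> ` V) \<inter> (\<lambda>z. inv_into U \<phi> (fst z) + inv_into V \<psi> (snd z)) -` W = ?S"
        by auto
      finally show ?thesis .
    qed
    have "open {q. a + q \<in> W}"
      using open_vimage[OF chart_open(1)[OF W(1)], of "\<lambda>q. a + q"]
      by (simp add: vimage_def continuous_on_add)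
    then have T: "open ?T"
      by (rule chart_open_image[OF V])
    have "smooth_on ?T (\<lambda>y. ?m (\<phi> a, y))"
      by (rule smooth_on_compose[OF T S _ group_law_smooth[OF U(1) V W(1)] smooth_on_Pair[OF T]])
        (auto simp: chart_inverse[OF V] chart_inverse[OF U(1)] U(2))
    moreover have "(\<lambda>y. ?m (\<phi> a, y)) ` ?T \<subseteq> \<theta> ` W"
      by (auto simp: chart_inverse[OF V] chart_inverse[OF U(1)] U(2))
    ultimately have "smooth_on ?T (\<lambda>y. f (inv_into W \<theta> (?m (\<phi> a, y))))"
      using smooth_on_compose[OF T chart_open(2)[OF W(1)] _ smooth_funsD[OF f W(1)]] by blast
    then have "smooth_on ?T (\<lambda>y. shift a f (inv_into V \<psi> y))"
      by (rule smooth_on_cong[OF T])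
        (auto simp: chart_inverse[OF V] chart_inverse[OF U(1)] chart_inverse[OF W(1)] U(2) shift_def)
    then show "\<exists>T. open T \<and> y \<in> T \<and> smooth_on T (\<lambda>y. shift a f (inv_into V \<psi> y))"
      using T q W(2) by blast
  qed
qed

lemma shift_smooth_iff: "shift a f \<in> smooth_funs A \<longleftrightarrow> f \<in> smooth_funs A"
  using shift_smooth[of f a] shift_smooth[of "shift a f" "- a"] by (auto simp: shift_shift)

lemma translate_vector_field: "X \<in> vector_fields A \<Longrightarrow> translate a X \<in> vector_fields A"
  unfolding vector_fields_def translate_def
  by (auto simp: shift_simps shift_smooth_iff shift_shift)

lemma metric_on_translate:
  assumes "X \<in> vector_fields A" "Y \<in> vector_fields A"
  shows "metric_on g (translate a X) (translate a Y) = shift a (metric_on g X Y)"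
proof
  fix p
  have "g (- a + (a + p)) (push_left (- a) (value_at X (a + p))) (push_left (- a) (value_at Y (a + p)))
      = g (a + p) (value_at X (a + p)) (value_at Y (a + p))"
    using left_invariant assms value_at_tangent_space unfolding left_invariant_metric_def by blast
  then show "metric_on g (translate a X) (translate a Y) p = shift a (metric_on g X Y) p"
    by (simp add: metric_on_def shift_def value_at_translate add.assoc[symmetric])
qed

lemma lie_algebra_vector_field: "X \<in> lie_algebra A \<Longrightarrow> X \<in> vector_fields A"
  by (simp add: lie_algebra_def)

lemma subspace_lie_algebra: "subspace (lie_algebra A)"
proof (rule subspaceI)
  note [simp] = lie_algebra_iff_translate translate_simps
  show "0 \<in> lie_algebra A"
    using subspace_0[OF subspace_vector_fields] by simp
  show "X + Y \<in> lie_algebra A" if "X \<in> lie_algebra A" "Y \<in> lie_algebra A" for X Y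
    using that subspace_add[OF subspace_vector_fields] by simp
  show "c *\<^sub>R X \<in> lie_algebra A" if "X \<in> lie_algebra A" for c X
    using that subspace_scale[OF subspace_vector_fields] by simp
qed

lemma bracket_lie_algebra:
  "X \<in> lie_algebra A \<Longrightarrow> Y \<in> lie_algebra A \<Longrightarrow> bracket X Y \<in> lie_algebra A"
  by (simp add: lie_algebra_iff_translate bracket_vector_field flip: bracket_translate)

lemma metric_on_lie_algebra:
  assumes "X \<in> lie_algebra A" "Y \<in> lie_algebra A"
  shows "metric_on g X Y = (\<lambda>p. inner_prod g X Y)"
proof
  fix p
  have "shift p (metric_on g X Y) 0 = metric_on g X Y 0"
    using metric_on_translate[of X Y p] assms by (simp add: lie_algebra_iff_translate)
  then show "metric_on g X Y p = inner_prod g X Y"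
    by (simp add: shift_def metric_on_def inner_prod_def)
qed

text \<open>By the Koszul formula \<open>D X Y\<close> and its translate have the same inner product with all fields.\<close>

lemma connection_lie_algebra:
  assumes "X \<in> lie_algebra A" "Y \<in> lie_algebra A"
  shows "D X Y \<in> lie_algebra A"
  unfolding lie_algebra_iff_translate
proof (intro conjI allI)
  have XY: "X \<in> vector_fields A" "Y \<in> vector_fields A" "\<And>a. translate a X = X" "\<And>a. translate a Y = Y"
    using assms by (auto simp: lie_algebra_iff_translate)
  show DXY: "D X Y \<in> vector_fields A"
    by (rule connection_vector_field[OF XY(1,2)])
  fix a :: 'g
  let ?T = "translate a" and ?m = "metric_on g"
  have "?m (D X Y) (?T Z) = ?m (?T (D X Y)) (?T Z)" if Z: "Z \<in> vector_fields A" for Z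
  proof -
    note b = bracket_vector_field[OF XY(1) Z] bracket_vector_field[OF XY(2) Z]
      bracket_vector_field[OF XY(1,2)]
    have m: "?m X (?T Z) = shift a (?m X Z)" "?m Y (?T Z) = shift a (?m Y Z)"
      "?m X Y = shift a (?m X Y)" "?m (bracket X Y) (?T Z) = shift a (?m (bracket X Y) Z)"
      "?m (bracket X (?T Z)) Y = shift a (?m (bracket X Z) Y)"
      "?m (bracket Y (?T Z)) X = shift a (?m (bracket Y Z) X)"
      using metric_on_translate[OF XY(1) Z, of a] metric_on_translate[OF XY(2) Z, of a]
        metric_on_translate[OF XY(1,2), of a] metric_on_translate[OF b(3) Z, of a]
        metric_on_translate[OF b(1) XY(2), of a] metric_on_translate[OF b(2) XY(1), of a]
      by (simp_all add: XY flip: bracket_translate)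
    have s: "X (shift a f) = shift a (X f)" "Y (shift a f) = shift a (Y f)"
      "?T Z (shift a f) = shift a (Z f)" for f
      using translate_shift[of a X f] translate_shift[of a Y f] translate_shift[of a Z f]
      by (simp_all add: XY)
    have "2 *\<^sub>R ?m (D X Y) (?T Z) = shift a (2 *\<^sub>R ?m (D X Y) Z)"
      unfolding Koszul[OF XY(1,2) translate_vector_field[OF Z]] Koszul[OF XY(1,2) Z]
      \<comment> \<open>\<open>m(3)\<close> contains its own left-hand side on the right and would
        loop as a simplification rule, so it is applied once by hand.\<close>
      by (subst m(3)) (simp only: m(1,2,4,5,6) s shift_simps)
    then show ?thesis
      by (simp add: shift_simps metric_on_translate[OF DXY Z])
  qed
  note eq = this
  let ?E = "D X Y - ?T (D X Y)"
  have TD: "?T (D X Y) \<in> vector_fields A"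
    by (rule translate_vector_field[OF DXY])
  have E: "?E \<in> vector_fields A"
    by (rule subspace_diff[OF subspace_vector_fields DXY TD])
  \<comment> \<open>\<open>eq\<close> tests only against translates, but \<open>?E\<close> is the
    translate by \<open>a\<close> of its own translate by \<open>- a\<close>.\<close>
  have "?m (D X Y) ?E = ?m (?T (D X Y)) ?E"
    using eq[OF translate_vector_field[OF E, of "- a"]] by (simp add: translate_translate)
  then have "?m ?E ?E = 0"
    by (simp add: metric_on_diff_left[OF DXY TD E])
  then show "?T (D X Y) = D X Y"
    using vector_field_eq_0I[OF E] by simp
qed

end

section \<open>Skew endomorphisms in dimension at most three\<close>

text \<open>Separates the linear algebra from the geometry. The dimension bound is assumed in terms
  of orthogonal sets, which is the form in which derivations at the identity provide it.\<close>

locale inner_product_subspace =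
  fixes L :: "'v::real_vector set" and ip :: "'v \<Rightarrow> 'v \<Rightarrow> real"
  assumes subspace_L: "subspace L"
    and ip_add_left: "\<And>x y z. x \<in> L \<Longrightarrow> y \<in> L \<Longrightarrow> z \<in> L \<Longrightarrow> ip (x + y) z = ip x z + ip y z"
    and ip_scaleR_left: "\<And>c x y. x \<in> L \<Longrightarrow> y \<in> L \<Longrightarrow> ip (c *\<^sub>R x) y = c * ip x y"
    and ip_commute: "\<And>x y. x \<in> L \<Longrightarrow> y \<in> L \<Longrightarrow> ip x y = ip y x"
    and ip_pos: "\<And>x. x \<in> L \<Longrightarrow> x \<noteq> 0 \<Longrightarrow> ip x x > 0"
    and card_orthogonal: "\<And>W. finite W \<Longrightarrow> W \<subseteq> L \<Longrightarrow> 0 \<notin> W \<Longrightarrow>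
      (\<And>u v. u \<in> W \<Longrightarrow> v \<in> W \<Longrightarrow> u \<noteq> v \<Longrightarrow> ip u v = 0) \<Longrightarrow> card W \<le> 3"
begin

lemma L_closed [simp, intro]:
  "0 \<in> L" "x \<in> L \<Longrightarrow> y \<in> L \<Longrightarrow> x + y \<in> L" "x \<in> L \<Longrightarrow> y \<in> L \<Longrightarrow> x - y \<in> L"
  "x \<in> L \<Longrightarrow> c *\<^sub>R x \<in> L" "x \<in> L \<Longrightarrow> - x \<in> L"
  using subspace_L by (auto simp: subspace_0 subspace_add subspace_diff subspace_scale subspace_neg)

lemma ip_simps [simp]:
  "x \<in> L \<Longrightarrow> y \<in> L \<Longrightarrow> z \<in> L \<Longrightarrow> ip (x + y) z = ip x z + ip y z"
  "x \<in> L \<Longrightarrow> y \<in> L \<Longrightarrow> z \<in> L \<Longrightarrow> ip z (x + y) = ip z x + ip z y"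
  "x \<in> L \<Longrightarrow> y \<in> L \<Longrightarrow> ip (c *\<^sub>R x) y = c * ip x y"
  "x \<in> L \<Longrightarrow> y \<in> L \<Longrightarrow> ip y (c *\<^sub>R x) = c * ip y x"
  "y \<in> L \<Longrightarrow> ip 0 y = 0" "y \<in> L \<Longrightarrow> ip y 0 = 0"
  "x \<in> L \<Longrightarrow> y \<in> L \<Longrightarrow> ip (- x) y = - ip x y" "x \<in> L \<Longrightarrow> y \<in> L \<Longrightarrow> ip y (- x) = - ip y x"
  "x \<in> L \<Longrightarrow> y \<in> L \<Longrightarrow> z \<in> L \<Longrightarrow> ip (x - y) z = ip x z - ip y z"
  "x \<in> L \<Longrightarrow> y \<in> L \<Longrightarrow> z \<in> L \<Longrightarrow> ip z (x - y) = ip z x - ip z y"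
proof -
  show add: "ip (x + y) z = ip x z + ip y z" if "x \<in> L" "y \<in> L" "z \<in> L" for x y z
    using ip_add_left that .
  show sc: "ip (c *\<^sub>R x) y = c * ip x y" if "x \<in> L" "y \<in> L" for c x y
    using ip_scaleR_left that .
  show add': "ip z (x + y) = ip z x + ip z y" if "x \<in> L" "y \<in> L" "z \<in> L" for x y z
    using add that ip_commute[of z] by simp
  show sc': "ip y (c *\<^sub>R x) = c * ip y x" if "x \<in> L" "y \<in> L" for c x y
    using sc that ip_commute[of y] by simp
  show "ip 0 y = 0" "ip y 0 = 0" if "y \<in> L" for y
    using sc[OF that that, of 0] sc'[OF that that, of 0] by simp_all
  show m: "ip (- x) y = - ip x y" "ip y (- x) = - ip y x" if "x \<in> L" "y \<in> L" for x y
    using sc[OF that, of "-1"] sc'[OF that, of "-1"] by simp_all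
  show "ip (x - y) z = ip x z - ip y z" if "x \<in> L" "y \<in> L" "z \<in> L" for x y z
    using add[of x "- y" z] m[of y z] that by simp
  show "ip z (x - y) = ip z x - ip z y" if "x \<in> L" "y \<in> L" "z \<in> L" for x y z
    using add'[of x "- y" z] m[of y z] that by simp
qed

lemma ip_self_eq_0: "x \<in> L \<Longrightarrow> ip x x = 0 \<longleftrightarrow> x = 0"
  using ip_pos by fastforce

lemma ip_self_nonneg: "x \<in> L \<Longrightarrow> ip x x \<ge> 0"
  using ip_pos[of x] ip_self_eq_0[of x] by linarith

lemma no_four_orthogonal:
  assumes "a \<in> L" "b \<in> L" "c \<in> L" "d \<in> L" "a \<noteq> 0" "b \<noteq> 0" "c \<noteq> 0" "d \<noteq> 0"
    and "ip a b = 0" "ip a c = 0" "ip a d = 0" "ip b c = 0" "ip b d = 0" "ip c d = 0"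
  shows False
proof -
  have "distinct [a, b, c, d]"
    using assms by (auto simp: ip_self_eq_0)
  then have "card {a, b, c, d} = 4" by simp
  moreover have "card {a, b, c, d} \<le> 3"
    using assms ip_commute by (intro card_orthogonal) auto
  ultimately show False by simp
qed

lemma normalize:
  assumes "x \<in> L" "x \<noteq> 0"
  obtains c where "c > 0" "ip (c *\<^sub>R x) (c *\<^sub>R x) = 1"
proof
  show "1 / sqrt (ip x x) > 0" using ip_pos[OF assms] by simp
  show "ip ((1 / sqrt (ip x x)) *\<^sub>R x) ((1 / sqrt (ip x x)) *\<^sub>R x) = 1"
    using ip_pos[OF assms] assms(1) by (simp add: field_simps)
qed

text \<open>If nothing nonzero is orthogonal to \<open>S\<close>, then \<open>e = 0\<close> is
  returned together with that information, so that Gram-Schmidt can run three times whatever the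
  dimension is.\<close>

lemma orthogonal_unit_vector:
  assumes "S \<subseteq> L"
  obtains e where "e \<in> L" "\<forall>s\<in>S. ip e s = 0" "e = 0 \<or> ip e e = 1"
    "e = 0 \<longrightarrow> (\<forall>x\<in>L. (\<forall>s\<in>S. ip x s = 0) \<longrightarrow> x = 0)"
proof (cases "\<exists>x\<in>L. (\<forall>s\<in>S. ip x s = 0) \<and> x \<noteq> 0")
  case True
  then obtain x where x: "x \<in> L" "\<forall>s\<in>S. ip x s = 0" "x \<noteq> 0" by blast
  then obtain c where "c > 0" "ip (c *\<^sub>R x) (c *\<^sub>R x) = 1"
    using normalize by blast
  with x assms show ?thesis
    by (intro that[of "c *\<^sub>R x"]) (auto simp: subset_iff)
next
  case False
  with assms show ?thesis by (intro that[of 0]) auto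
qed

text \<open>The dimension may be less than three, in which case some of the vectors vanish.\<close>

lemma orthonormal_or_zero_triple:
  obtains e1 e2 e3 where "e1 \<in> L" "e2 \<in> L" "e3 \<in> L" "ip e1 e2 = 0" "ip e1 e3 = 0" "ip e2 e3 = 0"
    "\<forall>x\<in>L. x = ip x e1 *\<^sub>R e1 + ip x e2 *\<^sub>R e2 + ip x e3 *\<^sub>R e3"
proof -
  obtain e1 where e1: "e1 \<in> L" "e1 = 0 \<or> ip e1 e1 = 1" "e1 = 0 \<longrightarrow> (\<forall>x\<in>L. x = 0)"
    using orthogonal_unit_vector[of "{}"] by auto
  have "{e1} \<subseteq> L" using e1(1) by simp
  then obtain e2 where "e2 \<in> L" "\<forall>s\<in>{e1}. ip e2 s = 0" "e2 = 0 \<or> ip e2 e2 = 1"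
      "e2 = 0 \<longrightarrow> (\<forall>x\<in>L. (\<forall>s\<in>{e1}. ip x s = 0) \<longrightarrow> x = 0)"
    by (rule orthogonal_unit_vector)
  then have e2: "e2 \<in> L" "ip e2 e1 = 0" "e2 = 0 \<or> ip e2 e2 = 1"
      "e2 = 0 \<longrightarrow> (\<forall>x\<in>L. ip x e1 = 0 \<longrightarrow> x = 0)"
    by simp_all
  have "{e1, e2} \<subseteq> L" using e1(1) e2(1) by simp
  then obtain e3 where "e3 \<in> L" "\<forall>s\<in>{e1, e2}. ip e3 s = 0" "e3 = 0 \<or> ip e3 e3 = 1"
      "e3 = 0 \<longrightarrow> (\<forall>x\<in>L. (\<forall>s\<in>{e1, e2}. ip x s = 0) \<longrightarrow> x = 0)"
    by (rule orthogonal_unit_vector)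
  then have e3: "e3 \<in> L" "ip e3 e1 = 0" "ip e3 e2 = 0" "e3 = 0 \<or> ip e3 e3 = 1"
      "e3 = 0 \<longrightarrow> (\<forall>x\<in>L. ip x e1 = 0 \<and> ip x e2 = 0 \<longrightarrow> x = 0)"
    by simp_all
  have o: "ip e1 e2 = 0" "ip e1 e3 = 0" "ip e2 e3 = 0"
    using ip_commute[OF e1(1) e2(1)] ip_commute[OF e1(1) e3(1)] ip_commute[OF e2(1) e3(1)]
      e2(2) e3(2,3) by simp_all
  have "x = ip x e1 *\<^sub>R e1 + ip x e2 *\<^sub>R e2 + ip x e3 *\<^sub>R e3" if x: "x \<in> L" for x
  proof -
    define r where "r = x - (ip x e1 *\<^sub>R e1 + ip x e2 *\<^sub>R e2 + ip x e3 *\<^sub>R e3)"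
    have r: "r \<in> L" using x e1(1) e2(1) e3(1) by (simp add: r_def)
    have ro: "ip r e1 = 0" "ip r e2 = 0" "ip r e3 = 0"
      using x e1(1,2) e2(1,2,3) e3(1,2,3,4) o by (auto simp: r_def)
    \<comment> \<open>If one of the vectors is zero, its maximality clause already kills the
      residual; otherwise the residual would be a fourth orthogonal vector.\<close>
    have "r = 0"
    proof (rule ccontr)
      assume "r \<noteq> 0"
      then have "e1 \<noteq> 0" "e2 \<noteq> 0" "e3 \<noteq> 0"
        using e1(3) e2(4) e3(5) r ro by blast+
      with no_four_orthogonal[of r e1 e2 e3] \<open>r \<noteq> 0\<close> r ro o e1(1) e2(1) e3(1) show False
        by blast
    qed
    then show ?thesis by (simp add: r_def)
  qed
  then show ?thesis using that e1(1) e2(1) e3(1) o by blast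
qed

section \<open>The cubic identity for skew maps and Rodrigues' formula\<close>

lemma so_algebraD:
  assumes "T \<in> so_algebra L ip"
  shows "x \<in> L \<Longrightarrow> T x \<in> L" "x \<in> L \<Longrightarrow> y \<in> L \<Longrightarrow> T (x + y) = T x + T y"
    "x \<in> L \<Longrightarrow> T (c *\<^sub>R x) = c *\<^sub>R T x" "x \<in> L \<Longrightarrow> y \<in> L \<Longrightarrow> ip (T x) y = - ip x (T y)"
    "x \<notin> L \<Longrightarrow> T x = 0"
  using assms by (auto simp: so_algebra_def)

lemma skew_self_orthogonal:
  assumes "T \<in> so_algebra L ip" "x \<in> L" shows "ip (T x) x = 0"
  using so_algebraD(4)[OF assms(1,2,2)] ip_commute[OF so_algebraD(1)[OF assms] assms(2)] by simp

text \<open>Cayley-Hamilton for the skew matrix with entries \<alpha>, \<beta>, \<gamma>, whose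
  characteristic polynomial is t^3 + (\<alpha>^2 + \<beta>^2 + \<gamma>^2) t. Zero vectors in the
  triple only make entries vanish, so smaller dimensions are included.\<close>

lemma skew_cubed:
  assumes T: "T \<in> so_algebra L ip"
  obtains \<theta> where "\<theta> \<ge> 0" "\<forall>x\<in>L. T (T (T x)) = (- \<theta>\<^sup>2) *\<^sub>R T x" "\<theta> = 0 \<longrightarrow> (\<forall>x\<in>L. T x = 0)"
proof -
  obtain e1 e2 e3 where e: "e1 \<in> L" "e2 \<in> L" "e3 \<in> L"
    and o: "ip e1 e2 = 0" "ip e1 e3 = 0" "ip e2 e3 = 0"
    and ex: "\<forall>x\<in>L. x = ip x e1 *\<^sub>R e1 + ip x e2 *\<^sub>R e2 + ip x e3 *\<^sub>R e3"
    by (rule orthonormal_or_zero_triple)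
  note D = so_algebraD[OF T]
  define \<alpha> \<beta> \<gamma> where "\<alpha> = ip (T e1) e2" and "\<beta> = ip (T e1) e3" and "\<gamma> = ip (T e2) e3"
  have neg: "ip (T y) x = - ip (T x) y" if "x \<in> L" "y \<in> L" for x y
    using D(4)[OF that(2,1)] ip_commute[of y "T x"] that D(1) by simp
  have T1: "T e1 = \<alpha> *\<^sub>R e2 + \<beta> *\<^sub>R e3"
    using bspec[OF ex D(1)[OF e(1)]] skew_self_orthogonal[OF T e(1)]
    by (simp add: \<alpha>_def \<beta>_def)
  have T2: "T e2 = (- \<alpha>) *\<^sub>R e1 + \<gamma> *\<^sub>R e3"
    using bspec[OF ex D(1)[OF e(2)]] skew_self_orthogonal[OF T e(2)] neg[OF e(1,2)]
    by (simp add: \<alpha>_def \<gamma>_def)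
  have T3: "T e3 = (- \<beta>) *\<^sub>R e1 + (- \<gamma>) *\<^sub>R e2"
    using bspec[OF ex D(1)[OF e(3)]] skew_self_orthogonal[OF T e(3)] neg[OF e(1,3)] neg[OF e(2,3)]
    by (simp add: \<beta>_def \<gamma>_def)
  define \<theta> where "\<theta> = sqrt (\<alpha>\<^sup>2 + \<beta>\<^sup>2 + \<gamma>\<^sup>2)"
  have \<theta>2: "\<theta>\<^sup>2 = \<alpha>\<^sup>2 + \<beta>\<^sup>2 + \<gamma>\<^sup>2"
    by (simp add: \<theta>_def)
  have lin: "T (a *\<^sub>R e1 + b *\<^sub>R e2 + c *\<^sub>R e3) = a *\<^sub>R T e1 + b *\<^sub>R T e2 + c *\<^sub>R T e3" for a b c
    using e by (simp add: D)
  have form: "T (a *\<^sub>R e1 + b *\<^sub>R e2 + c *\<^sub>R e3) =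
      (- b * \<alpha> - c * \<beta>) *\<^sub>R e1 + (a * \<alpha> - c * \<gamma>) *\<^sub>R e2 + (a * \<beta> + b * \<gamma>) *\<^sub>R e3" for a b c
    unfolding lin T1 T2 T3 by (simp add: algebra_simps)
  have "T (T (T x)) = (- \<theta>\<^sup>2) *\<^sub>R T x" if "x \<in> L" for x
    apply (subst (1 2) bspec[OF ex that])
    unfolding form \<theta>2 scaleR_add_right scaleR_scaleR
    by (intro arg_cong2[where f="(+)"] arg_cong2[where f="(*\<^sub>R)"] refl)
      (simp_all add: algebra_simps power2_eq_square)
  moreover have "\<forall>x\<in>L. T x = 0" if "\<theta> = 0"
  proof
    fix x assume x: "x \<in> L"
    have "\<alpha> = 0" "\<beta> = 0" "\<gamma> = 0"
      using that \<theta>2 by (auto simp: add_nonneg_eq_0_iff)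
    then show "T x = 0"
      by (subst bspec[OF ex x]) (simp add: form)
  qed
  ultimately show ?thesis using that[of \<theta>] by (simp add: \<theta>_def)
qed

text \<open>\<open>exp_endo\<close> is a definite description, so the limit has to be unique. The
  parallelogram law bounds |u - w|^2 by 2 |u - S|^2 + 2 |w - S|^2 directly at the level of the
  quadratic form.\<close>

lemma exp_endo_eqI:
  assumes T: "T \<in> so_algebra L ip" and z: "z \<in> L" and w: "w \<in> L"
    and lim: "(\<lambda>N. let d = w - (\<Sum>n<N. (1 / fact n) *\<^sub>R (T ^^ n) z) in ip d d) \<longlonglongrightarrow> 0"
  shows "exp_endo L ip T z = w"
proof -
  let ?S = "\<lambda>N. \<Sum>n<N. (1 / fact n) *\<^sub>R (T ^^ n) z"
  have Tn: "(T ^^ n) z \<in> L" for n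
    by (induction n) (auto simp: z so_algebraD(1)[OF T])
  have S: "?S N \<in> L" for N
    by (intro subspace_sum[OF subspace_L] L_closed(4) Tn)
  have "u = w" if u: "u \<in> L"
    and lim': "(\<lambda>N. let d = u - ?S N in ip d d) \<longlonglongrightarrow> 0" for u
  proof -
    have "ip (u - w) (u - w) \<le> 2 * ip (u - ?S N) (u - ?S N) + 2 * ip (w - ?S N) (w - ?S N)" for N
    proof -
      have m: "u - ?S N \<in> L" "w - ?S N \<in> L" using S u w by auto
      have "0 \<le> ip ((u - ?S N) + (w - ?S N)) ((u - ?S N) + (w - ?S N))"
        using m by (intro ip_self_nonneg) auto
      moreover have "ip (u - w) (u - w) = ip ((u - ?S N) - (w - ?S N)) ((u - ?S N) - (w - ?S N))"
        by simp
      ultimately show ?thesis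
        unfolding ip_simps(1,2,9,10)[OF m] using m by (simp only: ip_simps(1,2,9,10) L_closed)
    qed
    moreover have "(\<lambda>N. 2 * ip (u - ?S N) (u - ?S N) + 2 * ip (w - ?S N) (w - ?S N))
        \<longlonglongrightarrow> 2 * 0 + 2 * 0"
      using lim lim' unfolding Let_def by (intro tendsto_intros)
    ultimately have "ip (u - w) (u - w) \<le> 0"
      by (intro LIMSEQ_le_const) auto
    then show ?thesis
      using ip_self_nonneg[of "u - w"] ip_self_eq_0[of "u - w"] u w by simp
  qed
  note unique = this
  show ?thesis
    unfolding exp_endo_def if_P[OF z]
    by (rule the_equality, rule conjI[OF w lim], elim conjE, rule unique)
qed

lemma exp_endo_fixed:
  assumes T: "T \<in> so_algebra L ip" and z: "z \<in> L" and "T z = 0"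
  shows "exp_endo L ip T z = z"
proof (rule exp_endo_eqI[OF T z z])
  have "T 0 = 0"
    using so_algebraD(3)[OF T, of 0 0] by simp
  then have "(T ^^ n) z = 0" if "n > 0" for n
    using that
  proof (induction n)
    case (Suc n)
    then show ?case using assms(3) by (cases n) auto
  qed simp
  then have t: "(1 / fact n) *\<^sub>R (T ^^ n) z = (if n = 0 then z else 0)" for n
    by simp
  \<comment> \<open>The condition \<open>N > 0\<close> excludes the empty partial sum, hence the
    eventual statement from 1 on.\<close>
  have "(\<Sum>n<N. (1 / fact n) *\<^sub>R (T ^^ n) z) = z" if "N > 0" for N
    using that unfolding t by (simp add: sum.delta)
  then have "\<forall>\<^sub>F N in sequentially.
      (let d = z - (\<Sum>n<N. (1 / fact n) *\<^sub>R (T ^^ n) z) in ip d d) = 0"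
    by (intro eventually_sequentiallyI[of 1]) (simp add: Let_def)
  then show "(\<lambda>N. let d = z - (\<Sum>n<N. (1 / fact n) *\<^sub>R (T ^^ n) z) in ip d d) \<longlonglongrightarrow> 0"
    by (rule tendsto_eventually)
qed

text \<open>By \<open>cube\<close> the positive powers of \<open>T\<close> send \<open>z\<close>
  alternately to multiples of \<open>T z\<close> and \<open>T (T z)\<close>. The odd terms add up to
  the sine series over \<theta>, the even ones to 1 minus the cosine series, over
  \<theta>^2.\<close>

theorem Rodrigues:
  assumes T: "T \<in> so_algebra L ip" and cube: "\<forall>x\<in>L. T (T (T x)) = (- \<theta>\<^sup>2) *\<^sub>R T x"
    and \<theta>: "\<theta> \<noteq> 0" and z: "z \<in> L"
  shows "exp_endo L ip T z = z + (sin \<theta> / \<theta>) *\<^sub>R T z + ((1 - cos \<theta>) / \<theta>\<^sup>2) *\<^sub>R T (T z)"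
proof (rule exp_endo_eqI[OF T z])
  note D = so_algebraD[OF T]
  have Tz: "T z \<in> L" "T (T z) \<in> L" using D(1) z by auto
  then show "z + (sin \<theta> / \<theta>) *\<^sub>R T z + ((1 - cos \<theta>) / \<theta>\<^sup>2) *\<^sub>R T (T z) \<in> L"
    using z by auto
  have odd: "(T ^^ Suc (2 * m)) z = ((- \<theta>\<^sup>2) ^ m) *\<^sub>R T z" for m
    by (induction m) (use Tz cube z D(1) in \<open>auto simp: D(3)\<close>)
  have even: "(T ^^ Suc (Suc (2 * m))) z = ((- \<theta>\<^sup>2) ^ m) *\<^sub>R T (T z)" for m
    using odd[of m] Tz by (simp add: D(3))
  let ?s = "\<lambda>N. \<Sum>n<N. sin_coeff n * \<theta> ^ n" and ?c = "\<lambda>N. \<Sum>n<N. cos_coeff n * \<theta> ^ n"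
  have pow: "(- \<theta>\<^sup>2) ^ m = (- 1) ^ m * \<theta> ^ (2 * m)" for m
    by (metis power_minus power_mult)
  \<comment> \<open>One formula serves both parities because \<open>sin_coeff\<close> vanishes at
    even and \<open>cos_coeff\<close> at odd indices.\<close>
  have t: "(1 / fact (Suc n)) *\<^sub>R (T ^^ Suc n) z =
      (sin_coeff (Suc n) * \<theta> ^ Suc n / \<theta>) *\<^sub>R T z - (cos_coeff (Suc n) * \<theta> ^ Suc n / \<theta>\<^sup>2) *\<^sub>R T (T z)" for n
  proof (cases "even n")
    case True
    then obtain m where m: "n = 2 * m" by blast
    have "sin_coeff (Suc n) * \<theta> ^ Suc n / \<theta> = (1 / fact (Suc n)) * (- \<theta>\<^sup>2) ^ m"
      "cos_coeff (Suc n) = 0"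
      using \<theta> unfolding m pow by (simp_all add: sin_coeff_def cos_coeff_def del: fact_Suc)
    then show ?thesis
      unfolding m odd by simp
  next
    case False
    then obtain m where m: "n = Suc (2 * m)" by (metis oddE Suc_eq_plus1)
    have "cos_coeff (Suc n) * \<theta> ^ Suc n / \<theta>\<^sup>2 = - ((1 / fact (Suc n)) * (- \<theta>\<^sup>2) ^ m)"
      "sin_coeff (Suc n) = 0"
      using \<theta> unfolding m pow
      by (simp_all add: sin_coeff_def cos_coeff_def power2_eq_square del: fact_Suc)
    then show ?thesis
      unfolding m even by simp
  qed
  \<comment> \<open>The term n = 0 is \<open>z\<close>, and the 1 in \<open>1 - ?c\<close> removes
    the constant term of the cosine series. The empty sum does not have this form, hence
    \<open>Suc N\<close>.\<close>
  have S: "(\<Sum>n<Suc N. (1 / fact n) *\<^sub>R (T ^^ n) z) =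
      z + (?s (Suc N) / \<theta>) *\<^sub>R T z + ((1 - ?c (Suc N)) / \<theta>\<^sup>2) *\<^sub>R T (T z)" for N
  proof (induction N)
    case (Suc N)
    show ?case
      by (subst sum.lessThan_Suc, subst Suc.IH, subst t)
        (simp add: algebra_simps add_divide_distrib diff_divide_distrib)
  qed (simp add: sin_coeff_def cos_coeff_def)
  have ip: "ip (a *\<^sub>R T z + b *\<^sub>R T (T z)) (a *\<^sub>R T z + b *\<^sub>R T (T z)) =
      a\<^sup>2 * ip (T z) (T z) + 2 * a * b * ip (T z) (T (T z)) + b\<^sup>2 * ip (T (T z)) (T (T z))" for a b
    using Tz ip_commute[OF Tz] by (simp add: power2_eq_square algebra_simps)
  let ?w = "z + (sin \<theta> / \<theta>) *\<^sub>R T z + ((1 - cos \<theta>) / \<theta>\<^sup>2) *\<^sub>R T (T z)"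
  let ?a = "\<lambda>N. (sin \<theta> - ?s N) / \<theta>" and ?b = "\<lambda>N. (?c N - cos \<theta>) / \<theta>\<^sup>2"
  have d: "?w - (\<Sum>n<Suc N. (1 / fact n) *\<^sub>R (T ^^ n) z) = ?a (Suc N) *\<^sub>R T z + ?b (Suc N) *\<^sub>R T (T z)" for N
    unfolding S by (simp add: algebra_simps add_divide_distrib diff_divide_distrib)
  have sc: "?s \<longlonglongrightarrow> sin \<theta>" "?c \<longlonglongrightarrow> cos \<theta>"
    using sin_converges[of \<theta>] cos_converges[of \<theta>] unfolding sums_def by simp_all
  have "?a \<longlonglongrightarrow> (sin \<theta> - sin \<theta>) / \<theta>" "?b \<longlonglongrightarrow> (cos \<theta> - cos \<theta>) / \<theta>\<^sup>2"
    by (intro tendsto_intros sc; use \<theta> in simp)+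
  then have "?a \<longlonglongrightarrow> 0" "?b \<longlonglongrightarrow> 0" by simp_all
  then have "(\<lambda>N. (?a N)\<^sup>2 * ip (T z) (T z) + 2 * ?a N * ?b N * ip (T z) (T (T z))
      + (?b N)\<^sup>2 * ip (T (T z)) (T (T z))) \<longlonglongrightarrow>
      0\<^sup>2 * ip (T z) (T z) + 2 * 0 * 0 * ip (T z) (T (T z)) + 0\<^sup>2 * ip (T (T z)) (T (T z))"
    by (intro tendsto_intros)
  from LIMSEQ_Suc[OF this] have "(\<lambda>N. (?a (Suc N))\<^sup>2 * ip (T z) (T z) + 2 * ?a (Suc N) * ?b (Suc N) * ip (T z) (T (T z))
      + (?b (Suc N))\<^sup>2 * ip (T (T z)) (T (T z))) \<longlonglongrightarrow> 0"
    by simp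
  then have "(\<lambda>N. let d = ?w - (\<Sum>n<Suc N. (1 / fact n) *\<^sub>R (T ^^ n) z) in ip d d) \<longlonglongrightarrow> 0"
    unfolding Let_def d ip .
  then show "(\<lambda>N. let d = ?w - (\<Sum>n<N. (1 / fact n) *\<^sub>R (T ^^ n) z) in ip d d) \<longlonglongrightarrow> 0"
    by (rule LIMSEQ_imp_Suc)
qed

section \<open>Connected groups of isometries and their Lie algebras\<close>

lemma exp_endo_mem_connected_subgroup:
  assumes "T \<in> H"
  obtains h where "h \<in> connected_subgroup L ip H" "\<And>x. x \<in> L \<Longrightarrow> h x = exp_endo L ip T x"
proof
  show "exp_endo L ip T \<circ> (\<lambda>x. if x \<in> L then x else 0) \<in> connected_subgroup L ip H"
    by (intro connected_subgroup.intros assms)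
qed simp

lemma so_algebra_scaleR: "T \<in> so_algebra L ip \<Longrightarrow> (c *\<^sub>R T) \<in> so_algebra L ip"
  by (auto simp: so_algebra_def scaleR_fun_def algebra_simps)

text \<open>After scaling \<open>T\<close> to rotation angle \<open>\<pi> / 2\<close>, Rodrigues' formula shows that \<open>exp T - exp (- T)\<close>
  is a nonzero multiple of \<open>T\<close>.\<close>

lemma skew_eq_exp_difference:
  assumes H: "H \<subseteq> so_algebra L ip" "subspace H" and T: "T \<in> H"
  obtains h h' c where "h \<in> connected_subgroup L ip H" "h' \<in> connected_subgroup L ip H"
    "\<forall>x\<in>L. T x = c *\<^sub>R (h x - h' x)"
proof -
  have Tso: "T \<in> so_algebra L ip" using H T by auto
  note D = so_algebraD[OF Tso]
  obtain \<theta> where \<theta>: "\<theta> \<ge> 0" "\<forall>x\<in>L. T (T (T x)) = (- \<theta>\<^sup>2) *\<^sub>R T x"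
    "\<theta> = 0 \<longrightarrow> (\<forall>x\<in>L. T x = 0)" by (rule skew_cubed[OF Tso])
  show ?thesis
  proof (cases "\<theta> = 0")
    case True
    with \<theta>(3) connected_subgroup.one show ?thesis by (intro that[of _ _ 0]) auto
  next
    case False
    have ex: "exp_endo L ip (c *\<^sub>R T) x = x + (sin (c * \<theta>) / \<theta>) *\<^sub>R T x + ((1 - cos (c * \<theta>)) / \<theta>\<^sup>2) *\<^sub>R T (T x)"
      if "x \<in> L" "c \<noteq> 0" for x c
    proof -
      have cube: "\<forall>x\<in>L. (c *\<^sub>R T) ((c *\<^sub>R T) ((c *\<^sub>R T) x)) = (- (c * \<theta>)\<^sup>2) *\<^sub>R (c *\<^sub>R T) x"
        using \<theta>(2) by (auto simp: scaleR_fun_def D power2_eq_square)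
      show ?thesis
        using Rodrigues[OF so_algebra_scaleR[OF Tso] cube _ that(1)] False that
        by (simp add: scaleR_fun_def D power2_eq_square)
    qed
    \<comment> \<open>At the angles \<pi>/2 and -\<pi>/2 the cosine terms of the two exponentials
      agree and the sines are 1 and -1, so the difference is (2 / \<theta>) T.\<close>
    define k where "k = pi / (2 * \<theta>)"
    have k: "k * \<theta> = pi / 2" "k \<noteq> 0" using False by (auto simp: k_def)
    obtain h where h: "h \<in> connected_subgroup L ip H" "\<And>x. x \<in> L \<Longrightarrow> h x = exp_endo L ip (k *\<^sub>R T) x"
      using exp_endo_mem_connected_subgroup subspace_scale[OF H(2) T] by blast
    obtain h' where h': "h' \<in> connected_subgroup L ip H" "\<And>x. x \<in> L \<Longrightarrow> h' x = exp_endo L ip ((- k) *\<^sub>R T) x"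
      using exp_endo_mem_connected_subgroup subspace_scale[OF H(2) T] by blast
    have "T x = (\<theta> / 2) *\<^sub>R (h x - h' x)" if x: "x \<in> L" for x
      using ex[OF x, of k] ex[OF x, of "- k"] k False h(2)[OF x] h'(2)[OF x]
      by (simp flip: scaleR_add_left)
    then show ?thesis using h(1) h'(1) that by blast
  qed
qed

text \<open>On \<open>L\<close> the map \<open>T\<close> is itself a multiple of a difference of two
  group elements; this replaces differentiating the one-parameter group at time zero.\<close>

lemma invariant_imp_algebra_invariant:
  assumes "H \<subseteq> so_algebra L ip" "subspace H" "subspace W" "W \<subseteq> L"
    and "invariant_under (connected_subgroup L ip H) W" "T \<in> H" "x \<in> W"
  shows "T x \<in> W"
proof -
  obtain h h' c where "h \<in> connected_subgroup L ip H" "h' \<in> connected_subgroup L ip H"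
    "\<forall>x\<in>L. T x = c *\<^sub>R (h x - h' x)"
    by (rule skew_eq_exp_difference[OF assms(1,2,6)])
  moreover have "x \<in> L" "h x \<in> W" "h' x \<in> W"
    using assms(4,5,7) calculation(1,2) unfolding invariant_under_def by blast+
  ultimately show ?thesis
    by (simp add: subspace_scale[OF assms(3)] subspace_diff[OF assms(3)])
qed

lemma fixed_imp_algebra_zero:
  assumes "H \<subseteq> so_algebra L ip" "subspace H" "x \<in> L"
    and "\<forall>h\<in>connected_subgroup L ip H. h x = x" "T \<in> H"
  shows "T x = 0"
proof -
  obtain h h' c where "h \<in> connected_subgroup L ip H" "h' \<in> connected_subgroup L ip H"
    "\<forall>x\<in>L. T x = c *\<^sub>R (h x - h' x)"
    by (rule skew_eq_exp_difference[OF assms(1,2,5)])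
  moreover have "h x = x" "h' x = x"
    using assms(4) calculation(1,2) by blast+
  ultimately show ?thesis using assms(3) by simp
qed

lemma algebra_zero_imp_fixed:
  assumes "H \<subseteq> so_algebra L ip" "x \<in> L" "\<forall>T\<in>H. T x = 0" "h \<in> connected_subgroup L ip H"
  shows "h x = x"
  using assms(4)
  by induction (use assms in \<open>auto simp: exp_endo_fixed subset_iff\<close>)

text \<open>Rodrigues' formula writes \<open>exp_endo L ip T x\<close> as a combination of
  \<open>x\<close>, \<open>T x\<close> and \<open>T (T x)\<close>, all of which lie in
  \<open>W\<close>; no limit is taken inside \<open>W\<close>.\<close>

lemma algebra_invariant_imp_invariant:
  assumes H: "H \<subseteq> so_algebra L ip" and W: "subspace W" "W \<subseteq> L" "\<forall>T\<in>H. \<forall>x\<in>W. T x \<in> W"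
  shows "invariant_under (connected_subgroup L ip H) W"
proof -
  have "exp_endo L ip T x \<in> W" if "T \<in> H" "x \<in> W" for T x
  proof -
    have T: "T \<in> so_algebra L ip" and x: "x \<in> L" using that H W by auto
    obtain \<theta> where \<theta>: "\<theta> \<ge> 0" "\<forall>x\<in>L. T (T (T x)) = (- \<theta>\<^sup>2) *\<^sub>R T x"
      "\<theta> = 0 \<longrightarrow> (\<forall>x\<in>L. T x = 0)" by (rule skew_cubed[OF T])
    show ?thesis
    proof (cases "\<theta> = 0")
      case True
      with \<theta>(3) x that show ?thesis by (simp add: exp_endo_fixed[OF T x])
    next
      case False
      have "T x \<in> W" "T (T x) \<in> W"
        using W(3) that by blast+
      then show ?thesis
        unfolding Rodrigues[OF T \<theta>(2) False x]
        by (intro subspace_add[OF W(1)] subspace_scale[OF W(1)] that(2))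
    qed
  qed
  moreover have "h x \<in> W" if "h \<in> connected_subgroup L ip H" "x \<in> W" for h x
    using that(1) by induction (use that(2) W(2) calculation in \<open>auto simp: subset_iff\<close>)
  ultimately show ?thesis by (auto simp: invariant_under_def)
qed

end

section \<open>Three-dimensional Riemannian Lie groups\<close>

lemma (in smooth_manifold) Jacobi_identity:
  assumes X: "X \<in> vector_fields A" and Y: "Y \<in> vector_fields A" and Z: "Z \<in> vector_fields A"
  shows "bracket X (bracket Y Z) + bracket Y (bracket Z X) + bracket Z (bracket X Y) = 0"
proof
  fix f
  have 0: "X 0 = 0" "Y 0 = 0" "Z 0 = 0"
    using vector_field_const[OF X, of 0] vector_field_const[OF Y, of 0] vector_field_const[OF Z, of 0]
    by (simp_all add: func_zero)
  show "(bracket X (bracket Y Z) + bracket Y (bracket Z X) + bracket Z (bracket X Y)) f = 0 f"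
  proof (cases "f \<in> smooth_funs A")
    case True
    then show ?thesis
      by (simp add: bracket_def vector_field_diff[OF X] vector_field_diff[OF Y]
          vector_field_diff[OF Z] vector_fieldD(1)[OF X] vector_fieldD(1)[OF Y]
          vector_fieldD(1)[OF Z])
  next
    case False
    then show ?thesis
      by (simp add: bracket_def vector_fieldD(5)[OF X] vector_fieldD(5)[OF Y]
          vector_fieldD(5)[OF Z] 0)
  qed
qed

locale riemannian_lie_group_3 = riemannian_lie_group A g D
  for A :: "('g::{topological_group_add, t2_space, second_countable_topology}, real^3) atlas"
    and g :: "'g metric" and D :: "'g connection"
begin

abbreviation "L \<equiv> lie_algebra A"
abbreviation "ip \<equiv> inner_prod g"

lemma lie_algebra_eqI:
  assumes "X \<in> L" "Y \<in> L" "value_at X 0 = value_at Y 0"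
  shows "X = Y"
proof (rule vector_field_eqI)
  fix p
  have "value_at X (p + 0) = push_left p (value_at X 0)"
    "value_at Y (p + 0) = push_left p (value_at Y 0)"
    using assms(1,2) unfolding lie_algebra_def by blast+
  with assms(3) show "value_at X p = value_at Y p" by simp
qed

lemma inner_prod_eq: "ip X Y = metric_on g X Y 0"
  by (simp add: inner_prod_def metric_on_def)

end

sublocale riemannian_lie_group_3 \<subseteq> inner_product_subspace "lie_algebra A" "inner_prod g"
proof
  note [simp] = lie_algebra_vector_field inner_prod_eq
  show "subspace L" by (rule subspace_lie_algebra)
  show "ip (x + y) z = ip x z + ip y z" if "x \<in> L" "y \<in> L" "z \<in> L" for x y z
    using that by (simp add: metric_on_add_left)
  show "ip (c *\<^sub>R x) y = c * ip x y" if "x \<in> L" "y \<in> L" for c x y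
    using that by (simp add: metric_on_scaleR_left scaleR_fun_apply)
  show "ip x y = ip y x" if "x \<in> L" "y \<in> L" for x y
    using that by (simp add: metric_on_commute)
  have pos: "ip x x > 0" if "x \<in> L" "x \<noteq> 0" for x
  proof -
    have "value_at x 0 \<noteq> 0"
      using lie_algebra_eqI[OF that(1) subspace_0[OF subspace_lie_algebra]] that(2)
      by (auto simp: value_at_simps)
    then show ?thesis
      using that metric_pos[OF riemannian value_at_tangent_space] by (simp add: metric_on_def)
  qed
  then show "ip x x > 0" if "x \<in> L" "x \<noteq> 0" for x using that .
  fix W assume W: "finite W" "W \<subseteq> L" "0 \<notin> W"
    and orth: "\<And>u v. u \<in> W \<Longrightarrow> v \<in> W \<Longrightarrow> u \<noteq> v \<Longrightarrow> ip u v = 0"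
  have inj: "inj_on (\<lambda>X. value_at X 0) W"
    using lie_algebra_eqI W(2) by (auto intro!: inj_onI)
  \<comment> \<open>Evaluation at the identity is injective on left invariant fields and carries
    \<open>ip\<close> to \<open>g 0\<close>, so the bound for tangent vectors applies.\<close>
  have "card ((\<lambda>X. value_at X 0) ` W) \<le> DIM(real^3)"
  proof (rule card_orthogonal_tangent_vectors[OF riemannian])
    show "(\<lambda>X. value_at X 0) ` W \<subseteq> tangent_space A 0"
      using W(2) by (auto intro!: value_at_tangent_space lie_algebra_vector_field)
    show "0 \<notin> (\<lambda>X. value_at X 0) ` W"
    proof
      assume "0 \<in> (\<lambda>X. value_at X 0) ` W"
      then obtain x where x: "x \<in> W" "value_at x 0 = 0" by force
      then have "x = 0"
        using lie_algebra_eqI[of x 0] W(2) subspace_0[OF subspace_lie_algebra] by (auto simp: value_at_simps)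
      with x W(3) show False by simp
    qed
  qed (use W(1) orth in \<open>auto simp: inner_prod_def\<close>)
  then show "card W \<le> 3"
    by (simp add: card_image[OF inj])
qed

context riemannian_lie_group_3
begin

section \<open>The connection as a bilinear operation on the Lie algebra\<close>

lemma connection_simps [simp]:
  "X \<in> L \<Longrightarrow> Y \<in> L \<Longrightarrow> D X Y \<in> L"
  "X \<in> L \<Longrightarrow> Y \<in> L \<Longrightarrow> Z \<in> L \<Longrightarrow> D (X + Y) Z = D X Z + D Y Z"
  "X \<in> L \<Longrightarrow> Y \<in> L \<Longrightarrow> Z \<in> L \<Longrightarrow> D X (Y + Z) = D X Y + D X Z"
  "X \<in> L \<Longrightarrow> Y \<in> L \<Longrightarrow> D (c *\<^sub>R X) Y = c *\<^sub>R D X Y"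
  "X \<in> L \<Longrightarrow> Y \<in> L \<Longrightarrow> D X (c *\<^sub>R Y) = c *\<^sub>R D X Y"
  by (simp_all add: connection_lie_algebra connection_add connection_scaleR lie_algebra_vector_field)

lemma connection_diff [simp]:
  "X \<in> L \<Longrightarrow> Y \<in> L \<Longrightarrow> Z \<in> L \<Longrightarrow> D (X - Y) Z = D X Z - D Y Z"
  "X \<in> L \<Longrightarrow> Y \<in> L \<Longrightarrow> Z \<in> L \<Longrightarrow> D X (Y - Z) = D X Y - D X Z"
  using connection_simps(2)[of X "(-1) *\<^sub>R Y" Z] connection_simps(3)[of X Y "(-1) *\<^sub>R Z"]
    connection_simps(4)[of Y Z "-1"] connection_simps(5)[of X Z "-1"] by auto

lemma connection_0 [simp]: "X \<in> L \<Longrightarrow> D X 0 = 0" "X \<in> L \<Longrightarrow> D 0 X = 0"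
  using connection_simps(5)[of X 0 0] connection_simps(4)[of 0 X 0] by auto

lemma bracket_eq: "X \<in> L \<Longrightarrow> Y \<in> L \<Longrightarrow> bracket X Y = D X Y - D Y X"
  by (simp add: torsion_free lie_algebra_vector_field)

lemma bracket_closed [simp]: "X \<in> L \<Longrightarrow> Y \<in> L \<Longrightarrow> bracket X Y \<in> L"
  by (rule bracket_lie_algebra)

text \<open>Inner products of left invariant fields are constant functions, so their derivative in
  metric compatibility drops out.\<close>

lemma connection_skew:
  assumes "X \<in> L" "Y \<in> L" "Z \<in> L"
  shows "ip (D X Y) Z = - ip Y (D X Z)"
proof -
  note v = lie_algebra_vector_field[OF assms(1)] lie_algebra_vector_field[OF assms(2)]
    lie_algebra_vector_field[OF assms(3)]
  have "X (metric_on g Y Z) = 0"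
    using vector_field_const[OF v(1)] metric_on_lie_algebra[OF assms(2,3)] by simp
  then have "(metric_on g (D X Y) Z + metric_on g Y (D X Z)) 0 = 0"
    using metric_compatible[OF v] by (metis zero_fun_apply)
  then show ?thesis by (simp add: inner_prod_eq)
qed

lemma connection_orthogonal: "X \<in> L \<Longrightarrow> Y \<in> L \<Longrightarrow> ip (D X Y) Y = 0"
  using connection_skew[of X Y Y] ip_commute[of Y "D X Y"] by simp

lemma curv_skew:
  assumes "X \<in> L" "Y \<in> L" "Z \<in> L" "W \<in> L"
  shows "ip (curv D X Y Z) W = - ip Z (curv D X Y W)"
  using assms by (simp add: curv_def connection_skew)

section \<open>Curvature endomorphisms and the holonomy algebra\<close>

definition curv_endo :: "'g vfield \<Rightarrow> 'g vfield \<Rightarrow> 'g vfield \<Rightarrow> 'g vfield" where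
  "curv_endo X Y = (\<lambda>Z. if Z \<in> L then curv D X Y Z else 0)"

lemma curv_endo_so: "X \<in> L \<Longrightarrow> Y \<in> L \<Longrightarrow> curv_endo X Y \<in> so_algebra L ip"
  by (auto simp: so_algebra_def curv_endo_def curv_skew) (simp_all add: curv_def algebra_simps)

text \<open>Keeps the hull from being an intersection over the empty family: so(L) is itself a
  subalgebra containing the curvature endomorphisms, hence bounds the holonomy algebra.\<close>

lemma so_subalgebra_so_algebra: "so_subalgebra L ip (so_algebra L ip)"
proof -
  have "subspace (so_algebra L ip)"
    by (rule subspaceI) (auto simp: so_algebra_def scaleR_fun_apply algebra_simps)
  moreover have "P \<circ> Q - Q \<circ> P \<in> so_algebra L ip"
    if "P \<in> so_algebra L ip" "Q \<in> so_algebra L ip" for P Q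
  proof -
    note P = so_algebraD[OF that(1)] and Q = so_algebraD[OF that(2)]
    have "P 0 = 0" "Q 0 = 0"
      using P(3)[of 0 0] Q(3)[of 0 0] by simp_all
    then show ?thesis
      by (auto simp: so_algebra_def P Q algebra_simps)
  qed
  ultimately show ?thesis by (simp add: so_subalgebra_def)
qed

abbreviation "H \<equiv> holonomy_algebra A g D"

lemma curv_endos_subset: "curv_endos A D \<subseteq> so_algebra L ip"
  using curv_endo_so by (auto simp: curv_endos_def curv_endo_def)

lemma holonomy_algebra_subset:
  assumes "so_subalgebra L ip S" "curv_endos A D \<subseteq> S" shows "H \<subseteq> S"
  unfolding holonomy_algebra_def by (rule hull_minimal) (use assms in auto)

lemma holonomy_algebra_so: "H \<subseteq> so_algebra L ip"
  by (rule holonomy_algebra_subset[OF so_subalgebra_so_algebra curv_endos_subset])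

lemma subspace_holonomy_algebra: "subspace H"
  unfolding holonomy_algebra_def hull_def
  by (rule subspace_Inter) (auto simp: so_subalgebra_def)

lemma curv_endo_holonomy: "X \<in> L \<Longrightarrow> Y \<in> L \<Longrightarrow> curv_endo X Y \<in> H"
  unfolding holonomy_algebra_def
  by (rule subsetD[OF hull_subset]) (auto simp: curv_endos_def curv_endo_def)

text \<open>The residual would be a fourth vector orthogonal to three nonzero ones. This turns an
  orthonormal triple into a basis.\<close>

lemma orthonormal_expansion:
  assumes "e1 \<in> L" "e2 \<in> L" "e3 \<in> L" "ip e1 e1 = 1" "ip e2 e2 = 1" "ip e3 e3 = 1"
    "ip e1 e2 = 0" "ip e1 e3 = 0" "ip e2 e3 = 0" "x \<in> L"
  shows "x = ip x e1 *\<^sub>R e1 + ip x e2 *\<^sub>R e2 + ip x e3 *\<^sub>R e3"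
proof -
  define r where "r = x - (ip x e1 *\<^sub>R e1 + ip x e2 *\<^sub>R e2 + ip x e3 *\<^sub>R e3)"
  have sym: "ip e2 e1 = 0" "ip e3 e1 = 0" "ip e3 e2 = 0"
    using assms ip_commute by metis+
  have r: "r \<in> L" "ip r e1 = 0" "ip r e2 = 0" "ip r e3 = 0"
    using assms sym by (simp_all add: r_def)
  have "e1 \<noteq> 0" "e2 \<noteq> 0" "e3 \<noteq> 0"
    using assms by auto
  then have "r = 0"
    using no_four_orthogonal[of r e1 e2 e3] r assms by blast
  then show ?thesis by (simp add: r_def)
qed

lemma connection_minus [simp]:
  "X \<in> L \<Longrightarrow> Y \<in> L \<Longrightarrow> D (- X) Y = - D X Y" "X \<in> L \<Longrightarrow> Y \<in> L \<Longrightarrow> D X (- Y) = - D X Y"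
  using connection_diff(1)[of 0 X Y] connection_diff(2)[of X 0 Y] by simp_all

lemma Koszul_lie_algebra:
  assumes "X \<in> L" "Y \<in> L" "Z \<in> L"
  shows "ip (D X Y) Z = (ip (bracket X Y) Z - ip (bracket X Z) Y - ip (bracket Y Z) X) / 2"
proof -
  note v = lie_algebra_vector_field[OF assms(1)] lie_algebra_vector_field[OF assms(2)]
    lie_algebra_vector_field[OF assms(3)]
  have "X (metric_on g Y Z) = 0" "Y (metric_on g X Z) = 0" "Z (metric_on g X Y) = 0"
    by (simp_all only: metric_on_lie_algebra assms vector_field_const[OF v(1)]
        vector_field_const[OF v(2)] vector_field_const[OF v(3)])
  then have "(2 *\<^sub>R metric_on g (D X Y) Z) 0 = (0 + 0 - 0 + metric_on g (bracket X Y) Z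
      - metric_on g (bracket X Z) Y - metric_on g (bracket Y Z) X) 0"
    using Koszul[OF v] by simp
  then show ?thesis by (simp add: inner_prod_eq scaleR_fun_apply)
qed

end

section \<open>The Lie algebra with \<open>[e1, e2] = a e2\<close> as only bracket\<close>

text \<open>The Lie algebra aff(R) + R: \<open>e1\<close> and \<open>e2\<close> span a hyperbolic
  plane of curvature - a^2 and \<open>e3\<close> the flat factor.\<close>

locale solvable_frame = riemannian_lie_group_3 +
  fixes e1 e2 e3 :: "'a vfield" and a :: real
  assumes frame_mem [simp]: "e1 \<in> L" "e2 \<in> L" "e3 \<in> L"
    and orthonormal [simp]: "ip e1 e1 = 1" "ip e2 e2 = 1" "ip e3 e3 = 1"
      "ip e1 e2 = 0" "ip e1 e3 = 0" "ip e2 e3 = 0"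
    and brackets: "bracket e1 e2 = a *\<^sub>R e2" "bracket e1 e3 = 0" "bracket e2 e3 = 0"
    and a_pos: "a > 0"
begin

lemma orthonormal' [simp]: "ip e2 e1 = 0" "ip e3 e1 = 0" "ip e3 e2 = 0"
  using ip_commute[of e1 e2] ip_commute[of e1 e3] ip_commute[of e2 e3] by simp_all

lemma expansion: "x \<in> L \<Longrightarrow> x = ip x e1 *\<^sub>R e1 + ip x e2 *\<^sub>R e2 + ip x e3 *\<^sub>R e3"
  by (rule orthonormal_expansion) simp_all

lemma eqI:
  assumes "x \<in> L" "y \<in> L" "ip x e1 = ip y e1" "ip x e2 = ip y e2" "ip x e3 = ip y e3"
  shows "x = y"
  using expansion[OF assms(1)] expansion[OF assms(2)] assms(3-5) by metis

definition J where "J x = ip x e1 *\<^sub>R e2 - ip x e2 *\<^sub>R e1"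

lemma J_closed [simp]: "J x \<in> L"
  by (simp add: J_def)

lemma brackets':
  "bracket e1 e1 = 0" "bracket e2 e2 = 0" "bracket e3 e3 = 0"
  "bracket e2 e1 = (- a) *\<^sub>R e2" "bracket e3 e1 = 0" "bracket e3 e2 = 0"
  using brackets by (simp_all add: bracket_eq algebra_simps)

lemma connection_frame:
  "D e1 e1 = 0" "D e1 e2 = 0" "D e1 e3 = 0" "D e3 e1 = 0" "D e3 e2 = 0" "D e3 e3 = 0"
  "D e2 e3 = 0" "D e2 e1 = (- a) *\<^sub>R e2" "D e2 e2 = a *\<^sub>R e1"
  by (rule eqI; simp add: Koszul_lie_algebra brackets brackets')+

lemma connection_eq:
  assumes "x \<in> L" "y \<in> L"
  shows "D x y = (- a * ip x e2) *\<^sub>R J y"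
proof -
  have "D x y = D (ip x e1 *\<^sub>R e1 + ip x e2 *\<^sub>R e2 + ip x e3 *\<^sub>R e3)
      (ip y e1 *\<^sub>R e1 + ip y e2 *\<^sub>R e2 + ip y e3 *\<^sub>R e3)"
    using expansion[OF assms(1)] expansion[OF assms(2)] by simp
  then show ?thesis
    by (simp add: connection_frame J_def algebra_simps)
qed

text \<open>All operators \<open>D x\<close> are multiples of the same rotation \<open>J\<close> and
  therefore commute, so only the bracket term of the curvature survives.\<close>

lemma curv_eq:
  assumes "x \<in> L" "y \<in> L" "z \<in> L"
  shows "curv D x y z = (- a * ip (bracket x y) e2) *\<^sub>R J z"
proof -
  have "D x (D y z) = D y (D x z)"
    using assms by (simp add: connection_eq[of _ z] connection_eq[of _ "J z"] algebra_simps)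
  then show ?thesis
    using assms by (simp add: curv_def connection_eq[of "bracket x y" z])
qed

lemma curv_e1_e2:
  "z \<in> L \<Longrightarrow> curv D e1 e2 z = (- a\<^sup>2) *\<^sub>R J z"
  by (simp add: curv_eq brackets power2_eq_square)

text \<open>The line of \<open>e3\<close> at index 0 and the plane of \<open>e1\<close>,
  \<open>e2\<close> at every other index; with \<open>k = 1\<close> only 0 and 1 occur.\<close>

definition V where "V i = (if i = 0 then {x \<in> L. ip x e1 = 0 \<and> ip x e2 = 0} else {x \<in> L. ip x e3 = 0})"
  for i :: nat

lemma subspace_V: "subspace (V i)"
  by (rule subspaceI) (auto simp: V_def)

lemma V_subset: "V i \<subseteq> L"
  by (auto simp: V_def)

lemma J_V: "x \<in> L \<Longrightarrow> J x \<in> V (Suc 0)"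
  by (simp add: V_def J_def)

text \<open>The holonomy algebra is a hull, so bounding it amounts to exhibiting a subalgebra that
  contains the curvature; here this is the stabilizer of \<open>e3\<close>.\<close>

lemma so_subalgebra_annihilator: "so_subalgebra L ip {T \<in> so_algebra L ip. T e3 = 0}"
proof -
  have z: "T 0 = 0" if "T \<in> so_algebra L ip" for T
    using so_algebraD(3)[OF that, of 0 0] by simp
  show ?thesis
    using so_subalgebra_so_algebra unfolding so_subalgebra_def subspace_def
    by (auto simp: scaleR_fun_apply z) (simp add: fun_eq_iff)
qed

lemma holonomy_algebra_annihilates:
  assumes "T \<in> H" shows "T e3 = 0"
proof -
  have "curv_endos A D \<subseteq> {T \<in> so_algebra L ip. T e3 = 0}"
    using curv_endos_subset by (auto simp: curv_endos_def curv_eq J_def)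
  then show ?thesis
    using holonomy_algebra_subset[OF so_subalgebra_annihilator] assms by blast
qed

lemma V_decomposition: "V_decomposition A g D 1 V"
proof -
  let ?G = "holonomy_group A g D"
  have G: "?G = connected_subgroup L ip H"
    by (simp add: holonomy_group_def)
  note HG = holonomy_algebra_so subspace_holonomy_algebra
  have T0: "T x = 0" if "T \<in> H" "x \<in> V 0" for T x
  proof -
    note T = so_algebraD[OF subsetD[OF holonomy_algebra_so that(1)]]
    have "x = ip x e3 *\<^sub>R e3" using expansion[of x] that(2) by (simp add: V_def)
    moreover have "T (ip x e3 *\<^sub>R e3) = 0"
      by (simp add: T(3) holonomy_algebra_annihilates[OF that(1)])
    ultimately show ?thesis by simp
  qed
  have T1: "\<forall>T\<in>H. \<forall>x\<in>V 1. T x \<in> V 1"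
  proof
    fix T assume T: "T \<in> H"
    then show "\<forall>x\<in>V 1. T x \<in> V 1"
      using so_algebraD[OF subsetD[OF holonomy_algebra_so T]] holonomy_algebra_annihilates[OF T]
      by (simp add: V_def)
  qed
  have fixed: "\<forall>h\<in>?G. \<forall>x\<in>V 0. h x = x"
    unfolding G using algebra_zero_imp_fixed[OF holonomy_algebra_so] T0 V_subset by blast
  have inv: "invariant_under ?G (V i)" if "i \<le> 1" for i
  proof (cases "i = 0")
    case True
    with fixed show ?thesis by (simp add: invariant_under_def)
  next
    case False
    with that have "i = 1" by simp
    moreover have "invariant_under (connected_subgroup L ip H) (V 1)"
      by (rule algebra_invariant_imp_invariant[OF holonomy_algebra_so subspace_V V_subset T1])
    ultimately show ?thesis unfolding G by (elim ssubst)
  qed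
  have orth: "ip x y = 0" if "x \<in> V 0" "y \<in> V 1" for x y
  proof -
    have "x = ip x e3 *\<^sub>R e3" using expansion[of x] that(1) by (simp add: V_def)
    moreover have "ip (ip x e3 *\<^sub>R e3) y = 0"
      using that ip_commute[of e3 y] by (simp add: V_def)
    ultimately show ?thesis by simp
  qed
  have "span (\<Union>i\<le>1. V i) = L"
  proof (rule antisym)
    show "span (\<Union>i\<le>1. V i) \<subseteq> L"
      using V_subset subspace_L by (intro span_minimal) auto
    show "L \<subseteq> span (\<Union>i\<le>1. V i)"
    proof
      fix x assume x: "x \<in> L"
      have "ip x e3 *\<^sub>R e3 \<in> V 0" "ip x e1 *\<^sub>R e1 + ip x e2 *\<^sub>R e2 \<in> V 1"
        by (simp_all add: V_def)
      then have "ip x e3 *\<^sub>R e3 \<in> span (\<Union>i\<le>1. V i)"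
        "ip x e1 *\<^sub>R e1 + ip x e2 *\<^sub>R e2 \<in> span (\<Union>i\<le>1. V i)"
        by (auto intro!: span_base)
      from span_add[OF this(2,1)] show "x \<in> span (\<Union>i\<le>1. V i)"
        using expansion[OF x] by simp
    qed
  qed
  moreover have "irreducible_under ?G (V 1)"
    unfolding irreducible_under_def
  proof (intro conjI allI impI)
    have "e1 \<in> V 1" "e1 \<noteq> 0" using orthonormal(1) by (auto simp: V_def simp del: orthonormal(1))
    then show "V 1 \<noteq> {0}" by blast
    fix W assume W: "subspace W \<and> W \<subseteq> V 1 \<and> invariant_under ?G W"
    show "W = {0} \<or> W = V 1"
    proof (rule disjCI)
      assume "W \<noteq> V 1"
      have "w = 0" if w: "w \<in> W" for w
      proof (rule ccontr)
        assume "w \<noteq> 0"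
        have wL: "w \<in> L" "ip w e3 = 0" using W w by (auto simp: V_def)
        let ?p = "ip w e1" and ?q = "ip w e2"
        have we: "w = ?p *\<^sub>R e1 + ?q *\<^sub>R e2" using expansion[OF wL(1)] wL(2) by simp
        have n: "?p\<^sup>2 + ?q\<^sup>2 \<noteq> 0"
          using we \<open>w \<noteq> 0\<close> by (auto simp: sum_power2_eq_zero_iff)
        \<comment> \<open>The curvature acts on the plane as a nonzero multiple of \<open>J\<close>,
          so \<open>W\<close> contains with \<open>w\<close> also its rotation \<open>J w\<close>,
          and these two span the plane.\<close>
        have "curv_endo e1 e2 w \<in> W"
          using invariant_imp_algebra_invariant[OF HG, of W "curv_endo e1 e2" w] W w V_subset
            curv_endo_holonomy[of e1 e2] by (auto simp: G)
        then have "(- a\<^sup>2) *\<^sub>R J w \<in> W"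
          using wL by (simp add: curv_endo_def curv_e1_e2)
        then have "(- 1 / a\<^sup>2) *\<^sub>R ((- a\<^sup>2) *\<^sub>R J w) \<in> W"
          by (rule subspace_scale[OF conjunct1[OF W]])
        then have Jw: "J w \<in> W" using a_pos by simp
        have comb: "x *\<^sub>R w + y *\<^sub>R J w \<in> W" for x y
          by (intro subspace_add[OF conjunct1[OF W]] subspace_scale[OF conjunct1[OF W]] w Jw)
        have "x \<in> W" if x: "x \<in> V 1" for x
        proof -
          have xL: "x \<in> L" "ip x e3 = 0" using x by (auto simp: V_def)
          let ?n = "?p\<^sup>2 + ?q\<^sup>2"
          \<comment> \<open>The numerators are the inner products of \<open>x\<close> with
            \<open>w\<close> and \<open>J w\<close>; both vectors have squared length
            \<open>?n\<close>.\<close>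
          have "x = ((ip x e1 * ?p + ip x e2 * ?q) / ?n) *\<^sub>R w + ((ip x e2 * ?p - ip x e1 * ?q) / ?n) *\<^sub>R J w"
            by (rule eqI) (use n xL wL in \<open>auto simp: J_def divide_simps power2_eq_square algebra_simps\<close>)
          then show ?thesis using comb by metis
        qed
        with W \<open>W \<noteq> V 1\<close> show False by blast
      qed
      then show "W = {0}" using W subspace_0 by blast
    qed
  qed
  \<comment> \<open>If the group fixed \<open>e1\<close>, the curvature would annihilate it, but
    R(e1, e2) e1 = - a^2 e2.\<close>
  moreover have "\<exists>h\<in>?G. \<exists>x\<in>V 1. h x \<noteq> x"
  proof (rule ccontr)
    assume "\<not> ?thesis"
    moreover have "e1 \<in> V 1" by (simp add: V_def)
    ultimately have "\<forall>h\<in>connected_subgroup L ip H. h e1 = e1" by (auto simp: G)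
    from fixed_imp_algebra_zero[OF HG frame_mem(1) this curv_endo_holonomy[OF frame_mem(1,2)]]
    have "a\<^sup>2 *\<^sub>R e2 = 0"
      by (simp add: curv_endo_def curv_e1_e2 J_def)
    then have "e2 = 0" using a_pos by simp
    then show False using orthonormal(2) by simp
  qed
  moreover have "ip x y = 0" if "x \<in> V 1" "y \<in> V 0" for x y
    using orth[OF that(2,1)] ip_commute[of x y] that V_subset by auto
  ultimately show ?thesis
    unfolding V_decomposition_def
    using subspace_V inv fixed orth by (auto simp: le_Suc_eq)
qed

theorem admits_Z_decomposition: "admits_Z_decomposition A g D"
proof -
  have "curv D e1 e2 e1 \<noteq> 0"
  proof
    assume "curv D e1 e2 e1 = 0"
    then have "e2 = 0" using a_pos by (simp add: curv_e1_e2 J_def)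
    then show False using orthonormal(2) by simp
  qed
  \<comment> \<open>Derivatives are multiples of values of \<open>J\<close>, so they stay in the
    plane: \<open>Z_1\<close> is no larger than \<open>V_1\<close>, which leaves \<open>e3\<close>
    for \<open>Z_0\<close>.\<close>
  moreover have iter: "iterated_derivs D (V (Suc 0)) \<subseteq> V (Suc 0)"
  proof
    fix x assume "x \<in> iterated_derivs D (V (Suc 0))"
    then show "x \<in> V (Suc 0)"
    proof induction
      case (step u w)
      then have "u \<in> L" "w \<in> L" using V_subset by auto
      then show ?case
        by (simp only: connection_eq subspace_scale[OF subspace_V J_V])
    qed
  qed
  have "e3 \<in> Z_part A g D 1 V 0"
  proof -
    have "span (\<Union>j\<in>{1..1}. span (iterated_derivs D (V j))) \<subseteq> V (Suc 0)"
      using iter by (intro span_minimal subspace_V) (auto dest: span_minimal[OF _ subspace_V])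
    then show ?thesis
      using ip_commute[of e3] by (auto simp: Z_part_def V_def)
  qed
  moreover have "e1 \<in> Z_part A g D 1 V 1"
    unfolding Z_part_def
    by (auto intro!: span_base iterated_derivs.base simp: V_def)
  moreover have "e1 \<noteq> 0" "e3 \<noteq> 0"
    using orthonormal(1,3) by (auto simp del: orthonormal)
  ultimately have "\<exists>i\<le>1. \<exists>j\<le>1. i \<noteq> j \<and> Z_part A g D 1 V i \<noteq> {0} \<and> Z_part A g D 1 V j \<noteq> {0}"
    by (intro exI[of _ 0] exI[of _ 1] conjI) auto
  with V_decomposition \<open>curv D e1 e2 e1 \<noteq> 0\<close> show ?thesis
    unfolding admits_Z_decomposition_def using frame_mem by blast
qed

subsection \<open>Local symmetry\<close>

lemma frame_vector_fields [simp]: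
  "e1 \<in> vector_fields A" "e2 \<in> vector_fields A" "e3 \<in> vector_fields A"
  by (simp_all add: lie_algebra_vector_field)

lemma metric_on_frame:
  "metric_on g e1 e1 = 1" "metric_on g e2 e2 = 1" "metric_on g e3 e3 = 1"
  "metric_on g e1 e2 = 0" "metric_on g e1 e3 = 0" "metric_on g e2 e3 = 0"
  "metric_on g e2 e1 = 0" "metric_on g e3 e1 = 0" "metric_on g e3 e2 = 0"
  by (simp_all add: metric_on_lie_algebra fun_eq_iff)

text \<open>Together with \<open>\<omega>\<close> and \<open>\<eta>\<close> this is the dual
  coframe. The connection form of the plane is - a \<omega>: \<open>D W\<close> acts on the frame as
  - a \<omega>(W) times \<open>J\<close>.\<close>

definition \<theta> where "\<theta> X = metric_on g X e1"
definition \<omega> where "\<omega> X = metric_on g X e2"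
definition \<eta> where "\<eta> X = metric_on g X e3"

lemma components_smooth [simp]:
  assumes "X \<in> vector_fields A"
  shows "\<theta> X \<in> smooth_funs A" "\<omega> X \<in> smooth_funs A" "\<eta> X \<in> smooth_funs A"
  using assms by (simp_all add: \<theta>_def \<omega>_def \<eta>_def metric_on_smooth)

text \<open>Left invariant fields form a frame over the smooth functions: at a point where the
  residual were nonzero, four orthogonal nonzero tangent vectors would exist.\<close>

lemma vector_field_expansion:
  assumes X: "X \<in> vector_fields A"
  shows "X = fmult (\<theta> X) e1 + fmult (\<omega> X) e2 + fmult (\<eta> X) e3"
proof (rule vector_field_eqI)
  fix p :: 'a
  let ?S = "fmult (\<theta> X) e1 + fmult (\<omega> X) e2 + fmult (\<eta> X) e3"
  have f: "fmult (\<theta> X) e1 \<in> vector_fields A" "fmult (\<omega> X) e2 \<in> vector_fields A"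
    "fmult (\<eta> X) e3 \<in> vector_fields A"
    using X by (simp_all add: fmult_vector_field)
  note f12 = subspace_add[OF subspace_vector_fields f(1,2)]
  have S: "?S \<in> vector_fields A"
    by (rule subspace_add[OF subspace_vector_fields f12 f(3)])
  define R where "R = X - ?S"
  have R: "R \<in> vector_fields A"
    unfolding R_def by (rule subspace_diff[OF subspace_vector_fields X S])
  have Re: "metric_on g R e = 0" if "e = e1 \<or> e = e2 \<or> e = e3" for e
  proof -
    have e: "e \<in> vector_fields A" using that by auto
    show ?thesis
      unfolding R_def metric_on_diff_left[OF X S e] metric_on_add_left[OF f12 f(3) e]
        metric_on_add_left[OF f(1,2) e]
      using that by (auto simp: metric_on_fmult_left metric_on_frame \<theta>_def \<omega>_def \<eta>_def)
  qed
  let ?v = "\<lambda>X. value_at X p"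
  have ip: "g p (?v Y) (?v Z) = metric_on g Y Z p" for Y Z
    by (simp add: metric_on_def)
  have m: "metric_on g R e1 = 0" "metric_on g R e2 = 0" "metric_on g R e3 = 0"
    "metric_on g e1 R = 0" "metric_on g e2 R = 0" "metric_on g e3 R = 0"
    using Re metric_on_commute[OF frame_vector_fields(1) R]
      metric_on_commute[OF frame_vector_fields(2) R] metric_on_commute[OF frame_vector_fields(3) R]
    by simp_all
  have "?v R = 0"
  proof (rule ccontr)
    assume nz: "?v R \<noteq> 0"
    have z: "g p 0 w = 0" if "w \<in> tangent_space A p" for w
      using metric_scaleR[OF riemannian that that, of 0] by simp
    let ?W = "{?v R, ?v e1, ?v e2, ?v e3}"
    have T: "?W \<subseteq> tangent_space A p"
      using R by (auto intro: value_at_tangent_space)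
    have RR: "metric_on g R R p > 0"
      using metric_pos[OF riemannian value_at_tangent_space[OF R] nz] by (simp add: ip)
    have ne: "?v Y \<noteq> ?v Z" if "metric_on g Y Z p = 0" "metric_on g Y Y p > 0" for Y Z
      using that unfolding ip[symmetric] by auto
    have s: "?v Y \<noteq> 0" if "Y \<in> vector_fields A" "metric_on g Y Y p > 0" for Y
      using that z[OF value_at_tangent_space[OF that(1)]] unfolding ip[symmetric] by auto
    have "?v R \<noteq> ?v e1" "?v R \<noteq> ?v e2" "?v R \<noteq> ?v e3" "?v e1 \<noteq> ?v e2" "?v e1 \<noteq> ?v e3" "?v e2 \<noteq> ?v e3"
      using RR by (intro ne; simp add: m metric_on_frame)+
    then have "distinct [?v R, ?v e1, ?v e2, ?v e3]" by simp
    then have "card ?W = 4" by simp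
    moreover have "card ?W \<le> DIM(real^3)"
    proof (rule card_orthogonal_tangent_vectors[OF riemannian _ T])
      show "0 \<notin> ?W" using s[OF R RR] s[of e1] s[of e2] s[of e3] by (auto simp: metric_on_frame)
      show "g p u v = 0" if "u \<in> ?W" "v \<in> ?W" "u \<noteq> v" for u v
        using that by (auto simp: ip m metric_on_frame)
    qed simp
    ultimately show False by simp
  qed
  moreover have "X = R + ?S" by (simp add: R_def)
  ultimately show "?v X = ?v ?S"
    by (metis add_0 value_at_simps(1))
qed

lemma connection_e:
  assumes W: "W \<in> vector_fields A"
  shows "D W e1 = fmult (\<omega> W) ((- a) *\<^sub>R e2)" "D W e2 = fmult (\<omega> W) (a *\<^sub>R e1)" "D W e3 = 0"
proof -
  have "D W e = fmult (\<theta> W) (D e1 e) + fmult (\<omega> W) (D e2 e) + fmult (\<eta> W) (D e3 e)"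
    if e: "e \<in> vector_fields A" for e
  proof -
    have f: "fmult (\<theta> W) e1 \<in> vector_fields A" "fmult (\<omega> W) e2 \<in> vector_fields A"
      "fmult (\<eta> W) e3 \<in> vector_fields A"
      using W by (simp_all add: fmult_vector_field)
    have "D W e = D (fmult (\<theta> W) e1 + fmult (\<omega> W) e2 + fmult (\<eta> W) e3) e"
      using vector_field_expansion[OF W] by simp
    then show ?thesis
      using W e by (simp add: connection_add(1)[OF subspace_add[OF subspace_vector_fields f(1,2)] f(3) e]
          connection_add(1)[OF f(1,2) e] connection_fmult)
  qed
  moreover have "fmult f 0 = 0" for f :: "'a \<Rightarrow> real"
    by (simp add: fmult_def fun_eq_iff)
  ultimately show "D W e1 = fmult (\<omega> W) ((- a) *\<^sub>R e2)" "D W e2 = fmult (\<omega> W) (a *\<^sub>R e1)" "D W e3 = 0"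
    by (simp_all add: connection_frame)
qed

text \<open>The extra terms come from pairing \<open>X\<close> with the rotating frame vectors
  \<open>D W e1\<close> and \<open>D W e2\<close> in metric compatibility.\<close>

lemma derivative_components:
  assumes W: "W \<in> vector_fields A" and X: "X \<in> vector_fields A"
  shows "W (\<theta> X) = \<theta> (D W X) - a *\<^sub>R (\<omega> W * \<omega> X)"
    "W (\<omega> X) = \<omega> (D W X) + a *\<^sub>R (\<omega> W * \<theta> X)"
proof -
  have s: "c *\<^sub>R e1 \<in> vector_fields A" "c *\<^sub>R e2 \<in> vector_fields A" for c
    by (simp_all add: subspace_scale[OF subspace_vector_fields])
  show "W (\<theta> X) = \<theta> (D W X) - a *\<^sub>R (\<omega> W * \<omega> X)"
    "W (\<omega> X) = \<omega> (D W X) + a *\<^sub>R (\<omega> W * \<theta> X)"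
    using metric_compatible[OF W X frame_vector_fields(1)] metric_compatible[OF W X frame_vector_fields(2)]
    unfolding connection_e[OF W] metric_on_fmult_right[OF s(1) X components_smooth(2)[OF W]]
      metric_on_fmult_right[OF s(2) X components_smooth(2)[OF W]]
      metric_on_scaleR_right[OF frame_vector_fields(1) X] metric_on_scaleR_right[OF frame_vector_fields(2) X]
    by (simp_all add: \<theta>_def \<omega>_def fun_eq_iff scaleR_fun_apply)
qed

text \<open>Equals - a^2 times the area form of the plane field of \<open>e1\<close> and
  \<open>e2\<close>, that is, the curvature form.\<close>

definition \<kappa> where "\<kappa> X Y = a\<^sup>2 *\<^sub>R (\<omega> X * \<theta> Y - \<omega> Y * \<theta> X)"

lemma component_bracket:
  assumes "X \<in> vector_fields A" "Y \<in> vector_fields A"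
  shows "\<omega> (bracket X Y) = \<omega> (D X Y) - \<omega> (D Y X)"
  using assms by (simp add: \<omega>_def torsion_free metric_on_diff_left connection_vector_field)

text \<open>The second structure equation: X(\<omega> Y) - Y(\<omega> X) - \<omega>([X, Y]) equals
  \<kappa>(X, Y) / a, and the terms quadratic in the connection form cancel because rotations of one
  plane commute.\<close>

lemma curv_frame:
  assumes X: "X \<in> vector_fields A" and Y: "Y \<in> vector_fields A"
  shows "curv D X Y e1 = fmult (\<kappa> X Y) e2" "curv D X Y e2 = - fmult (\<kappa> X Y) e1" "curv D X Y e3 = 0"
proof -
  have s: "c *\<^sub>R e1 \<in> vector_fields A" "c *\<^sub>R e2 \<in> vector_fields A" for c
    by (simp_all add: subspace_scale[OF subspace_vector_fields])
  have DD1: "D X (D Y e1) = fmult (X (\<omega> Y)) ((- a) *\<^sub>R e2) + fmult (\<omega> Y) ((- a) *\<^sub>R fmult (\<omega> X) (a *\<^sub>R e1))"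
    if X: "X \<in> vector_fields A" and Y: "Y \<in> vector_fields A" for X Y
    unfolding connection_e[OF Y] connection_fmult(2)[OF components_smooth(2)[OF Y] X s(2)]
      connection_scaleR(2)[OF X frame_vector_fields(2)] connection_e[OF X] by (rule refl)
  have DD2: "D X (D Y e2) = fmult (X (\<omega> Y)) (a *\<^sub>R e1) + fmult (\<omega> Y) (a *\<^sub>R fmult (\<omega> X) ((- a) *\<^sub>R e2))"
    if X: "X \<in> vector_fields A" and Y: "Y \<in> vector_fields A" for X Y
    unfolding connection_e[OF Y] connection_fmult(2)[OF components_smooth(2)[OF Y] X s(1)]
      connection_scaleR(2)[OF X frame_vector_fields(1)] connection_e[OF X] by (rule refl)
  note r = derivative_components(2)[OF X Y] derivative_components(2)[OF Y X] component_bracket[OF X Y]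
  show "curv D X Y e1 = fmult (\<kappa> X Y) e2"
    unfolding curv_def DD1[OF X Y] DD1[OF Y X] connection_e[OF bracket_vector_field[OF X Y]] r
    by (simp add: fun_eq_iff fmult_def \<kappa>_def scaleR_fun_apply power2_eq_square algebra_simps)
  show "curv D X Y e2 = - fmult (\<kappa> X Y) e1"
    unfolding curv_def DD2[OF X Y] DD2[OF Y X] connection_e[OF bracket_vector_field[OF X Y]] r
    by (simp add: fun_eq_iff fmult_def \<kappa>_def scaleR_fun_apply power2_eq_square algebra_simps)
  show "curv D X Y e3 = 0"
    unfolding curv_def connection_e[OF X] connection_e[OF Y] connection_e[OF bracket_vector_field[OF X Y]]
    using connection_scaleR(2)[OF X frame_vector_fields(1), of 0]
      connection_scaleR(2)[OF Y frame_vector_fields(1), of 0] by simp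
qed

lemma curv_vector_fields:
  assumes X: "X \<in> vector_fields A" and Y: "Y \<in> vector_fields A" and Z: "Z \<in> vector_fields A"
  shows "curv D X Y Z = fmult (\<kappa> X Y * \<theta> Z) e2 - fmult (\<kappa> X Y * \<omega> Z) e1"
proof -
  have f: "fmult (\<theta> Z) e1 \<in> vector_fields A" "fmult (\<omega> Z) e2 \<in> vector_fields A"
    "fmult (\<eta> Z) e3 \<in> vector_fields A"
    using Z by (simp_all add: fmult_vector_field)
  have "curv D X Y Z = curv D X Y (fmult (\<theta> Z) e1 + fmult (\<omega> Z) e2 + fmult (\<eta> Z) e3)"
    using vector_field_expansion[OF Z] by simp
  also have "\<dots> = fmult (\<theta> Z) (fmult (\<kappa> X Y) e2) + fmult (\<omega> Z) (- fmult (\<kappa> X Y) e1) + fmult (\<eta> Z) 0"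
    using Z by (simp add: curv_add[OF X Y subspace_add[OF subspace_vector_fields f(1,2)] f(3)]
        curv_add[OF X Y f(1,2)] curv_fmult[OF X Y] curv_frame[OF X Y])
  finally show ?thesis
    by (simp add: fun_eq_iff fmult_def algebra_simps)
qed

theorem locally_symmetric: "locally_symmetric A D"
  unfolding locally_symmetric_def
proof (intro ballI)
  fix W X Y Z
  assume W: "W \<in> vector_fields A" and X: "X \<in> vector_fields A" and Y: "Y \<in> vector_fields A"
    and Z: "Z \<in> vector_fields A"
  note D = connection_vector_field
  note c = components_smooth
  note s = smooth_funs_scaleR smooth_funs_mult smooth_funs_diff
  have \<kappa>: "\<kappa> X Y \<in> smooth_funs A"
    unfolding \<kappa>_def by (intro s c X Y)
  have 1: "W (\<omega> X * \<theta> Y - \<omega> Y * \<theta> X) =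
      \<omega> X * W (\<theta> Y) + W (\<omega> X) * \<theta> Y - (\<omega> Y * W (\<theta> X) + W (\<omega> Y) * \<theta> X)"
    using X Y by (simp add: vector_field_diff[OF W] vector_fieldD(4)[OF W] s)
  have 2: "W (\<kappa> X Y) = a\<^sup>2 *\<^sub>R W (\<omega> X * \<theta> Y - \<omega> Y * \<theta> X)"
    unfolding \<kappa>_def by (rule vector_fieldD(3)[OF W]) (intro s c X Y)
  \<comment> \<open>The area form is invariant under rotations of the plane: the terms added by
    \<open>derivative_components\<close> cancel in the antisymmetric expression.\<close>
  have d\<kappa>: "W (\<kappa> X Y) = \<kappa> (D W X) Y + \<kappa> X (D W Y)"
    unfolding 2 1 derivative_components[OF W X] derivative_components[OF W Y]
    by (simp add: \<kappa>_def fun_eq_iff scaleR_fun_apply algebra_simps)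
  have f: "\<kappa> X Y * \<theta> Z \<in> smooth_funs A" "\<kappa> X Y * \<omega> Z \<in> smooth_funs A"
    by (intro s c \<kappa> Z)+
  have d: "W (\<kappa> X Y * \<theta> Z) = \<kappa> X Y * (\<theta> (D W Z) - a *\<^sub>R (\<omega> W * \<omega> Z)) + (\<kappa> (D W X) Y + \<kappa> X (D W Y)) * \<theta> Z"
    "W (\<kappa> X Y * \<omega> Z) = \<kappa> X Y * (\<omega> (D W Z) + a *\<^sub>R (\<omega> W * \<theta> Z)) + (\<kappa> (D W X) Y + \<kappa> X (D W Y)) * \<omega> Z"
    using vector_fieldD(4)[OF W \<kappa> c(1)[OF Z]] vector_fieldD(4)[OF W \<kappa> c(2)[OF Z]]
    unfolding derivative_components[OF W Z] d\<kappa> .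
  have v: "fmult (\<kappa> X Y * \<theta> Z) e2 \<in> vector_fields A" "fmult (\<kappa> X Y * \<omega> Z) e1 \<in> vector_fields A"
    by (simp_all add: fmult_vector_field f)
  have "D W (curv D X Y Z) = D W (fmult (\<kappa> X Y * \<theta> Z) e2 + (- 1) *\<^sub>R fmult (\<kappa> X Y * \<omega> Z) e1)"
    by (simp add: curv_vector_fields[OF X Y Z])
  also have "\<dots> = fmult (W (\<kappa> X Y * \<theta> Z)) e2 + fmult (\<kappa> X Y * \<theta> Z) (fmult (\<omega> W) (a *\<^sub>R e1)) +
      (- 1) *\<^sub>R (fmult (W (\<kappa> X Y * \<omega> Z)) e1 + fmult (\<kappa> X Y * \<omega> Z) (fmult (\<omega> W) ((- a) *\<^sub>R e2)))"
    unfolding connection_add(2)[OF W v(1) subspace_scale[OF subspace_vector_fields v(2)]]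
      connection_scaleR(2)[OF W v(2)] connection_fmult(2)[OF f(1) W frame_vector_fields(2)]
      connection_fmult(2)[OF f(2) W frame_vector_fields(1)] connection_e[OF W] by (rule refl)
  \<comment> \<open>The terms containing \<open>a\<close> arise once from the rotated frame vectors
    and once, with opposite sign, from the components of \<open>Z\<close>: the curvature commutes
    with the rotation.\<close>
  finally show "D W (curv D X Y Z) - curv D (D W X) Y Z - curv D X (D W Y) Z - curv D X Y (D W Z) = 0"
    unfolding curv_vector_fields[OF D[OF W X] Y Z] curv_vector_fields[OF X D[OF W Y] Z]
      curv_vector_fields[OF X Y D[OF W Z]] d
    by (simp add: fun_eq_iff fmult_def scaleR_fun_apply algebra_simps)
qed

end

section \<open>From a Z-decomposition to the structure constants\<close>

context riemannian_lie_group_3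
begin

lemma iterated_derivs_subset:
  assumes "W \<subseteq> L" shows "iterated_derivs D W \<subseteq> L"
proof
  fix x assume "x \<in> iterated_derivs D W"
  then show "x \<in> L" by induction (use assms in auto)
qed

text \<open>Some \<open>T\<close> in the holonomy algebra moves a vector \<open>x\<close> of
  \<open>W\<close>; then \<open>T x\<close> lies in \<open>W\<close> as well and is orthogonal to
  \<open>x\<close> by skewness, so \<open>W\<close> has dimension at least two.\<close>

lemma moved_vector:
  assumes V: "subspace W" "W \<subseteq> L" "invariant_under (holonomy_group A g D) W"
    and nontrivial: "\<exists>h\<in>holonomy_group A g D. \<exists>x\<in>W. h x \<noteq> x"
  obtains x y where "x \<in> W" "y \<in> W" "x \<noteq> 0" "y \<noteq> 0" "ip x y = 0"
proof -
  have G: "holonomy_group A g D = connected_subgroup L ip H"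
    by (simp add: holonomy_group_def)
  obtain x where x: "x \<in> W" "\<not> (\<forall>T\<in>H. T x = 0)"
    using nontrivial algebra_zero_imp_fixed[OF holonomy_algebra_so] V(2) unfolding G by blast
  then obtain T where T: "T \<in> H" "T x \<noteq> 0" by blast
  have so: "T \<in> so_algebra L ip" using T holonomy_algebra_so by blast
  have xL: "x \<in> L" using x V(2) by blast
  have TW: "T x \<in> W"
    using invariant_imp_algebra_invariant[OF holonomy_algebra_so subspace_holonomy_algebra V(1,2)
        V(3)[unfolded G] T(1) x(1)] .
  have "x \<noteq> 0"
    using T(2) so_algebraD(3)[OF so, of 0 0] by auto
  moreover have "ip x (T x) = 0"
    using skew_self_orthogonal[OF so xL] ip_commute[OF xL so_algebraD(1)[OF so xL]] by simp
  ultimately show ?thesis using that x(1) TW T(2) by blast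
qed

text \<open>Two summands with nontrivial holonomy would need dimension four, so \<open>V 1\<close> is the only one; it
  is the orthogonal complement of a unit vector of \<open>Z_0\<close>, which is fixed by the holonomy.\<close>

lemma Z_decomposition_unit_normal:
  assumes "admits_Z_decomposition A g D"
  obtains n u v where "n \<in> L" "u \<in> L" "v \<in> L" "ip n n = 1" "ip u u = 1" "ip v v = 1"
    "ip n u = 0" "ip n v = 0" "ip u v = 0"
    "\<forall>x\<in>{u, v}. \<forall>y\<in>{u, v}. ip n (D x y) = 0"
    "\<forall>x\<in>L. \<forall>y\<in>L. curv D x y n = 0"
proof -
  have G: "holonomy_group A g D = connected_subgroup L ip H"
    by (simp add: holonomy_group_def)
  obtain x0 y0 z0 where R: "x0 \<in> L" "y0 \<in> L" "z0 \<in> L" "curv D x0 y0 z0 \<noteq> 0"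
    using assms unfolding admits_Z_decomposition_def by blast
  obtain k V i j where dec: "V_decomposition A g D k V" and ij: "i \<le> k" "j \<le> k" "i \<noteq> j"
    "Z_part A g D k V i \<noteq> {0}" "Z_part A g D k V j \<noteq> {0}"
    using assms unfolding admits_Z_decomposition_def by blast
  have sub: "subspace (V i)" and inv: "invariant_under (holonomy_group A g D) (V i)" if "i \<le> k" for i
    using dec that by (auto simp: V_decomposition_def)
  have orth: "ip x y = 0" if "i \<le> k" "j \<le> k" "i \<noteq> j" "x \<in> V i" "y \<in> V j" for i j x y
    using dec that unfolding V_decomposition_def by blast
  have spanV: "span (\<Union>i\<le>k. V i) = L"
    using dec by (simp add: V_decomposition_def)
  have VL: "V i \<subseteq> L" if "i \<le> k" for i
    using that unfolding spanV[symmetric] by (auto intro: span_base)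
  have fix0: "\<forall>h\<in>holonomy_group A g D. \<forall>x\<in>V 0. h x = x"
    using dec unfolding V_decomposition_def by blast
  have kill0: "curv D x y z = 0" if "x \<in> L" "y \<in> L" "z \<in> V 0" for x y z
  proof -
    have z: "z \<in> L" using VL[of 0] that(3) by blast
    have "curv_endo x y z = 0"
      by (rule fixed_imp_algebra_zero[OF holonomy_algebra_so subspace_holonomy_algebra z _
            curv_endo_holonomy[OF that(1,2)]]) (use fix0 that(3) in \<open>simp add: G\<close>)
    then show ?thesis using z by (simp add: curv_endo_def)
  qed
  have pair: "\<exists>x\<in>V i. \<exists>y\<in>V i. x \<noteq> 0 \<and> y \<noteq> 0 \<and> ip x y = 0" if "1 \<le> i" "i \<le> k" for i
  proof -
    have "\<exists>h\<in>holonomy_group A g D. \<exists>x\<in>V i. h x \<noteq> x"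
      using dec that unfolding V_decomposition_def by auto
    then show ?thesis
      using moved_vector[OF sub[OF that(2)] VL[OF that(2)] inv[OF that(2)]] by metis
  qed
  \<comment> \<open>Otherwise the trivial summand would be the whole Lie algebra and the curvature
    would vanish.\<close>
  have "k \<noteq> 0"
  proof
    assume "k = 0"
    then have "span (V 0) = L" using spanV by simp
    moreover have "span (V 0) = V 0" using sub[of 0] by (simp add: span_eq_iff)
    ultimately have "L = V 0" by (rule subst)
    with kill0 R show False by blast
  qed
  moreover have "k < 2"
  proof (rule ccontr)
    assume "\<not> k < 2"
    then have k: "1 \<le> k" "2 \<le> k" by auto
    obtain x1 y1 where 1: "x1 \<in> V 1" "y1 \<in> V 1" "x1 \<noteq> 0" "y1 \<noteq> 0" "ip x1 y1 = 0"
      using pair[of 1] k by auto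
    obtain x2 y2 where 2: "x2 \<in> V 2" "y2 \<in> V 2" "x2 \<noteq> 0" "y2 \<noteq> 0" "ip x2 y2 = 0"
      using pair[of 2] k by auto
    have m: "x1 \<in> L" "y1 \<in> L" "x2 \<in> L" "y2 \<in> L"
      using VL[OF k(1)] VL[OF k(2)] 1 2 by blast+
    have o: "ip x y = 0" if "x \<in> V 1" "y \<in> V 2" for x y
      using orth[OF k _ that] by simp
    show False
      by (rule no_four_orthogonal[OF m 1(3,4) 2(3,4) 1(5) o[OF 1(1) 2(1)] o[OF 1(1) 2(2)]
            o[OF 1(2) 2(1)] o[OF 1(2) 2(2)] 2(5)])
  qed
  ultimately have k: "k = 1" by simp
  \<comment> \<open>With \<open>k = 1\<close> two distinct indices are 0 and 1 in some
    order.\<close>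
  have "Z_part A g D k V 0 \<noteq> {0}"
    using ij k by (cases i; cases j) auto
  moreover have "0 \<in> Z_part A g D k V 0"
  proof -
    have "span (iterated_derivs D (V 1)) \<subseteq> L"
      using VL[of 1] k by (intro span_minimal iterated_derivs_subset subspace_L) auto
    then have "span (\<Union>j\<in>{1..k}. span (iterated_derivs D (V j))) \<subseteq> L"
      using k by (intro span_minimal subspace_L) auto
    then show ?thesis by (auto simp: Z_part_def)
  qed
  ultimately obtain n0 where n0: "n0 \<in> Z_part A g D k V 0" "n0 \<noteq> 0" by blast
  have n0L: "n0 \<in> L" using n0 by (simp add: Z_part_def)
  have n0o: "ip n0 y = 0" if "y \<in> iterated_derivs D (V 1)" for y
    using n0(1) that k by (auto simp: Z_part_def intro: span_base)
  obtain x1 y1 where xy: "x1 \<in> V 1" "y1 \<in> V 1" "x1 \<noteq> 0" "y1 \<noteq> 0" "ip x1 y1 = 0"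
    using pair[of 1] k by auto
  have V1: "subspace (V 1)" "V 1 \<subseteq> L" and V0: "subspace (V 0)" "V 0 \<subseteq> L"
    using sub[of 1] VL[of 1] sub[of 0] VL[of 0] k by auto
  have xyL: "x1 \<in> L" "y1 \<in> L" using V1(2) xy by blast+
  obtain c where c: "ip (c *\<^sub>R x1) (c *\<^sub>R x1) = 1" using normalize[OF xyL(1) xy(3)] by blast
  obtain d where d: "ip (d *\<^sub>R y1) (d *\<^sub>R y1) = 1" using normalize[OF xyL(2) xy(4)] by blast
  obtain b where b: "ip (b *\<^sub>R n0) (b *\<^sub>R n0) = 1" using normalize[OF n0L n0(2)] by blast
  define u v n where "u = c *\<^sub>R x1" and "v = d *\<^sub>R y1" and "n = b *\<^sub>R n0"
  have uv: "u \<in> V 1" "v \<in> V 1"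
    unfolding u_def v_def by (rule subspace_scale[OF V1(1)], rule xy)+
  have L: "n \<in> L" "u \<in> L" "v \<in> L"
    unfolding n_def u_def v_def using n0L xyL by simp_all
  have no: "ip n y = 0" if "y \<in> iterated_derivs D (V 1)" for y
    using n0o[OF that] n0L iterated_derivs_subset[OF V1(2)] that unfolding n_def by auto
  \<comment> \<open>Curvature is known to annihilate \<open>V 0\<close> only. Since \<open>n\<close>
    is orthogonal to \<open>V 1\<close>, its component \<open>a1\<close> there is orthogonal to
    itself.\<close>
  have nV: "n \<in> V 0"
  proof -
    have "(\<Union>i\<le>k. V i) = V 0 \<union> V 1"
      using k by (auto simp: le_Suc_eq)
    then have "n \<in> span (V 0 \<union> V 1)"
      using spanV L(1) by simp
    then obtain a0 a1 where a: "n = a0 + a1" "a0 \<in> span (V 0)" "a1 \<in> span (V 1)"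
      unfolding span_Un by blast
    have a0: "a0 \<in> V 0" and a1: "a1 \<in> V 1"
      using a span_minimal[OF order_refl V0(1)] span_minimal[OF order_refl V1(1)] by blast+
    have aL: "a0 \<in> L" "a1 \<in> L" using a0 a1 V0(2) V1(2) by blast+
    have "ip a0 a1 + ip a1 a1 = 0"
      using no[OF iterated_derivs.base[OF a1]] aL unfolding a(1) by simp
    moreover have "ip a0 a1 = 0"
      using orth[of 0 1 a0 a1] a0 a1 k by simp
    ultimately have "a1 = 0" using ip_self_eq_0[OF aL(2)] by simp
    then show ?thesis using a(1) a0 by simp
  qed
  show ?thesis
  proof (rule that[OF L])
    show "ip n n = 1" "ip u u = 1" "ip v v = 1"
      using b c d by (simp_all only: n_def u_def v_def)
    show "ip n u = 0" "ip n v = 0"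
      using no[OF iterated_derivs.base] uv by blast+
    show "ip u v = 0" using xyL xy(5) by (simp add: u_def v_def)
    show "\<forall>x\<in>{u, v}. \<forall>y\<in>{u, v}. ip n (D x y) = 0"
      using no[OF iterated_derivs.step[OF _ iterated_derivs.base]] uv by simp
    show "\<forall>x\<in>L. \<forall>y\<in>L. curv D x y n = 0"
      using kill0 nV by blast
  qed
qed

text \<open>The normal vector is parallel, so the connection is \<open>D x = \<mu> x *\<^sub>R J\<close> with the rotation \<open>J\<close> of
  the plane spanned by \<open>u\<close> and \<open>v\<close>, and the Jacobi identity forces \<open>\<mu> n = 0\<close>.\<close>

theorem Z_decomposition_imp_solvable_frame:
  assumes "admits_Z_decomposition A g D"
  obtains e1 e2 e3 a where "solvable_frame A g D e1 e2 e3 a"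
proof -
  obtain n u v where L [simp]: "n \<in> L" "u \<in> L" "v \<in> L"
    and unit [simp]: "ip n n = 1" "ip u u = 1" "ip v v = 1"
    and orth [simp]: "ip n u = 0" "ip n v = 0" "ip u v = 0"
    and closed: "\<forall>x\<in>{u, v}. \<forall>y\<in>{u, v}. ip n (D x y) = 0"
    and flat: "\<forall>x\<in>L. \<forall>y\<in>L. curv D x y n = 0"
    by (rule Z_decomposition_unit_normal[OF assms])
  have orth' [simp]: "ip u n = 0" "ip v n = 0" "ip v u = 0"
    using ip_commute[of u n] ip_commute[of v n] ip_commute[of v u] by simp_all
  have ex: "x = ip x u *\<^sub>R u + ip x v *\<^sub>R v + ip x n *\<^sub>R n" if "x \<in> L" for x
    by (rule orthonormal_expansion) (simp_all add: that)
  \<comment> \<open>Skewness moves the derivative from \<open>n\<close> to \<open>u\<close> and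
    \<open>v\<close>, where \<open>closed\<close> applies.\<close>
  have Dn0: "D x n = 0" if "x = u \<or> x = v" for x
  proof -
    have x: "x \<in> L" using that by auto
    have "ip (D x n) u = 0" "ip (D x n) v = 0" "ip (D x n) n = 0"
      using closed that connection_skew[OF x, of n u] connection_skew[OF x, of n v]
        connection_orthogonal[OF x, of n] by auto
    then show ?thesis using ex[of "D x n"] x by simp
  qed
  define w where "w = D n n"
  have wL [simp]: "w \<in> L" by (simp add: w_def)
  have Dn: "D z n = ip z n *\<^sub>R w" if "z \<in> L" for z
  proof -
    have "D z n = D (ip z u *\<^sub>R u + ip z v *\<^sub>R v + ip z n *\<^sub>R n) n"
      using ex[OF that] by simp
    then show ?thesis by (simp add: Dn0 w_def)
  qed
  have wn: "ip w n = 0"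
    by (simp add: w_def connection_orthogonal)
  \<comment> \<open>Since \<open>D w n = 0\<close>, the bracket of \<open>w\<close> and
    \<open>n\<close> has inner product |w|^2 with \<open>n\<close>, so R(w, n) n = |w|^2 w - D w w.
    The last term is orthogonal to \<open>w\<close>, and the pairing with \<open>w\<close> leaves
    |w|^4 = 0.\<close>
  have "w = 0"
  proof -
    have "ip (D n w) n = - ip w w"
      using connection_skew[of n w n] by (simp add: w_def)
    then have "ip (bracket w n) n = ip w w"
      using Dn[OF wL] wn by (simp add: bracket_eq)
    then have "curv D w n n = ip w w *\<^sub>R w - D w w"
      using wn by (simp add: curv_def Dn)
    then have "ip (ip w w *\<^sub>R w - D w w) w = 0"
      using flat by simp
    then show ?thesis by (simp add: connection_orthogonal ip_self_eq_0)
  qed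
  then have Dn [simp]: "D z n = 0" if "z \<in> L" for z
    using Dn[OF that] by simp
  define \<mu> where "\<mu> x = ip (D x u) v" for x
  define J where "J z = ip z u *\<^sub>R v - ip z v *\<^sub>R u" for z
  have JL [simp]: "J z \<in> L" for z by (simp add: J_def)
  have Du: "D x u = \<mu> x *\<^sub>R v" and Dv: "D x v = (- \<mu> x) *\<^sub>R u" if x: "x \<in> L" for x
  proof -
    have "ip (D x u) n = 0" "ip (D x v) n = 0" "ip (D x v) u = - \<mu> x"
      using connection_skew[OF x, of u n] connection_skew[OF x, of v n] connection_skew[OF x, of v u]
        ip_commute[of v "D x u"] x by (simp_all add: \<mu>_def)
    then show "D x u = \<mu> x *\<^sub>R v" "D x v = (- \<mu> x) *\<^sub>R u"
      using ex[of "D x u"] ex[of "D x v"] x connection_orthogonal[OF x, of u] connection_orthogonal[OF x, of v]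
      by (simp_all add: \<mu>_def)
  qed
  have DJ: "D x z = \<mu> x *\<^sub>R J z" if "x \<in> L" "z \<in> L" for x z
  proof -
    have "D x z = D x (ip z u *\<^sub>R u + ip z v *\<^sub>R v + ip z n *\<^sub>R n)"
      using ex[OF that(2)] by simp
    then show ?thesis
      using that(1) by (simp add: Du Dv J_def algebra_simps)
  qed
  have \<mu>: "\<mu> z = \<mu> u * ip z u + \<mu> v * ip z v + \<mu> n * ip z n" if "z \<in> L" for z
  proof -
    have "\<mu> z = ip (D (ip z u *\<^sub>R u + ip z v *\<^sub>R v + ip z n *\<^sub>R n) u) v"
      using ex[OF that] by (simp add: \<mu>_def)
    then show ?thesis by (simp add: \<mu>_def)
  qed
  have br: "bracket x y = \<mu> x *\<^sub>R J y - \<mu> y *\<^sub>R J x" if "x \<in> L" "y \<in> L" for x y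
    using that by (simp add: bracket_eq DJ)
  have curv: "curv D x y z = \<mu> (bracket x y) *\<^sub>R J z" if "x \<in> L" "y \<in> L" "z \<in> L" for x y z
  proof -
    have "J (c *\<^sub>R J z) = c *\<^sub>R J (J z)" for c z
      by (simp add: J_def algebra_simps)
    then show ?thesis using that by (simp add: curv_def DJ mult.commute)
  qed
  have Jn: "J n = 0" "J u = v" "J v = - u" by (simp_all add: J_def)
  define p q where "p = \<mu> u" and "q = \<mu> v"
  \<comment> \<open>Only the first term survives: [v, n] and [n, u] are multiples of
    \<open>u\<close> and \<open>v\<close>, which bracket to zero with \<open>u\<close> and
    \<open>v\<close>. What remains is \<mu>(n) J [u, v] = 0.\<close>
  have "bracket n (bracket u v) + bracket u (bracket v n) + bracket v (bracket n u) = 0"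
    by (intro Jacobi_identity lie_algebra_vector_field L)
  moreover have "bracket n (bracket u v) = (- \<mu> n * p) *\<^sub>R v + (\<mu> n * q) *\<^sub>R u"
    "bracket v n = \<mu> n *\<^sub>R u" "bracket n u = \<mu> n *\<^sub>R v"
    by (simp_all add: br Jn p_def q_def J_def algebra_simps)
  moreover have "bracket x (c *\<^sub>R x) = 0" if "x \<in> L" for c x
    using that by (simp add: bracket_eq)
  ultimately have J0: "(- \<mu> n * p) *\<^sub>R v + (\<mu> n * q) *\<^sub>R u = 0"
    by simp
  have "\<mu> n * p = 0" "\<mu> n * q = 0"
    using arg_cong[OF J0, of "\<lambda>x. ip x v"] arg_cong[OF J0, of "\<lambda>x. ip x u"] by simp_all
  \<comment> \<open>Brackets lie in the plane, the range of \<open>J\<close>. If \<mu> vanished on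
    the plane, it would vanish on all brackets and the curvature would be zero.\<close>
  moreover have pq: "p \<noteq> 0 \<or> q \<noteq> 0"
  proof (rule ccontr)
    assume "\<not> ?thesis"
    then have "\<mu> (bracket x y) = 0" if "x \<in> L" "y \<in> L" for x y
      using that \<mu>[of "bracket x y"] by (simp add: br J_def p_def q_def)
    then have "curv D x y z = 0" if "x \<in> L" "y \<in> L" "z \<in> L" for x y z
      using that by (simp add: curv)
    then show False using assms unfolding admits_Z_decomposition_def by blast
  qed
  ultimately have \<mu>n: "\<mu> n = 0" by auto
  define r where "r = sqrt (p\<^sup>2 + q\<^sup>2)"
  have r2: "r * r = p * p + q * q"
    by (simp add: r_def power2_eq_square)
  have r: "r > 0"
    using pq by (auto simp: r_def sum_power2_gt_zero_iff)
  \<comment> \<open>[u, v] = - p u - q v has length \<open>r\<close>; \<open>e2\<close> is its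
    direction and \<open>e1 = - J e2\<close>. With this orientation \<mu>(e2) = - r and
    \<open>J e1 = e2\<close>, so the constant comes out as \<open>r\<close>, which is
    positive.\<close>
  define e1 where "e1 = (- q / r) *\<^sub>R u + (p / r) *\<^sub>R v"
  define e2 where "e2 = (- p / r) *\<^sub>R u + (- q / r) *\<^sub>R v"
  have eL [simp]: "e1 \<in> L" "e2 \<in> L" by (simp_all add: e1_def e2_def)
  have \<mu>e: "\<mu> e1 = 0" "\<mu> e2 = - r"
    using r r2 \<mu>[OF eL(1)] \<mu>[OF eL(2)] \<mu>n
    by (simp_all add: e1_def e2_def flip: p_def q_def) (simp_all add: field_simps)
  have Je1: "J e1 = e2"
    by (simp add: J_def e1_def e2_def algebra_simps)
  have "solvable_frame A g D e1 e2 n r"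
  proof
    have "(p * p + q * q) / (r * r) = 1"
      unfolding r2[symmetric] using r by simp
    then show "ip e1 e1 = 1" "ip e2 e2 = 1"
      by (simp_all add: e1_def e2_def add_divide_distrib add.commute)
    show "ip e1 e2 = 0"
      by (simp add: e1_def e2_def)
    show "ip e1 n = 0" "ip e2 n = 0"
      by (simp_all add: e1_def e2_def)
    show "bracket e1 e2 = r *\<^sub>R e2" "bracket e1 n = 0" "bracket e2 n = 0"
      by (simp_all add: br \<mu>e \<mu>n Jn Je1)
  qed (use r in auto)
  then show ?thesis by (rule that)
qed

text \<open>Only the brackets with i < j carry information; the other constants are forced by
  antisymmetry, which is why \<open>C 2 1 2 = - a\<close> accompanies
  \<open>C 1 2 2 = a\<close>.\<close>

lemma solvable_frame_iff:
  "(\<exists>e1 e2 e3 a. solvable_frame A g D e1 e2 e3 a) \<longleftrightarrow>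
    (\<exists>e a C. a > 0 \<and> orthonormal_basis L ip 3 e \<and> structure_constants 3 e C \<and>
      C 1 2 2 = a \<and> C 2 1 2 = - a \<and>
      (\<forall>i\<in>{1..3}. \<forall>j\<in>{1..3}. \<forall>k\<in>{1..3}.
         (i, j, k) \<noteq> (1, 2, 2) \<and> (i, j, k) \<noteq> (2, 1, 2) \<longrightarrow> C i j k = 0))"
  (is "?F \<longleftrightarrow> ?C")
proof
  have I: "{1..3} = {1, 2, 3::nat}" by auto
  {
    assume ?F
    then obtain e1 e2 e3 a where "solvable_frame A g D e1 e2 e3 a" by blast
    then interpret solvable_frame A g D e1 e2 e3 a .
    define e where "e i = (if i = 1 then e1 else if i = 2 then e2 else e3)" for i :: nat
    define C where "C i j k = (if (i, j, k) = (1, 2, 2) then a else if (i, j, k) = (2, 1, 2) then - a else 0)"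
      for i j k :: nat
    have "span (e ` {1..3}) = L"
    proof (rule antisym)
      show "span (e ` {1..3}) \<subseteq> L"
        using subspace_L by (intro span_minimal) (auto simp: e_def)
      have m: "e1 \<in> span (e ` {1..3})" "e2 \<in> span (e ` {1..3})" "e3 \<in> span (e ` {1..3})"
        unfolding I by (auto simp: e_def intro: span_base)
      show "L \<subseteq> span (e ` {1..3})"
      proof
        fix x assume "x \<in> L"
        from expansion[OF this] span_add[OF span_add[OF span_scale[OF m(1)] span_scale[OF m(2)]] span_scale[OF m(3)]]
        show "x \<in> span (e ` {1..3})" by metis
      qed
    qed
    then have "orthonormal_basis L ip 3 e"
      unfolding orthonormal_basis_def I by (simp add: e_def)
    moreover have "structure_constants 3 e C"
      unfolding structure_constants_def I
      by (simp add: e_def C_def brackets brackets')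
    ultimately show ?C
      using a_pos by (intro exI[of _ e] exI[of _ a] exI[of _ C]) (auto simp: C_def)
  }
  assume ?C
  then obtain e a C where a: "a > 0" and e: "orthonormal_basis L ip 3 e" and s: "structure_constants 3 e C"
    and C: "C 1 2 2 = a" "C 2 1 2 = - a" "\<forall>i\<in>{1..3}. \<forall>j\<in>{1..3}. \<forall>k\<in>{1..3}.
         (i, j, k) \<noteq> (1, 2, 2) \<and> (i, j, k) \<noteq> (2, 1, 2) \<longrightarrow> C i j k = 0"
    by blast
  have eL: "e i \<in> L" if "i \<in> {1..3}" for i
  proof -
    have "e i \<in> span (e ` {1..3})" using that by (intro span_base imageI)
    then show ?thesis using e by (simp only: orthonormal_basis_def)
  qed
  have b: "bracket (e i) (e j) = C i j 1 *\<^sub>R e 1 + C i j 2 *\<^sub>R e 2 + C i j 3 *\<^sub>R e 3"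
    if "i \<in> {1..3}" "j \<in> {1..3}" for i j
  proof -
    have "bracket (e i) (e j) = (\<Sum>k=1..3. C i j k *\<^sub>R e k)"
      using s that unfolding structure_constants_def by blast
    also have "\<dots> = C i j 1 *\<^sub>R e 1 + C i j 2 *\<^sub>R e 2 + C i j 3 *\<^sub>R e 3"
      unfolding I by (simp add: add.assoc)
    finally show ?thesis .
  qed
  have "solvable_frame A g D (e 1) (e 2) (e 3) a"
  proof
    show "e 1 \<in> L" "e 2 \<in> L" "e 3 \<in> L" by (simp_all add: eL)
    show "ip (e 1) (e 1) = 1" "ip (e 2) (e 2) = 1" "ip (e 3) (e 3) = 1"
      "ip (e 1) (e 2) = 0" "ip (e 1) (e 3) = 0" "ip (e 2) (e 3) = 0"
      using e by (simp_all add: orthonormal_basis_def)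
    show "bracket (e 1) (e 2) = a *\<^sub>R e 2" "bracket (e 1) (e 3) = 0" "bracket (e 2) (e 3) = 0"
      using C by (simp_all add: b)
  qed (rule a)
  then show ?F by blast
qed

end

theorem theorem4p2:
  fixes A :: "('g::{topological_group_add, t2_space, second_countable_topology}, real^3) atlas"
    and g :: "'g metric"
    and D :: "'g connection"
  assumes "lie_group A"
    and "connected (UNIV :: 'g set)"
    and "left_invariant_metric A g"
    and "levi_civita A g D"
  shows "(admits_Z_decomposition A g D \<longleftrightarrow>
           (\<exists>e a C. a > 0 \<and> orthonormal_basis (lie_algebra A) (inner_prod g) 3 e \<and>
              structure_constants 3 e C \<and>
              C 1 2 2 = a \<and> C 2 1 2 = - a \<and>
              (\<forall>i\<in>{1..3}. \<forall>j\<in>{1..3}. \<forall>k\<in>{1..3}.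
                 (i, j, k) \<noteq> (1, 2, 2) \<and> (i, j, k) \<noteq> (2, 1, 2) \<longrightarrow> C i j k = 0)))
         \<and> (admits_Z_decomposition A g D \<longrightarrow> locally_symmetric A D)"
proof -
  interpret riemannian_lie_group_3 A g D
    by unfold_locales (fact assms)+
  have "admits_Z_decomposition A g D \<longleftrightarrow> (\<exists>e1 e2 e3 a. solvable_frame A g D e1 e2 e3 a)"
    using Z_decomposition_imp_solvable_frame solvable_frame.admits_Z_decomposition by metis
  moreover have "locally_symmetric A D" if "admits_Z_decomposition A g D"
    using Z_decomposition_imp_solvable_frame[OF that] solvable_frame.locally_symmetric by metis
  ultimately show ?thesis
    unfolding solvable_frame_iff by blast
qed

end
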